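(* In the faulty RAM (FRAM) model, there exists a deterministic resilient selection algorithm with (worst-case) time complexity $O(n)$, where $n$ is the size of the input array.
   Context: FRAM model: memory cells may be corrupted (their contents changed arbitrarily, adversarially) at any time during the execution of an algorithm, the same cell possibly several times, and the algorithm cannot distinguish corrupted from uncorrupted cells. There are $O(1)$ reliable memory cells that are never corrupted. An upper bound $\delta$ on the number of corruptions is given to the algorithm as auxiliary input; $\alpha\le\delta$ denotes the actual number of corruptions that occur during the execution. A memory cell holds $\Theta(\log n)$ bits. For an array $X$ of elements from a totally ordered set and an element $e$, $\mathrm{rank}_X(e)=|\{i : X[i]\le e\}|$, and the $\alpha$-rank of $k$ in $X$ is the set $\{e : \mathrm{rank}_X(e)\in[k-\alpha,k+\alpha]\}$. A resilient $k$-selection (selection) algorithm is given an array $X$ of size $n$ and an integer $k$ and always returns an element $e$ (possibly corrupted, possibly not originally in $X$) that lies in the $\alpha$-rank of $k$ in $X^0$, where $X^0$ is the state of $X$ at the beginning of the execution and $\alpha$ is the number of corruptions that occurred during the execution.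
   Formalization: If X has equal entries the α-rank of k can be empty, so there the returned element may count with any rank of the positions it occupies in sorted order; for distinct entries the α-rank is literal. Cells are taken to hold at least c·log(n+1) bits, with c chosen by the algorithm. *)

theory Defs
  imports Complex_Main "HOL-Library.Landau_Symbols"
begin

section \<open>Programs of the faulty RAM\<close>

text \<open>
  A program works on registers, which are the reliable memory cells (a program mentions only
  finitely many of them, hence \<open>O(1)\<close>), and on an unreliable memory of \<open>2 ^ w\<close> cells. Registers and
  memory cells hold \<open>w\<close>-bit words, i.e. naturals below \<open>2 ^ w\<close>; arithmetic is modulo \<open>2 ^ w\<close>.
  The code itself is reliable, as usual. Neither \<open>w\<close> nor the order of the elements is known to a
  program.
\<close>

datatype aexp =
    N nat
  | R nat
  | Plus aexp aexp
  | Minus aexp aexp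
  | Times aexp aexp
  | Div aexp aexp
  | Mod aexp aexp

text \<open>
  Array elements are words, ordered by an arbitrary linear order \<open>le\<close> on the words that need not be
  the numeric one. \<open>Elem_le\<close> compares two words with respect to \<open>le\<close>; \<open>Less\<close> is the
  numeric comparison.
\<close>

datatype bexp =
    Less aexp aexp
  | Eq aexp aexp
  | Elem_le aexp aexp
  | Not bexp
  | And bexp bexp

datatype com =
    SKIP
  | Assign nat aexp
  | Load nat aexp
  | Store aexp aexp
  | Seq com com
  | If bexp com com
  | While bexp com

type_synonym regs = "nat \<Rightarrow> nat"
type_synonym mem = "nat \<Rightarrow> nat"
type_synonym config = "com \<times> regs \<times> mem"

fun aval :: "nat \<Rightarrow> aexp \<Rightarrow> regs \<Rightarrow> nat" where
  "aval w (N c) s = c mod 2 ^ w"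
| "aval w (R i) s = s i"
| "aval w (Plus a b) s = (aval w a s + aval w b s) mod 2 ^ w"
| "aval w (Minus a b) s = nat ((int (aval w a s) - int (aval w b s)) mod 2 ^ w)"
| "aval w (Times a b) s = (aval w a s * aval w b s) mod 2 ^ w"
| "aval w (Div a b) s = aval w a s div aval w b s"
| "aval w (Mod a b) s = aval w a s mod aval w b s"

fun bval :: "nat \<Rightarrow> nat rel \<Rightarrow> bexp \<Rightarrow> regs \<Rightarrow> bool" where
  "bval w le (Less a b) s \<longleftrightarrow> aval w a s < aval w b s"
| "bval w le (Eq a b) s \<longleftrightarrow> aval w a s = aval w b s"
| "bval w le (Elem_le a b) s \<longleftrightarrow> (aval w a s, aval w b s) \<in> le"
| "bval w le (Not b) s \<longleftrightarrow> \<not> bval w le b s"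
| "bval w le (And b c) s \<longleftrightarrow> bval w le b s \<and> bval w le c s"

text \<open>
  One step of the machine. Since \<open>step\<close> is a function, programs are deterministic.
  A step accesses at most one memory cell; expressions only involve registers, and since they have
  bounded size in a fixed program, charging one time unit per step is accurate up to a constant
  factor.
\<close>

fun step :: "nat \<Rightarrow> nat rel \<Rightarrow> config \<Rightarrow> config" where
  "step w le (SKIP, s, m) = (SKIP, s, m)"
| "step w le (Assign x a, s, m) = (SKIP, s(x := aval w a s), m)"
| "step w le (Load x a, s, m) = (SKIP, s(x := m (aval w a s)), m)"
| "step w le (Store a b, s, m) = (SKIP, s, m(aval w a s := aval w b s))"
| "step w le (Seq c d, s, m) =
     (if c = SKIP then (d, s, m)
      else let (c', s', m') = step w le (c, s, m) in (Seq c' d, s', m'))"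
| "step w le (If b c d, s, m) = (if bval w le b s then c else d, s, m)"
| "step w le (While b c, s, m) =
     (if bval w le b s then Seq c (While b c) else SKIP, s, m)"

text \<open>
  \<open>run w le cf t \<alpha> cf'\<close>: the configuration \<open>cf'\<close> can be reached from \<open>cf\<close> by \<open>t\<close> machine steps
  interleaved with \<open>\<alpha>\<close> corruptions. The adversary may write any word to any memory cell at any time
  before the program halts (which it does by reaching \<open>SKIP\<close>).
\<close>

inductive run :: "nat \<Rightarrow> nat rel \<Rightarrow> config \<Rightarrow> nat \<Rightarrow> nat \<Rightarrow> config \<Rightarrow> bool"
  for w :: nat and le :: "nat rel" and cf :: config where
  start: "run w le cf 0 0 cf"
| instr: "run w le cf t \<alpha> (c, s, m) \<Longrightarrow> c \<noteq> SKIP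
    \<Longrightarrow> run w le cf (Suc t) \<alpha> (step w le (c, s, m))"
| corrupt: "run w le cf t \<alpha> (c, s, m) \<Longrightarrow> c \<noteq> SKIP \<Longrightarrow> i < 2 ^ w \<Longrightarrow> v < 2 ^ w
    \<Longrightarrow> run w le cf t (Suc \<alpha>) (c, s, m(i := v))"


section \<open>Resilient selection\<close>

text \<open>In the following, \<open>X\<close> is an array with cells \<open>X 0, \<dots>, X (n - 1)\<close>.\<close>

definition rank :: "nat rel \<Rightarrow> nat \<Rightarrow> (nat \<Rightarrow> nat) \<Rightarrow> nat \<Rightarrow> nat" where
  "rank le n X e = card {i. i < n \<and> (X i, e) \<in> le}"

definition strict_rank :: "nat rel \<Rightarrow> nat \<Rightarrow> (nat \<Rightarrow> nat) \<Rightarrow> nat \<Rightarrow> nat" where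
  "strict_rank le n X e = card {i. i < n \<and> (X i, e) \<in> le \<and> X i \<noteq> e}"

definition alpha_rank :: "nat rel \<Rightarrow> nat \<Rightarrow> (nat \<Rightarrow> nat) \<Rightarrow> nat \<Rightarrow> nat \<Rightarrow> nat set" where
  "alpha_rank le n X \<alpha> k =
     {e \<in> Field le. int (rank le n X e) \<in> {int k - int \<alpha> .. int k + int \<alpha>}}"

text \<open>
  If \<open>X\<close> has equal entries, then \<open>alpha_rank\<close> may be empty even though \<open>1 \<le> k \<le> n\<close> (if all entries
  are equal, no element has rank \<open>1 < n\<close>). In that case, an element of \<open>X\<close> has all the ranks
  of the positions that it occupies when \<open>X\<close> is sorted.
\<close>

definition ranks :: "nat rel \<Rightarrow> nat \<Rightarrow> (nat \<Rightarrow> nat) \<Rightarrow> nat \<Rightarrow> nat set" where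
  "ranks le n X e = insert (rank le n X e) {strict_rank le n X e <.. rank le n X e}"

definition alpha_rank_ties :: "nat rel \<Rightarrow> nat \<Rightarrow> (nat \<Rightarrow> nat) \<Rightarrow> nat \<Rightarrow> nat \<Rightarrow> nat set" where
  "alpha_rank_ties le n X \<alpha> k =
     {e \<in> Field le. \<exists>r \<in> ranks le n X e. int r \<in> {int k - int \<alpha> .. int k + int \<alpha>}}"

lemma alpha_rank_ties_eq_alpha_rank:
  assumes "inj_on X {..<n}"
  shows "alpha_rank_ties le n X \<alpha> k = alpha_rank le n X \<alpha> k"
proof -
  have "ranks le n X e = {rank le n X e}" for e
  proof -
    let ?E = "{i. i < n \<and> X i = e}"
    have "card ?E \<le> 1"
      using assms by (auto simp: card_le_Suc0_iff_eq inj_on_def)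
    moreover have "rank le n X e \<le> card ({i. i < n \<and> (X i, e) \<in> le \<and> X i \<noteq> e} \<union> ?E)"
      unfolding rank_def by (rule card_mono) auto
    ultimately have "rank le n X e \<le> Suc (strict_rank le n X e)"
      using card_Un_le[of "{i. i < n \<and> (X i, e) \<in> le \<and> X i \<noteq> e}" ?E]
      unfolding strict_rank_def by linarith
    then show ?thesis by (auto simp: ranks_def)
  qed
  then show ?thesis by (simp add: alpha_rank_ties_def alpha_rank_def)
qed

text \<open>
  The array \<open>X\<close> is passed in the memory cells \<open>0, \<dots>, n - 1\<close>, and all other cells have arbitrary
  initial contents. The numbers \<open>n\<close>, \<open>k\<close> and the bound \<open>\<delta>\<close> on the number of corruptions are passed
  in reliable registers; the result is returned in register 0.
\<close>

definition init_regs :: "nat \<Rightarrow> nat \<Rightarrow> nat \<Rightarrow> regs" where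
  "init_regs n k \<delta> = (\<lambda>_. 0)(0 := n, 1 := k, 2 := \<delta>)"

definition valid_input ::
    "nat \<Rightarrow> nat \<Rightarrow> nat rel \<Rightarrow> nat \<Rightarrow> nat \<Rightarrow> mem \<Rightarrow> bool" where
  "valid_input w n le k \<delta> X \<longleftrightarrow>
     linear_order_on {..<2 ^ w} le \<and> k \<in> {1..n} \<and> \<delta> < 2 ^ w \<and> (\<forall>i. X i < 2 ^ w)"

definition resilient_selection :: "com \<Rightarrow> nat \<Rightarrow> nat \<Rightarrow> bool" where
  "resilient_selection P w n \<longleftrightarrow>
     (\<forall>le k \<delta> X t \<alpha> s m.
        valid_input w n le k \<delta> X \<longrightarrow>
        run w le (P, init_regs n k \<delta>, X) t \<alpha> (SKIP, s, m) \<longrightarrow> \<alpha> \<le> \<delta> \<longrightarrow>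
        s 0 \<in> (if inj_on X {..<n} then alpha_rank le n X \<alpha> k else alpha_rank_ties le n X \<alpha> k))"

text \<open>
  No execution, complete or not, takes more than \<open>T\<close> steps. As every configuration with
  a command other than \<open>SKIP\<close> admits a further step, this includes termination.
\<close>

definition time_bounded :: "com \<Rightarrow> nat \<Rightarrow> nat \<Rightarrow> nat \<Rightarrow> bool" where
  "time_bounded P w n T \<longleftrightarrow>
     (\<forall>le k \<delta> X t \<alpha> cf.
        valid_input w n le k \<delta> X \<longrightarrow>
        run w le (P, init_regs n k \<delta>, X) t \<alpha> cf \<longrightarrow> \<alpha> \<le> \<delta> \<longrightarrow> t \<le> T)"

text \<open>
  Word sizes, as a function of the input size: \<open>\<Theta>(log n)\<close> bits, and at least \<open>c * log 2 (n + 1)\<close>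
  so that a word can address the input and a workspace of polynomial size.
\<close>

definition word_size :: "nat \<Rightarrow> (nat \<Rightarrow> nat) \<Rightarrow> bool" where
  "word_size c w \<longleftrightarrow>
     (\<lambda>n. real (w n)) \<in> \<Theta>(\<lambda>n. ln (real n)) \<and>
     (\<forall>n \<ge> 1. real c * log 2 (real n + 1) \<le> real (w n))"

end

theory Submission
  imports Defs
begin

text \<open>
  The algorithm is an iterative version of quickselect with median-of-medians pivots. All control
  information is kept in registers: a stage at the top level holds the current array, a rank and an
  interval of keys, and the recursion that searches for a pivot only needs one base-8 digit per
  level, because an instance of size \<open>8 ^ e\<close> always has a subinstance of size \<open>8 ^ (e - 1)\<close>; the digits
  are packed into one register.

  A pivot of an instance \<open>A\<close> of size \<open>64 x\<close> must have at least \<open>8 x\<close> elements of \<open>A\<close> on either side, and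
  this is always verified by counting. To find one, take the medians of \<open>12 x\<close> groups of five, and
  search recursively for a pivot of the first \<open>8 x\<close> medians. If it turns out to be too small for \<open>A\<close>,
  discard \<open>x\<close> medians that do not exceed it, and repeat; similarly if it is too large. Three failures
  on the same side exhibit \<open>9 x\<close> elements of \<open>A\<close> among its \<open>8 x\<close> smallest, up to the number of
  corruptions of the two arrays of this level. So five failures are paid for by \<open>x / 20\<close> corruptions,
  and then the search restarts at this level. Since every cell belongs to at most two levels, the total
  time is \<open>O(n + \<alpha>)\<close>. A fuel register cuts the execution off after \<open>O(n)\<close> steps; if it runs out, then
  \<open>\<alpha> \<ge> n\<close>, and any answer is correct.

  For the exact bound \<open>\<alpha>\<close> on the error of the rank, it is enough that every element is read once when the
  array is partitioned, and that afterwards ranks only matter for keys inside the current interval: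
  every corruption then changes each of the relevant counts by at most one.
\<close>

section \<open>Runs with corruptions and a Hoare logic\<close>

text \<open>With one unit of fuel per cell, a level of size \<open>64 x\<close> spends
  \<open>64 x\<close> on its medians and \<open>40 x + 8 x\<close> on each of at most five subcalls
  of size \<open>8 x\<close> with their returns: \<open>304 x\<close>, within the
  \<open>5 * 64 x\<close> charged for it. This is linear because 5/8 < 1; starting with
  \<open>12 x\<close> medians and losing \<open>x\<close> per failure leaves \<open>8 x\<close> for
  the fifth subcall. A restart needs \<open>320 x\<close> again and comes with
  \<open>x \<le> 20 * f\<close>, hence the price of 6400 units per corruption. A partition with a
  verified pivot removes an eighth of the outermost instance size \<open>N\<close>, up to
  corruptions; at 96 units per element this frees \<open>12 * N\<close>, against
  \<open>6 * N\<close> spent on search and partition. As a corruption counts at two levels at most,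
  the demand is at most \<open>96 * n + 12800 * \<alpha>\<close>, and the supply
  \<open>16384 * n\<close> exceeds it unless \<open>n \<le> \<alpha>\<close>. The rigid sizes and
  the verification answer one obstacle: a recursion stack in memory could be corrupted, and no value
  read from memory can be trusted.\<close>

inductive adv :: "nat \<Rightarrow> mem \<Rightarrow> nat \<Rightarrow> mem \<Rightarrow> bool" for w :: nat and m :: mem where
  adv_refl: "adv w m 0 m"
| adv_step: "adv w m \<alpha> m' \<Longrightarrow> i < 2 ^ w \<Longrightarrow> v < 2 ^ w \<Longrightarrow> adv w m (Suc \<alpha>) (m'(i := v))"

section \<open>Decomposition of runs at the first instruction and at sequences\<close>

lemma run_SKIP:
  "run w le cf t \<alpha> cf' \<Longrightarrow> cf = (SKIP, s, m) \<Longrightarrow> t = 0 \<and> \<alpha> = 0 \<and> cf' = (SKIP, s, m)"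
  by (induction rule: run.induct) auto

text \<open>Runs grow at their end, whereas Hoare rules look at their beginning. Before the first
  instruction the adversary may write any number of times, possibly without the instruction ever
  being executed.\<close>

lemma run_first:
  assumes "run w le cf t \<alpha> cf'" and "cf = (c, s, m)" and "c \<noteq> SKIP"
  shows "(\<exists>m'. t = 0 \<and> adv w m \<alpha> m' \<and> cf' = (c, s, m')) \<or>
    (\<exists>\<alpha>1 m1 \<alpha>2 t'. adv w m \<alpha>1 m1 \<and> run w le (step w le (c, s, m1)) t' \<alpha>2 cf' \<and>
       t = Suc t' \<and> \<alpha> = \<alpha>1 + \<alpha>2)"
  using assms
proof (induction rule: run.induct)
  case start
  then show ?case by (auto intro: adv_refl)
next
  case (instr t \<alpha> c' s' m')
  then consider (a) "t = 0" "adv w m \<alpha> m'" "c' = c" "s' = s"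
    | (b) \<alpha>1 m1 \<alpha>2 t' where "adv w m \<alpha>1 m1" "run w le (step w le (c, s, m1)) t' \<alpha>2 (c', s', m')"
       "t = Suc t'" "\<alpha> = \<alpha>1 + \<alpha>2"
    by auto
  then show ?case
  proof cases
    case a
    then show ?thesis using run.start by fastforce
  next
    case b
    then show ?thesis using run.instr[OF b(2) \<open>c' \<noteq> SKIP\<close>] by blast
  qed
next
  case (corrupt t \<alpha> c' s' m' i v)
  then consider (a) "t = 0" "adv w m \<alpha> m'" "c' = c" "s' = s"
    | (b) \<alpha>1 m1 \<alpha>2 t' where "adv w m \<alpha>1 m1" "run w le (step w le (c, s, m1)) t' \<alpha>2 (c', s', m')"
       "t = Suc t'" "\<alpha> = \<alpha>1 + \<alpha>2"
    by auto
  then show ?case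
  proof cases
    case a
    then show ?thesis using corrupt adv_step by blast
  next
    case b
    then show ?thesis using run.corrupt[OF b(2) \<open>c' \<noteq> SKIP\<close> \<open>i < 2 ^ w\<close> \<open>v < 2 ^ w\<close>]
      by (metis add_Suc_right)
  qed
qed

text \<open>\<open>Seq SKIP d\<close> has not halted, so the adversary can still write after
  \<open>c\<close> has ended and before \<open>d\<close> starts. This is the middle piece of the
  decomposition; the additional time unit is the step that removes \<open>SKIP\<close>.\<close>

lemma run_Seq:
  assumes "run w le cf t \<alpha> cf'" and "cf = (Seq c d, s, m)"
  shows "(\<exists>c' s' m' m1 \<alpha>1 \<alpha>2. cf' = (Seq c' d, s', m') \<and> run w le (c, s, m) t \<alpha>1 (c', s', m1) \<and>
       adv w m1 \<alpha>2 m' \<and> (c' \<noteq> SKIP \<longrightarrow> m1 = m' \<and> \<alpha>2 = 0) \<and> \<alpha> = \<alpha>1 + \<alpha>2) \<or>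
    (\<exists>t1 \<alpha>1 s1 m1 \<alpha>2 m2 t3 \<alpha>3. run w le (c, s, m) t1 \<alpha>1 (SKIP, s1, m1) \<and> adv w m1 \<alpha>2 m2 \<and>
       run w le (d, s1, m2) t3 \<alpha>3 cf' \<and> t = t1 + 1 + t3 \<and> \<alpha> = \<alpha>1 + \<alpha>2 + \<alpha>3)"
    (is "?A t \<alpha> cf' \<or> ?B t \<alpha> cf'")
  using assms
proof (induction rule: run.induct)
  case start
  have "run w le (c, s, m) 0 0 (c, s, m)" by (rule run.start)
  then show ?case using start adv_refl by fastforce
next
  case (instr t \<alpha> e s' m')
  from instr.IH[OF instr.prems] show ?case
  proof
    assume "?A t \<alpha> (e, s', m')"
    then obtain c' m1 \<alpha>1 \<alpha>2 where *: "e = Seq c' d" "run w le (c, s, m) t \<alpha>1 (c', s', m1)"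
       "adv w m1 \<alpha>2 m'" "c' \<noteq> SKIP \<longrightarrow> m1 = m' \<and> \<alpha>2 = 0" "\<alpha> = \<alpha>1 + \<alpha>2" by auto
    show ?thesis
    proof (cases "c' = SKIP")
      case True
      then have "?B (Suc t) \<alpha> (step w le (e, s', m'))"
        using * run.start[of w le "(d, s', m')"] by fastforce
      then show ?thesis ..
    next
      case False
      obtain c'' s'' m'' where st: "step w le (c', s', m') = (c'', s'', m'')"
        by (cases "step w le (c', s', m')") auto
      have r: "run w le (c, s, m) (Suc t) \<alpha>1 (c'', s'', m'')"
        using run.instr[of w le _ t \<alpha>1 c' s' m'] * False st by metis
      have "?A (Suc t) \<alpha> (step w le (e, s', m'))"
        by (rule exI[of _ c''], rule exI[of _ s''], rule exI[of _ m''],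
            rule exI[of _ m''], rule exI[of _ \<alpha>1], rule exI[of _ 0])
          (use r * False st in \<open>auto intro: adv_refl\<close>)
      then show ?thesis ..
    qed
  next
    assume "?B t \<alpha> (e, s', m')"
    then obtain t1 \<alpha>1 s1 m1 \<alpha>2 m2 t3 \<alpha>3 where *: "run w le (c, s, m) t1 \<alpha>1 (SKIP, s1, m1)"
      "adv w m1 \<alpha>2 m2" "run w le (d, s1, m2) t3 \<alpha>3 (e, s', m')" "t = t1 + 1 + t3"
      "\<alpha> = \<alpha>1 + \<alpha>2 + \<alpha>3" by blast
    have "run w le (d, s1, m2) (Suc t3) \<alpha>3 (step w le (e, s', m'))"
      using run.instr[OF *(3) instr.hyps(2)] .
    moreover have "Suc t = t1 + 1 + Suc t3" using * by simp
    ultimately show ?thesis using * by blast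
  qed
next
  case (corrupt t \<alpha> e s' m' i v)
  from corrupt.IH[OF corrupt.prems] show ?case
  proof
    assume "?A t \<alpha> (e, s', m')"
    then obtain c' m1 \<alpha>1 \<alpha>2 where *: "e = Seq c' d" "run w le (c, s, m) t \<alpha>1 (c', s', m1)"
       "adv w m1 \<alpha>2 m'" "c' \<noteq> SKIP \<longrightarrow> m1 = m' \<and> \<alpha>2 = 0" "\<alpha> = \<alpha>1 + \<alpha>2" by auto
    show ?thesis
    proof (cases "c' = SKIP")
      case True
      then have "?A t (Suc \<alpha>) (e, s', m'(i := v))"
        using * adv_step[OF *(3) corrupt.hyps(3,4)] by (metis add_Suc_right)
      then show ?thesis ..
    next
      case False
      have "run w le (c, s, m) t (Suc \<alpha>1) (c', s', m'(i := v))"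
        using run.corrupt[of w le _ t \<alpha>1 c' s' m' i v] * False corrupt.hyps by metis
      then have "?A t (Suc \<alpha>) (e, s', m'(i := v))"
        using * False by (auto intro!: exI[of _ "m'(i := v)"] exI[of _ "Suc \<alpha>1"] intro: adv_refl)
      then show ?thesis ..
    qed
  next
    assume "?B t \<alpha> (e, s', m')"
    then obtain t1 \<alpha>1 s1 m1 \<alpha>2 m2 t3 \<alpha>3 where *: "run w le (c, s, m) t1 \<alpha>1 (SKIP, s1, m1)"
      "adv w m1 \<alpha>2 m2" "run w le (d, s1, m2) t3 \<alpha>3 (e, s', m')" "t = t1 + 1 + t3"
      "\<alpha> = \<alpha>1 + \<alpha>2 + \<alpha>3" by blast
    have "run w le (d, s1, m2) t3 (Suc \<alpha>3) (e, s', m'(i := v))"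
      using run.corrupt[OF *(3) corrupt.hyps(2-4)] .
    moreover have "Suc \<alpha> = \<alpha>1 + \<alpha>2 + Suc \<alpha>3" using * by simp
    ultimately show ?thesis using * by blast
  qed
qed

section \<open>Words stay in range, and unassigned registers keep their values\<close>

definition wf_state :: "nat \<Rightarrow> regs \<Rightarrow> mem \<Rightarrow> bool" where
  "wf_state w s m \<longleftrightarrow> (\<forall>x. s x < 2 ^ w) \<and> (\<forall>x. m x < 2 ^ w)"

lemma aval_bound: "(\<And>x. s x < 2 ^ w) \<Longrightarrow> aval w a s < 2 ^ w"
proof (induction a)
  case (Minus a b)
  have "(int (aval w a s) - int (aval w b s)) mod 2 ^ w < 2 ^ w" by (rule pos_mod_bound) simp
  then show ?case by (simp add: nat_less_iff)
next
  case (Div a b)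
  then have "aval w a s < 2 ^ w" by blast
  then show ?case using div_le_dividend[of "aval w a s" "aval w b s"] by (simp add: le_less_trans[OF div_le_dividend])
next
  case (Mod a b)
  then have "aval w a s < 2 ^ w" by blast
  then show ?case using mod_less_eq_dividend[of "aval w a s" "aval w b s"] by (simp add: le_less_trans[OF mod_less_eq_dividend])
qed auto

lemma step_wf:
  "wf_state w s m \<Longrightarrow> step w le (c, s, m) = (c', s', m') \<Longrightarrow> wf_state w s' m'"
proof (induction c arbitrary: c' s' m')
  case (Seq c d)
  then show ?case by (cases "step w le (c, s, m)") (auto split: if_splits)
next
  case (Assign x a)
  then show ?case using aval_bound[of s w a] by (auto simp: wf_state_def)
next
  case (Store a b)
  then show ?case using aval_bound[of s w b] by (auto simp: wf_state_def)
next
  case (Load x a)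
  then show ?case by (auto simp: wf_state_def)
next
  case (If b c d)
  from If.prems show ?case by simp
next
  case (While b c)
  from While.prems show ?case by simp
qed simp

lemma adv_wf: "adv w m \<alpha> m' \<Longrightarrow> wf_state w s m \<Longrightarrow> wf_state w s m'"
  by (induction rule: adv.induct) (auto simp: wf_state_def)

lemma run_wf:
  "run w le cf t \<alpha> cf' \<Longrightarrow> wf_state w (fst (snd cf)) (snd (snd cf)) \<Longrightarrow>
     wf_state w (fst (snd cf')) (snd (snd cf'))"
proof (induction rule: run.induct)
  case (instr t \<alpha> c s m)
  then show ?case using step_wf[of w s m le c] by (cases "step w le (c, s, m)") auto
qed (auto simp: wf_state_def)

fun modi :: "com \<Rightarrow> nat set" where
  "modi (Assign x _) = {x}"
| "modi (Load x _) = {x}"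
| "modi (Seq c d) = modi c \<union> modi d"
| "modi (If _ c d) = modi c \<union> modi d"
| "modi (While _ c) = modi c"
| "modi _ = {}"

lemma step_modi:
  "step w le (c, s, m) = (c', s', m') \<Longrightarrow> modi c' \<subseteq> modi c \<and> (r \<notin> modi c \<longrightarrow> s' r = s r)"
proof (induction c arbitrary: c' s' m')
  case (Seq c d)
  obtain c1 s1 m1 where st: "step w le (c, s, m) = (c1, s1, m1)" by (cases "step w le (c, s, m)") auto
  note IH = Seq.IH(1)[OF st]
  from Seq.prems show ?case using IH by (cases "c = SKIP") (auto simp: st)
next
  case (If b c d)
  from If.prems show ?case by (auto split: if_splits)
next
  case (While b c)
  from While.prems show ?case by (auto split: if_splits)
qed auto

lemma run_modi:
  "run w le cf t \<alpha> cf' \<Longrightarrow> modi (fst cf') \<subseteq> modi (fst cf) \<and>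
     (r \<notin> modi (fst cf) \<longrightarrow> fst (snd cf') r = fst (snd cf) r)"
proof (induction rule: run.induct)
  case (instr t \<alpha> c s m)
  then show ?case using step_modi[of w le c s m _ _ _ r] by (cases "step w le (c, s, m)") auto
qed auto

section \<open>Hoare rules with time bounds and a corruption counter\<close>

type_synonym assn = "regs \<Rightarrow> mem \<Rightarrow> nat \<Rightarrow> bool"

locale fram =
  fixes w :: nat and le :: "nat rel"
begin

text \<open>The last argument of an assertion is the number of corruptions that have occurred so far.\<close>

definition stable :: "assn \<Rightarrow> bool" where
  "stable P \<longleftrightarrow> (\<forall>s m \<alpha> i v. wf_state w s m \<longrightarrow> P s m \<alpha> \<longrightarrow> i < 2 ^ w \<longrightarrow> v < 2 ^ w \<longrightarrow>
     P s (m(i := v)) (Suc \<alpha>))"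

text \<open>
  Besides partial correctness, \<open>H P c T Q\<close> bounds the time of all executions of \<open>c\<close>, including incomplete
  ones. The postcondition is only claimed at the moment when \<open>SKIP\<close> is reached, so it need not be stable.
\<close>

definition H :: "assn \<Rightarrow> com \<Rightarrow> nat \<Rightarrow> assn \<Rightarrow> bool" where
  "H P c T Q \<longleftrightarrow> (\<forall>s m \<alpha> t \<beta> c' s' m'. wf_state w s m \<longrightarrow> P s m \<alpha> \<longrightarrow>
     run w le (c, s, m) t \<beta> (c', s', m') \<longrightarrow> t \<le> T \<and> (c' = SKIP \<longrightarrow> Q s' m' (\<alpha> + \<beta>)))"

lemma stable_adv:
  "adv w m \<beta> m' \<Longrightarrow> stable P \<Longrightarrow> wf_state w s m \<Longrightarrow> P s m \<alpha> \<Longrightarrow> P s m' (\<alpha> + \<beta>)"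
proof (induction rule: adv.induct)
  case (adv_step \<beta> m' i v)
  then show ?case unfolding stable_def using adv_wf by (metis add_Suc_right)
qed simp

text \<open>An instruction executes only after a burst of writes. Stability of \<open>P\<close>
  carries the precondition over the burst, so the remaining obligation starts at the instruction
  itself.\<close>

lemma H_first:
  assumes "c \<noteq> SKIP" "stable P"
    and "\<And>s m \<alpha> t \<beta> c' s' m'. wf_state w s m \<Longrightarrow> P s m \<alpha> \<Longrightarrow> run w le (step w le (c, s, m)) t \<beta> (c', s', m') \<Longrightarrow>
      t < T \<and> (c' = SKIP \<longrightarrow> Q s' m' (\<alpha> + \<beta>))"
  shows "H P c T Q"
  unfolding H_def
proof (intro allI impI, goal_cases)
  case (1 s m \<alpha> t \<beta> c' s' m')
  from run_first[OF 1(3) refl assms(1)] show ?case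
  proof (elim disjE exE conjE)
    fix \<alpha>1 m1 \<alpha>2 t'
    assume *: "adv w m \<alpha>1 m1" "run w le (step w le (c, s, m1)) t' \<alpha>2 (c', s', m')"
       "t = Suc t'" "\<beta> = \<alpha>1 + \<alpha>2"
    have "P s m1 (\<alpha> + \<alpha>1)" using stable_adv[OF *(1) assms(2)] 1 by blast
    then show ?thesis using assms(3)[OF adv_wf[OF *(1) 1(1)] _ *(2), of "\<alpha> + \<alpha>1"] * by (auto simp: add.assoc)
  qed (use assms(1) in auto)
qed

lemma H_conseq:
  assumes "H P' c T' Q'" "\<And>s m \<alpha>. wf_state w s m \<Longrightarrow> P s m \<alpha> \<Longrightarrow> P' s m \<alpha>"
    "\<And>s m \<alpha>. wf_state w s m \<Longrightarrow> Q' s m \<alpha> \<Longrightarrow> Q s m \<alpha>" "T' \<le> T"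
  shows "H P c T Q"
  unfolding H_def
proof (intro allI impI, goal_cases)
  case (1 s m \<alpha> t \<beta> c' s' m')
  then have "t \<le> T'" "c' = SKIP \<longrightarrow> Q' s' m' (\<alpha> + \<beta>)"
    using assms(1,2) unfolding H_def by blast+
  moreover have "wf_state w s' m'" using run_wf[OF 1(3)] 1 by simp
  ultimately show ?case using assms(3,4) by auto
qed

lemma H_pre: "H P' c T Q \<Longrightarrow> (\<And>s m \<alpha>. wf_state w s m \<Longrightarrow> P s m \<alpha> \<Longrightarrow> P' s m \<alpha>) \<Longrightarrow> H P c T Q"
  by (rule H_conseq[where P' = P' and Q' = Q and T' = T]) auto

lemma H_post: "H P c T Q' \<Longrightarrow> (\<And>s m \<alpha>. wf_state w s m \<Longrightarrow> Q' s m \<alpha> \<Longrightarrow> Q s m \<alpha>) \<Longrightarrow> H P c T Q"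
  by (rule H_conseq[where P' = P and Q' = Q' and T' = T]) auto

lemma H_time: "H P c T' Q \<Longrightarrow> T' \<le> T \<Longrightarrow> H P c T Q"
  by (rule H_conseq[where P' = P and Q' = Q and T' = T']) auto

lemma H_ex: "(\<And>x. H (P x) c T Q) \<Longrightarrow> H (\<lambda>s m \<alpha>. \<exists>x. P x s m \<alpha>) c T Q"
  unfolding H_def by blast

lemma H_pure: "(A \<Longrightarrow> H P c T Q) \<Longrightarrow> H (\<lambda>s m \<alpha>. A \<and> P s m \<alpha>) c T Q"
  unfolding H_def by blast

lemma H_Seq:
  assumes "H P c T1 M" "stable M" "H M d T2 Q" "T1 + T2 + 1 \<le> T"
  shows "H P (Seq c d) T Q"
  unfolding H_def
proof (intro allI impI, goal_cases)
  case (1 s m \<alpha> t \<beta> c' s' m')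
  from run_Seq[OF 1(3) refl] show ?case
  proof (elim disjE exE conjE)
    fix c'' s'' m'' m1 \<alpha>1 \<alpha>2
    assume "(c', s', m') = (Seq c'' d, s'', m'')" "run w le (c, s, m) t \<alpha>1 (c'', s'', m1)"
    then show ?thesis using assms(1,4) 1 unfolding H_def by fastforce
  next
    fix t1 \<alpha>1 s1 m1 \<alpha>2 m2 t3 \<alpha>3
    assume *: "run w le (c, s, m) t1 \<alpha>1 (SKIP, s1, m1)" "adv w m1 \<alpha>2 m2"
      "run w le (d, s1, m2) t3 \<alpha>3 (c', s', m')" "t = t1 + 1 + t3" "\<beta> = \<alpha>1 + \<alpha>2 + \<alpha>3"
    have "t1 \<le> T1" "M s1 m1 (\<alpha> + \<alpha>1)" using assms(1) 1 * unfolding H_def by blast+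
    moreover have "wf_state w s1 m1" using run_wf[OF *(1)] 1 by simp
    ultimately have "M s1 m2 (\<alpha> + \<alpha>1 + \<alpha>2)" "wf_state w s1 m2"
      using stable_adv[OF *(2) assms(2)] adv_wf[OF *(2)] by blast+
    then have "t3 \<le> T2 \<and> (c' = SKIP \<longrightarrow> Q s' m' (\<alpha> + \<alpha>1 + \<alpha>2 + \<alpha>3))"
      using assms(3) *(3) unfolding H_def by blast
    then show ?thesis using * \<open>t1 \<le> T1\<close> assms(4) by (auto simp: add.assoc)
  qed
qed

lemma H_seq: "H P c T1 M \<Longrightarrow> stable M \<Longrightarrow> H M d T2 Q \<Longrightarrow> H P (Seq c d) (T1 + T2 + 1) Q"
  by (rule H_Seq) auto

lemma H_SKIP: "(\<And>s m \<alpha>. wf_state w s m \<Longrightarrow> P s m \<alpha> \<Longrightarrow> Q s m \<alpha>) \<Longrightarrow> H P SKIP T Q"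
  unfolding H_def using run_SKIP by fastforce

lemma H_If:
  assumes "stable P" "H (\<lambda>s m \<alpha>. P s m \<alpha> \<and> bval w le b s) c T1 Q"
    "H (\<lambda>s m \<alpha>. P s m \<alpha> \<and> \<not> bval w le b s) d T2 Q" "T1 < T" "T2 < T"
  shows "H P (If b c d) T Q"
proof (rule H_first[OF _ assms(1)])
  fix s m \<alpha> t \<beta> c' s' m'
  assume "wf_state w s m" "P s m \<alpha>" "run w le (step w le (If b c d, s, m)) t \<beta> (c', s', m')"
  then show "t < T \<and> (c' = SKIP \<longrightarrow> Q s' m' (\<alpha> + \<beta>))"
    using assms(2-5) unfolding H_def by (cases "bval w le b s") (auto, (meson le_less_trans)+)
qed simp

lemma H_Load:
  assumes "stable P" "\<And>s m \<alpha>. wf_state w s m \<Longrightarrow> P s m \<alpha> \<Longrightarrow> Q (s(x := m (aval w a s))) m \<alpha>" "1 \<le> T"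
  shows "H P (Load x a) T Q"
proof (rule H_first[OF _ assms(1)])
  fix s m \<alpha> t \<beta> c' s' m'
  assume "wf_state w s m" "P s m \<alpha>" "run w le (step w le (Load x a, s, m)) t \<beta> (c', s', m')"
  then show "t < T \<and> (c' = SKIP \<longrightarrow> Q s' m' (\<alpha> + \<beta>))"
    using assms(2,3) run_SKIP by fastforce
qed simp

lemma H_Store:
  assumes "stable P"
    "\<And>s m \<alpha>. wf_state w s m \<Longrightarrow> P s m \<alpha> \<Longrightarrow> Q s (m(aval w a s := aval w b s)) \<alpha>" "1 \<le> T"
  shows "H P (Store a b) T Q"
proof (rule H_first[OF _ assms(1)])
  fix s m \<alpha> t \<beta> c' s' m'
  assume "wf_state w s m" "P s m \<alpha>" "run w le (step w le (Store a b, s, m)) t \<beta> (c', s', m')"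
  then show "t < T \<and> (c' = SKIP \<longrightarrow> Q s' m' (\<alpha> + \<beta>))"
    using assms(2,3) run_SKIP by fastforce
qed simp

lemma H_Assign:
  assumes "stable P" "\<And>s m \<alpha>. wf_state w s m \<Longrightarrow> P s m \<alpha> \<Longrightarrow> Q (s(x := aval w a s)) m \<alpha>" "1 \<le> T"
  shows "H P (Assign x a) T Q"
proof (rule H_first[OF _ assms(1)])
  fix s m \<alpha> t \<beta> c' s' m'
  assume "wf_state w s m" "P s m \<alpha>" "run w le (step w le (Assign x a, s, m)) t \<beta> (c', s', m')"
  then show "t < T \<and> (c' = SKIP \<longrightarrow> Q s' m' (\<alpha> + \<beta>))"
    using assms(2,3) run_SKIP by fastforce
qed simp

text \<open>The index \<open>B\<close> of the invariant is a time budget for the remaining iterations.\<close>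

lemma H_While:
  fixes I :: "nat \<Rightarrow> assn" and \<tau> :: "regs \<Rightarrow> nat"
  assumes st: "\<And>B. stable (I B)"
    and cost: "\<And>B s m \<alpha>. wf_state w s m \<Longrightarrow> I B s m \<alpha> \<Longrightarrow> bval w le b s \<Longrightarrow> \<tau> s + 2 \<le> B"
    and body: "\<And>B v. H (\<lambda>s m \<alpha>. I B s m \<alpha> \<and> bval w le b s \<and> \<tau> s = v) c v
      (\<lambda>s m \<alpha>. \<exists>B'. I B' s m \<alpha> \<and> B' + v + 2 \<le> B)"
  shows "H (I B) (While b c) (B + 1) (\<lambda>s m \<alpha>. (\<exists>B'. I B' s m \<alpha>) \<and> \<not> bval w le b s)"
    (is "H _ _ _ ?Q")
proof (induction B rule: less_induct)
  case (less B)
  show ?case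
  proof (rule H_first[OF _ st])
    fix s m \<alpha> t \<beta> c' s' m'
    assume *: "wf_state w s m" "I B s m \<alpha>"
      "run w le (step w le (While b c, s, m)) t \<beta> (c', s', m')"
    show "t < B + 1 \<and> (c' = SKIP \<longrightarrow> ?Q s' m' (\<alpha> + \<beta>))"
    proof (cases "bval w le b s")
      case True
      let ?v = "\<tau> s"
      let ?M = "\<lambda>s m \<alpha>. \<exists>B'. I B' s m \<alpha> \<and> B' + ?v + 2 \<le> B"
      have "stable ?M" using st unfolding stable_def by blast
      moreover have "H ?M (While b c) (B - ?v - 1) ?Q"
      proof (rule H_ex)
        fix B'
        show "H (\<lambda>s m \<alpha>. I B' s m \<alpha> \<and> B' + ?v + 2 \<le> B) (While b c) (B - ?v - 1) ?Q"
        proof (cases "B' + ?v + 2 \<le> B")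
          case True
          then show ?thesis using H_conseq[OF less[of B']] by auto
        qed (simp add: H_def)
      qed
      ultimately have "H (\<lambda>s m \<alpha>. I B s m \<alpha> \<and> bval w le b s \<and> \<tau> s = ?v)
          (Seq c (While b c)) B ?Q"
        using H_Seq[OF body[of B ?v]] cost * True by fastforce
      then show ?thesis using * True unfolding H_def by fastforce
    next
      case False
      then show ?thesis using * run_SKIP[OF *(3)] by auto
    qed
  qed simp
qed

text \<open>Instance of \<open>H_While\<close> with a fixed cost per iteration and the budget
  \<open>\<mu> s * (T + 2)\<close>: besides the body, an iteration takes one step for the test and
  one for removing \<open>SKIP\<close>. The final \<open>1\<close> is the failing test.\<close>

lemma H_for:
  assumes st: "stable I"
    and body: "\<And>v. H (\<lambda>s m \<alpha>. I s m \<alpha> \<and> bval w le b s \<and> \<mu> s = v) c T (\<lambda>s m \<alpha>. I s m \<alpha> \<and> \<mu> s < v)"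
    and pos: "\<And>s m \<alpha>. wf_state w s m \<Longrightarrow> I s m \<alpha> \<Longrightarrow> bval w le b s \<Longrightarrow> 0 < \<mu> s"
    and T': "K * (T + 2) + 1 \<le> T'"
  shows "H (\<lambda>s m \<alpha>. I s m \<alpha> \<and> \<mu> s \<le> K) (While b c) T' (\<lambda>s m \<alpha>. I s m \<alpha> \<and> \<not> bval w le b s)"
proof -
  let ?I = "\<lambda>B s m \<alpha>. I s m \<alpha> \<and> \<mu> s * (T + 2) \<le> B"
  have "H (?I (K * (T + 2))) (While b c) (K * (T + 2) + 1) (\<lambda>s m \<alpha>. (\<exists>B'. ?I B' s m \<alpha>) \<and> \<not> bval w le b s)"
  proof (rule H_While[where \<tau> = "\<lambda>_. T"])
    show "stable (?I B)" for B using st unfolding stable_def by blast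
    show "T + 2 \<le> B" if a: "wf_state w s m" "?I B s m \<alpha>" "bval w le b s" for B s m \<alpha>
    proof -
      have "1 * (T + 2) \<le> \<mu> s * (T + 2)" using pos a by (intro mult_right_mono) (auto simp: Suc_leI)
      then show ?thesis using a(2) by (metis mult_1 order_trans)
    qed
    fix B v
    show "H (\<lambda>s m \<alpha>. ?I B s m \<alpha> \<and> bval w le b s \<and> T = v) c v (\<lambda>s m \<alpha>. \<exists>B'. ?I B' s m \<alpha> \<and> B' + v + 2 \<le> B)"
    proof (cases "T = v")
      case True
      have "H (\<lambda>s m \<alpha>. \<exists>u. (I s m \<alpha> \<and> bval w le b s \<and> \<mu> s = u) \<and> u * (T + 2) \<le> B) c T
        (\<lambda>s m \<alpha>. \<exists>B'. ?I B' s m \<alpha> \<and> B' + v + 2 \<le> B)"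
      proof (rule H_ex)
        fix u
        show "H (\<lambda>s m \<alpha>. (I s m \<alpha> \<and> bval w le b s \<and> \<mu> s = u) \<and> u * (T + 2) \<le> B) c T
          (\<lambda>s m \<alpha>. \<exists>B'. ?I B' s m \<alpha> \<and> B' + v + 2 \<le> B)"
        proof (cases "u * (T + 2) \<le> B")
          case True
          show ?thesis
          proof (rule H_conseq[OF body[of u]])
            fix s m \<alpha>
            assume *: "I s m \<alpha> \<and> \<mu> s < u"
            then have "(\<mu> s + 1) * (T + 2) \<le> u * (T + 2)" by (intro mult_right_mono) auto
            then have "\<mu> s * (T + 2) + v + 2 \<le> B" using \<open>T = v\<close> True by (simp add: algebra_simps)
            then show "\<exists>B'. ?I B' s m \<alpha> \<and> B' + v + 2 \<le> B" using * by blast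
          qed auto
        qed (simp add: H_def)
      qed
      then show ?thesis using True by (auto elim!: H_pre)
    qed (simp add: H_def)
  qed
  then show ?thesis
    by (rule H_conseq) (use T' in \<open>auto intro!: mult_le_mono1 simp del: add_2_eq_Suc'\<close>)
qed

section \<open>Register-only code as a function on registers\<close>

fun regonly :: "com \<Rightarrow> bool" where
  "regonly SKIP = True"
| "regonly (Assign _ _) = True"
| "regonly (Seq c d) = (regonly c \<and> regonly d)"
| "regonly (If _ c d) = (regonly c \<and> regonly d)"
| "regonly _ = False"

fun ev :: "com \<Rightarrow> regs \<Rightarrow> regs" where
  "ev (Assign x a) s = s(x := aval w a s)"
| "ev (Seq c d) s = ev d (ev c s)"
| "ev (If b c d) s = (if bval w le b s then ev c s else ev d s)"
| "ev _ s = s"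

fun tm :: "com \<Rightarrow> nat" where
  "tm (Assign _ _) = 1"
| "tm (Seq c d) = tm c + tm d + 1"
| "tm (If _ c d) = max (tm c) (tm d) + 1"
| "tm _ = 0"

text \<open>Corruptions do not touch registers, and this code neither reads nor writes memory, so
  the two commute. Hence only the precondition has to be stable, and a whole block is replaced by
  the function \<open>ev c\<close>.\<close>

lemma H_ev:
  assumes "regonly c" "stable P"
  shows "H P c (tm c) (\<lambda>s' m \<alpha>. \<exists>s. wf_state w s m \<and> P s m \<alpha> \<and> s' = ev c s)"
  using assms
proof (induction c arbitrary: P)
  case SKIP
  show ?case by (rule H_SKIP) auto
next
  case (Assign x a)
  then show ?case by (intro H_Assign) auto
next
  case (Seq c d)
  let ?M = "\<lambda>s' m \<alpha>. \<exists>s. wf_state w s m \<and> P s m \<alpha> \<and> s' = ev c s"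
  have M: "stable ?M" unfolding stable_def
  proof (intro allI impI, elim exE conjE, goal_cases)
    case (1 s' m \<alpha> i v s)
    then have "wf_state w s (m(i := v))" by (simp add: wf_state_def)
    then show ?case using 1 Seq.prems(2) unfolding stable_def by blast
  qed
  have "H ?M d (tm d) (\<lambda>s' m \<alpha>. \<exists>s. wf_state w s m \<and> ?M s m \<alpha> \<and> s' = ev d s)"
    using Seq M by simp
  then have "H ?M d (tm d) (\<lambda>s' m \<alpha>. \<exists>s. wf_state w s m \<and> P s m \<alpha> \<and> s' = ev (Seq c d) s)"
    by (rule H_post) auto
  then show ?case using Seq M by (intro H_Seq[OF _ M]) auto
next
  case (If b c d)
  let ?Pt = "\<lambda>s m \<alpha>. P s m \<alpha> \<and> bval w le b s"
  let ?Pf = "\<lambda>s m \<alpha>. P s m \<alpha> \<and> \<not> bval w le b s"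
  let ?Q = "\<lambda>s' m \<alpha>. \<exists>s. wf_state w s m \<and> P s m \<alpha> \<and> s' = ev (If b c d) s"
  have st: "stable ?Pt" "stable ?Pf"
    using If.prems unfolding stable_def by blast+
  have "H ?Pt c (tm c) (\<lambda>s' m \<alpha>. \<exists>s. wf_state w s m \<and> ?Pt s m \<alpha> \<and> s' = ev c s)"
    using If.IH(1)[OF _ st(1)] If.prems by simp
  then have c: "H ?Pt c (tm c) ?Q" by (rule H_post) auto
  have "H ?Pf d (tm d) (\<lambda>s' m \<alpha>. \<exists>s. wf_state w s m \<and> ?Pf s m \<alpha> \<and> s' = ev d s)"
    using If.IH(2)[OF _ st(2)] If.prems by simp
  then have d: "H ?Pf d (tm d) ?Q" by (rule H_post) auto
  show ?case by (rule H_If[OF If.prems(2) c d]) auto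
qed auto

lemma ev_wf: "wf_state w s m \<Longrightarrow> wf_state w (ev c s) m"
proof (induction c arbitrary: s)
  case (Assign x a)
  then show ?case using aval_bound[of s w a] by (simp add: wf_state_def)
qed auto

lemma H_reg:
  assumes "regonly c" "stable P" "\<And>s m \<alpha>. wf_state w s m \<Longrightarrow> P s m \<alpha> \<Longrightarrow> Q (ev c s) m \<alpha>" "tm c \<le> T"
  shows "H P c T Q"
  by (rule H_conseq[OF H_ev[OF assms(1,2)]]) (use assms(3,4) in auto)

text \<open>Needed for the fuel register: the invariants bound the fuel only from below, while the
  time bound of the main loop needs it from above.\<close>

lemma H_frame:
  assumes "H P c T Q" "r \<notin> modi c"
  shows "H (\<lambda>s m \<alpha>. P s m \<alpha> \<and> s r = a) c T (\<lambda>s m \<alpha>. Q s m \<alpha> \<and> s r = a)"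
  unfolding H_def
proof (intro allI impI, goal_cases)
  case (1 s m \<alpha> t \<beta> c' s' m')
  have "s' r = s r" using run_modi[OF 1(3), of r] assms(2) by simp
  then show ?case using assms(1) 1 unfolding H_def by blast
qed

end

section \<open>Counting cells\<close>

definition cnt :: "mem \<Rightarrow> nat \<Rightarrow> nat \<Rightarrow> (nat \<Rightarrow> bool) \<Rightarrow> nat" where
  "cnt m a b P = (\<Sum>x\<in>{a..<b}. of_bool (P (m x)))"

lemma cnt_card: "cnt m a b P = card {x \<in> {a..<b}. P (m x)}"
proof -
  have "cnt m a b P = (\<Sum>x\<in>{x \<in> {a..<b}. P (m x)}. 1)"
    unfolding cnt_def by (rule sum.mono_neutral_cong_right) auto
  then show ?thesis by simp
qed

lemma cnt_empty [simp]: "b \<le> a \<Longrightarrow> cnt m a b P = 0"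
  by (simp add: cnt_def)

lemma cnt_first: "a < b \<Longrightarrow> cnt m a b P = of_bool (P (m a)) + cnt m (Suc a) b P"
  unfolding cnt_def by (rule sum.atLeast_Suc_lessThan)

lemma cnt_last: "a \<le> b \<Longrightarrow> cnt m a (Suc b) P = cnt m a b P + of_bool (P (m b))"
  by (simp add: cnt_def)

lemma cnt_cong: "(\<And>x. a \<le> x \<Longrightarrow> x < b \<Longrightarrow> P (m x) = Q (m' x)) \<Longrightarrow> cnt m a b P = cnt m' a b Q"
  by (simp add: cnt_def)

lemma cnt_mono: "(\<And>x. a \<le> x \<Longrightarrow> x < b \<Longrightarrow> P (m x) \<Longrightarrow> Q (m x)) \<Longrightarrow> cnt m a b P \<le> cnt m a b Q"
  unfolding cnt_def by (rule sum_mono) (auto simp: of_bool_def)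

lemma cnt_subset: "a' \<le> a \<Longrightarrow> b \<le> b' \<Longrightarrow> cnt m a b P \<le> cnt m a' b' P"
  unfolding cnt_def by (rule sum_mono2) auto

lemma cnt_le: "cnt m a b P \<le> b - a"
  unfolding cnt_card using card_mono[of "{a..<b}" "{x \<in> {a..<b}. P (m x)}"] by fastforce

lemma cnt_upd_other [simp]: "x < a \<or> b \<le> x \<Longrightarrow> cnt (m(x := v)) a b P = cnt m a b P"
  by (rule cnt_cong) auto

lemma cnt_upd_le: "cnt (m(x := v)) a b P \<le> cnt m a b P + of_bool (a \<le> x \<and> x < b)"
proof (cases "a \<le> x \<and> x < b")
  case True
  have "sum f {a..<b} = f x + sum f ({a..<b} - {x})" for f :: "nat \<Rightarrow> nat"
    using True by (intro sum.remove) auto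
  moreover have "(\<Sum>y\<in>{a..<b} - {x}. of_bool (P ((m(x := v)) y))) = (\<Sum>y\<in>{a..<b} - {x}. of_bool (P (m y)) :: nat)"
    by (rule sum.cong) auto
  ultimately show ?thesis using True unfolding cnt_def by (simp add: of_bool_def)
qed auto

lemma cnt_upd_ge: "cnt m a b P \<le> cnt (m(x := v)) a b P + of_bool (a \<le> x \<and> x < b)"
  using cnt_upd_le[of "m(x := v)" x "m x" a b P] by simp

lemma cnt_store_end: "a \<le> b \<Longrightarrow> cnt (m(b := v)) a (Suc b) P = cnt m a b P + of_bool (P v)"
  by (simp add: cnt_last)

section \<open>The program\<close>

text \<open>
  Registers: 0 is \<open>n\<close> and finally the result, 1 the rank that is searched in the current array, 3 the
  size of the current array, 4 and 5 the ends of the current interval of keys and 6 and 7 flags telling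
  whether they are set, 8 the size of the current instance of the pivot search, 9 its size at the
  top level, 10 the base of the workspace of the current level, 11 the packed digits of the
  enclosing levels, 12 the digit of the current level, 13 the pivot, 14 the mode (0: search a pivot
  of the current instance, 1: a pivot of it has been found, 2: answer found, 3: out of fuel), 15 the
  fuel. The other registers are temporary.

  The current array starts at cell 0. The partition moves large elements to a buffer at cell \<open>n\<close>. The
  workspaces of the levels follow each other from cell \<open>8 N\<close> on, where \<open>N\<close> is the size of the outermost
  instance, and the workspace of an instance of size \<open>N'\<close> has \<open>N'\<close> cells. The instance itself lies at the
  beginning of the preceding workspace; with the first workspace at \<open>8 N\<close>, this is always \<open>8 N'\<close> cells
  before its own workspace.
\<close>

abbreviation (input) seq :: "com \<Rightarrow> com \<Rightarrow> com" (infixr ";;" 60) where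
  "c ;; d \<equiv> Seq c d"

abbreviation (input) addrA :: aexp where
  "addrA \<equiv> Minus (R 10) (Times (N 8) (R 8))"

definition incr :: "nat \<Rightarrow> com" where
  "incr r = Assign r (Plus (R r) (N 1))"

definition cmp_exch :: "nat \<Rightarrow> nat \<Rightarrow> com" where
  "cmp_exch i j = If (Elem_le (R i) (R j)) SKIP
     (Assign 25 (R i) ;; Assign i (R j) ;; Assign j (R 25))"

text \<open>The first five exchanges sort registers 20 to 23. The last two clip register 24 to the
  two middle values, which yields the median of all five.\<close>

definition median5 :: com where
  "median5 = cmp_exch 20 21 ;; cmp_exch 22 23 ;; cmp_exch 20 22 ;; cmp_exch 21 23 ;;
     cmp_exch 21 22 ;; cmp_exch 21 24 ;; cmp_exch 24 22"

definition load5 :: "nat \<Rightarrow> com" where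
  "load5 j = Load (20 + j) (Plus addrA (Plus (Times (N 5) (R 16)) (N j)))"

definition medians_body :: com where
  "medians_body = load5 0 ;; load5 1 ;; load5 2 ;; load5 3 ;; load5 4 ;; median5 ;;
     Store (Plus (R 10) (R 16)) (R 24) ;; incr 16"

text \<open>A size \<open>64 x\<close> is stored without \<open>x\<close>, so guards are scaled:
  this one says that register 16 is below \<open>12 x\<close>.\<close>

definition medians :: com where
  "medians = Assign 16 (N 0) ;; While (Less (Times (N 16) (R 16)) (Times (N 3) (R 8))) medians_body"

definition count_body :: com where
  "count_body = Load 20 (Plus addrA (R 16)) ;;
     (If (Elem_le (R 20) (R 13)) (incr 18) SKIP ;; If (Elem_le (R 13) (R 20)) (incr 19) SKIP ;; incr 16)"

definition count :: com where
  "count = (Assign 16 (N 0) ;; Assign 18 (N 0) ;; Assign 19 (N 0)) ;; While (Less (R 16) (R 8)) count_body"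

text \<open>The first conjunct says that fewer than \<open>x\<close> medians have been dropped so
  far, their number being the difference of registers 16 and 17. The nested negations express a
  disjunction: at most the pivot if register 27 is 0, at least the pivot otherwise.\<close>

definition drop_body :: com where
  "drop_body = Load 20 (Plus (R 10) (R 16)) ;;
     If (And (Less (Times (N 64) (R 16)) (Plus (R 8) (Times (N 64) (R 17))))
          (Not (And (Not (And (Eq (R 27) (N 0)) (Elem_le (R 20) (R 13))))
                    (Not (And (Not (Eq (R 27) (N 0))) (Elem_le (R 13) (R 20)))))))
       (incr 16)
       (Store (Plus (R 10) (R 17)) (R 20) ;; incr 17 ;; incr 16)"

definition discard :: com where
  "discard = (Assign 16 (N 0) ;; Assign 17 (N 0)) ;;
     While (Less (Plus (Times (N 64) (R 16)) (Times (R 12) (R 8))) (Times (N 12) (R 8))) drop_body"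

definition push :: com where
  "push = Assign 11 (Plus (Times (N 8) (R 11)) (R 12)) ;; Assign 10 (Plus (R 10) (R 8)) ;;
     Assign 8 (Div (R 8) (N 8)) ;; Assign 14 (N 0)"

definition pop :: com where
  "pop = Assign 8 (Times (N 8) (R 8)) ;; Assign 10 (Minus (R 10) (R 8)) ;;
     Assign 12 (Mod (R 11) (N 8)) ;; Assign 11 (Div (R 11) (N 8))"

text \<open>The outermost instance is the largest power of 8 that fits into the array. So all level
  sizes are powers of 8, and the array is less than eight times as large as the instance whose size
  is charged for partitioning it.\<close>

definition new_stage :: com where
  "new_stage = Assign 8 (N 1) ;;
     While (Not (Less (R 3) (Times (N 8) (R 8)))) (Assign 8 (Times (N 8) (R 8))) ;;
     (Assign 9 (R 8) ;; Assign 10 (Times (N 8) (R 8)) ;; Assign 11 (N 0) ;; Assign 14 (N 0))"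

text \<open>Thresholds in \<open>(klo, khi]\<close> cannot tell a key from its clipped version.
  Since clipping is monotone, an element on one side of the pivot is still weakly on that side after
  both have been clipped.\<close>

definition clamp :: "nat \<Rightarrow> com" where
  "clamp r = If (And (Eq (R 6) (N 1)) (Elem_le (R r) (R 4))) (Assign r (R 4)) SKIP ;;
     If (And (Eq (R 7) (N 1)) (Elem_le (R 5) (R r))) (Assign r (R 5)) SKIP"

definition part_body :: com where
  "part_body = Load 20 (R 16) ;; clamp 20 ;;
     If (Eq (R 20) (R 13)) (incr 18 ;; incr 16)
       (If (Elem_le (R 20) (R 13)) (Store (R 17) (R 20) ;; (incr 17 ;; incr 16))
         (Store (Plus (R 0) (R 19)) (R 20) ;; (incr 19 ;; incr 16)))"

definition part_loop :: com where
  "part_loop = (clamp 13 ;; Assign 16 (N 0) ;; Assign 17 (N 0) ;; Assign 18 (N 0) ;; Assign 19 (N 0)) ;;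
     While (Less (R 16) (R 3)) part_body"

definition copy_high :: com where
  "copy_high = Assign 16 (N 0) ;;
     While (Less (R 16) (R 3)) (Load 20 (Plus (R 0) (R 16)) ;; Store (R 16) (R 20) ;; incr 16)"

definition partition :: com where
  "partition = part_loop ;;
     If (Not (Less (R 17) (R 1)))
       ((Assign 5 (R 13) ;; Assign 7 (N 1) ;; Assign 3 (R 17)) ;; new_stage)
       (If (Less (Plus (R 17) (R 18)) (R 1))
          ((Assign 4 (R 13) ;; Assign 6 (N 1) ;; Assign 1 (Minus (R 1) (Plus (R 17) (R 18))) ;;
            Assign 3 (R 19)) ;; copy_high ;; new_stage)
          (Assign 14 (N 2)))"

text \<open>Below 9 the size is 1 or 8, and then any element of the instance is a pivot: it
  represents an eighth of the instance by itself.\<close>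

definition call :: com where
  "call = If (Less (R 8) (N 9)) (Load 13 addrA ;; Assign 14 (N 1))
     (medians ;; (Assign 12 (N 0) ;; push))"

definition return :: com where
  "return = If (Eq (R 8) (R 9)) partition
     (pop ;; count ;;
      If (And (Not (Less (Times (N 8) (R 18)) (R 8))) (Not (Less (Times (N 8) (R 19)) (R 8)))) SKIP
        (If (Less (Times (N 8) (R 18)) (R 8)) (Assign 27 (N 0)) (Assign 27 (N 1)) ;; discard ;;
         (incr 12 ;; If (Eq (R 12) (N 5)) (Assign 14 (N 0)) push)))"

text \<open>Every round is charged the size of its instance before its work, and its work is linear
  in this size; so the total time is linear in the fuel.\<close>

definition main_body :: com where
  "main_body = If (Less (R 15) (R 8)) (Assign 14 (N 3))
     (Assign 15 (Minus (R 15) (R 8)) ;; If (Eq (R 14) (N 0)) call return)"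

definition program :: com where
  "program = (Assign 3 (R 0) ;; Assign 15 (Times (N 16384) (R 0))) ;; new_stage ;;
     While (Less (R 14) (N 2)) main_body ;; Assign 0 (R 13)"

section \<open>Keys and the top-level invariant\<close>

locale sel = fram +
  fixes n k :: nat and X :: mem
  assumes linear: "linear_order_on {..<2 ^ w} le"
    and k: "1 \<le> k" "k \<le> n"
    and X: "\<And>i. X i < 2 ^ w"
    and wide: "2 ^ 15 * (n + 1) \<le> (2 :: nat) ^ w"
begin

text \<open>
  The numeric keys represent the order of the elements (\<open>True\<close>) and its reverse (\<open>False\<close>). They are
  positive, so that no element is below the key 0.
\<close>

definition key :: "bool \<Rightarrow> nat \<Rightarrow> nat" where
  "key d y = (if d then card {z. (z, y) \<in> le} else 2 ^ w + 1 - card {z. (z, y) \<in> le})"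

lemma le_sub: "le \<subseteq> {..<2 ^ w} \<times> {..<2 ^ w}"
  using linear by (auto simp: order_on_defs)

lemma fin_below: "finite {z. (z, y) \<in> le}"
  using le_sub by (auto intro: finite_subset[of _ "{..<2 ^ w}"])

lemma card_below: "card {z. (z, y) \<in> le} \<le> 2 ^ w"
  using card_mono[of "{..<2 ^ w}" "{z. (z, y) \<in> le}"] le_sub by auto

text \<open>In a linear order down-sets form a chain, and a proper inclusion of finite sets
  increases the cardinality.\<close>

lemma key_le_iff:
  assumes "x < 2 ^ w" "y < 2 ^ w"
  shows "key True x \<le> key True y \<longleftrightarrow> (x, y) \<in> le"
proof
  have tr: "trans le" and tot: "total_on {..<2 ^ w} le" and as: "antisym le" and rf: "refl_on {..<2 ^ w} le"
    using linear by (auto simp: order_on_defs)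
  show "key True x \<le> key True y" if "(x, y) \<in> le"
    unfolding key_def using fin_below that tr by (auto intro!: card_mono dest: transD)
  assume *: "key True x \<le> key True y"
  show "(x, y) \<in> le"
  proof (rule ccontr)
    assume no: "(x, y) \<notin> le"
    then have "x \<noteq> y" using rf assms by (auto simp: refl_on_def)
    then have yx: "(y, x) \<in> le" using tot assms no by (auto simp: total_on_def)
    have "{z. (z, y) \<in> le} \<subset> {z. (z, x) \<in> le}"
    proof
      show "{z. (z, y) \<in> le} \<subseteq> {z. (z, x) \<in> le}" using tr yx by (auto dest: transD)
      have "(x, x) \<in> le" using rf assms by (auto simp: refl_on_def)
      then show "{z. (z, y) \<in> le} \<noteq> {z. (z, x) \<in> le}" using no by auto
    qed
    then have "card {z. (z, y) \<in> le} < card {z. (z, x) \<in> le}" by (rule psubset_card_mono[OF fin_below])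
    then show False using * by (simp add: key_def)
  qed
qed

lemma key_pos: "y < 2 ^ w \<Longrightarrow> 1 \<le> key d y"
proof -
  assume "y < 2 ^ w"
  then have "(y, y) \<in> le" using linear by (auto simp: order_on_defs refl_on_def)
  then have "0 < card {z. (z, y) \<in> le}" using fin_below by (auto simp: card_gt_0_iff)
  then show ?thesis using card_below[of y] by (auto simp: key_def)
qed

lemma key_True_le: "key True y \<le> 2 ^ w"
  using card_below[of y] by (auto simp: key_def)

lemma key_rev: "key False x \<le> key False y \<longleftrightarrow> key True y \<le> key True x"
  using card_below[of x] card_below[of y] by (auto simp: key_def)

lemma key_inj: "x < 2 ^ w \<Longrightarrow> y < 2 ^ w \<Longrightarrow> key True x = key True y \<longleftrightarrow> x = y"
  using key_le_iff[of x y] key_le_iff[of y x] linear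
  by (auto simp: order_on_defs antisym_def)

abbreviation at_most :: "bool \<Rightarrow> nat \<Rightarrow> nat \<Rightarrow> bool" where
  "at_most d p \<equiv> \<lambda>y. key d y \<le> p"

abbreviation under :: "nat \<Rightarrow> nat \<Rightarrow> bool" where
  "under t \<equiv> \<lambda>y. key True y < t"

definition cl :: "nat \<Rightarrow> nat" where
  "cl t = cnt X 0 n (under t)"

lemma cl_le: "cl t \<le> n"
  unfolding cl_def using cnt_le[of X 0 n] by simp

lemma rank_cl: "e < 2 ^ w \<Longrightarrow> rank le n X e = cl (key True e + 1)"
  unfolding rank_def cl_def cnt_card using X by (auto simp: key_le_iff[symmetric] less_Suc_eq_le intro!: arg_cong[of _ _ card])

lemma strict_rank_cl: "e < 2 ^ w \<Longrightarrow> strict_rank le n X e = cl (key True e)"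
  unfolding strict_rank_def cl_def cnt_card
  using X by (auto simp: key_le_iff[symmetric] key_inj[symmetric] intro!: arg_cong[of _ _ card])

text \<open>
  Nothing is claimed about thresholds outside of \<open>(klo, khi]\<close>; hence the cells may well contain
  elements outside of the interval, which only corruptions can bring in. The bounds on \<open>cl klo\<close> and
  \<open>cl (khi + 1)\<close> make the ends of the interval admissible answers as far as one side is concerned.
\<close>

definition outer :: "nat \<Rightarrow> nat \<Rightarrow> nat \<Rightarrow> nat \<Rightarrow> mem \<Rightarrow> nat \<Rightarrow> bool" where
  "outer mm kk klo khi m \<alpha> \<longleftrightarrow> 1 \<le> kk \<and> kk \<le> mm \<and> kk \<le> k \<and> mm \<le> n \<and> klo \<le> khi \<and>
     cl klo < k + \<alpha> \<and> k \<le> cl (khi + 1) + \<alpha> \<and>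
     (\<forall>t. klo < t \<longrightarrow> t \<le> khi \<longrightarrow>
        cl t \<le> k - kk + cnt m 0 mm (under t) + \<alpha> \<and>
        k - kk + cnt m 0 mm (under t) \<le> cl t + \<alpha>)"

lemma outer_upd: "outer mm kk klo khi m \<alpha> \<Longrightarrow> outer mm kk klo khi (m(x := v)) (Suc \<alpha>)"
  unfolding outer_def
proof (elim conjE, intro conjI allI impI, goal_cases)
  case (8 t)
  then show ?case using cnt_upd_ge[of m 0 mm "under t" x v] by (force simp: of_bool_def split: if_splits)
next
  case (9 t)
  then show ?case using cnt_upd_le[of m x v 0 mm "under t"] by (force simp: of_bool_def split: if_splits)
qed auto

text \<open>
  The invariant of a level for one direction of the order: \<open>P\<close> is (at least) the largest pivot that was
  too small, and every median that is at most \<open>p\<close>, including the discarded ones counted by \<open>g\<close>, stands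
  for three elements of the instance. The number \<open>f\<close> counts the corruptions at this level. The cells
  \<open>[b, b + j)\<close> and \<open>[b + q, b + z)\<close> are the medians that a discarding pass has kept and not yet read.
\<close>

definition quota :: "bool \<Rightarrow> nat \<Rightarrow> nat \<Rightarrow> nat \<Rightarrow> nat \<Rightarrow> nat \<Rightarrow> nat \<Rightarrow> (nat \<Rightarrow> nat) \<Rightarrow> nat \<Rightarrow> nat \<Rightarrow> nat \<Rightarrow> mem \<Rightarrow> bool" where
  "quota d a b x z q j g \<pi> L f m \<longleftrightarrow> (\<exists>P\<ge>\<pi>. cnt m a (a + 64 * x) (at_most d P) \<le> 8 * x + f \<and>
     (\<forall>p\<ge>P. 3 * (cnt m b (b + j) (at_most d p) + cnt m (b + q) (b + z) (at_most d p) + g p)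
        \<le> cnt m a (a + 64 * x) (at_most d p) + L * f))"

text \<open>One corruption adds at most one median, at weight 3, and takes at most one element from
  the instance; hence the slack of at least 4 per corruption. The condition \<open>j \<le> q\<close>
  keeps the two ranges of medians disjoint, so that they gain at most one together.\<close>

lemma quota_upd:
  assumes "quota d a b x z q j g \<pi> L f m" "4 \<le> L" "j \<le> q"
    and f': "f + of_bool (a \<le> u \<and> u < a + 64 * x \<or> b \<le> u \<and> u < b + max j z) \<le> f'"
  shows "quota d a b x z q j g \<pi> L f' (m(u := v))"
proof -
  let ?A = "\<lambda>m p. cnt m a (a + 64 * x) (at_most d p)"
  let ?B = "\<lambda>m p. cnt m b (b + j) (at_most d p)"
  let ?C = "\<lambda>m p. cnt m (b + q) (b + z) (at_most d p)"
  obtain P where P: "\<pi> \<le> P" "?A m P \<le> 8 * x + f"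
    "\<And>p. P \<le> p \<Longrightarrow> 3 * (?B m p + ?C m p + g p) \<le> ?A m p + L * f"
    using assms(1) unfolding quota_def by blast
  let ?m = "m(u := v)"
  show ?thesis
  proof (cases "a \<le> u \<and> u < a + 64 * x \<or> b \<le> u \<and> u < b + max j z")
    case True
    then have f: "f + 1 \<le> f'" using f' by simp
    have "4 \<le> L * (f' - f)" using assms(2) f mult_le_mono[of 4 L 1 "f' - f"] by simp
    moreover have "L * f' = L * f + L * (f' - f)" using f by (simp flip: distrib_left)
    ultimately have L: "L * f + 4 \<le> L * f'" by simp
    have "3 * (?B ?m p + ?C ?m p + g p) \<le> ?A ?m p + L * f'" if "P \<le> p" for p
    proof -
      have "?B ?m p + ?C ?m p \<le> ?B m p + ?C m p + 1"
        using cnt_upd_le[of m u v b "b + j" "at_most d p"] cnt_upd_le[of m u v "b + q" "b + z" "at_most d p"] \<open>j \<le> q\<close>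
        by (auto simp: of_bool_def split: if_splits)
      moreover have "?A m p \<le> ?A ?m p + 1"
        using cnt_upd_ge[of m a "a + 64 * x" "at_most d p" u v]
        by (auto simp: of_bool_def split: if_splits)
      moreover have "B' + C' \<le> B + C + 1 \<Longrightarrow> A \<le> A' + 1 \<Longrightarrow> 3 * (B + C + e) \<le> A + c \<Longrightarrow> c + 4 \<le> c' \<Longrightarrow>
          3 * (B' + C' + e) \<le> A' + c'" for A B C A' B' C' c c' e :: nat
        by (simp add: algebra_simps)
      ultimately show ?thesis using P(3)[OF that] L by blast
    qed
    moreover have "?A ?m P \<le> 8 * x + f'"
      using cnt_upd_le[of m u v a "a + 64 * x" "at_most d P"] P(2) f
      by (auto simp: of_bool_def split: if_splits)
    ultimately show ?thesis unfolding quota_def using P(1) by blast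
  next
    case False
    then have "u < a \<or> a + 64 * x \<le> u" "u < b \<or> b + j \<le> u" "u < b + q \<or> b + z \<le> u" by auto
    then have eq: "?A ?m p = ?A m p" "?B ?m p = ?B m p" "?C ?m p = ?C m p" for p by simp_all
    have "L * f \<le> L * f'" using f' False by simp
    then have "3 * (?B ?m p + ?C ?m p + g p) \<le> ?A ?m p + L * f'" if "P \<le> p" for p
      unfolding eq using P(3)[OF that] by linarith
    moreover have "?A ?m P \<le> 8 * x + f'" unfolding eq using P(2) f' by simp
    ultimately show ?thesis unfolding quota_def using P(1) by blast
  qed
qed

lemma quota_mono:
  assumes "quota d a b x z q j g \<pi> L f m"
    and "\<And>p. \<pi> \<le> p \<Longrightarrow> 3 * g' p + L * f \<le> 3 * g p + L' * f'" "f \<le> f'"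
  shows "quota d a b x z q j g' \<pi> L' f' m"
proof -
  obtain P where P: "\<pi> \<le> P" "cnt m a (a + 64 * x) (at_most d P) \<le> 8 * x + f"
    "\<forall>p\<ge>P. 3 * (cnt m b (b + j) (at_most d p) + cnt m (b + q) (b + z) (at_most d p) + g p)
        \<le> cnt m a (a + 64 * x) (at_most d p) + L * f"
    using assms(1) unfolding quota_def by blast
  show ?thesis unfolding quota_def
  proof (intro exI[of _ P] conjI allI impI)
    fix p assume "P \<le> p"
    then show "3 * (cnt m b (b + j) (at_most d p) + cnt m (b + q) (b + z) (at_most d p) + g' p)
        \<le> cnt m a (a + 64 * x) (at_most d p) + L' * f'"
      using P(3) assms(2)[of p] P(1) by fastforce
  qed (use P assms(3) in auto)
qed

text \<open>Between its read and its fate a median is held in a register. It is then counted by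
  \<open>g\<close>, where no corruption can reach it.\<close>

lemma quota_read:
  assumes "quota d a b x z q j g \<pi> L f m" "q < z"
  shows "quota d a b x z (Suc q) j (\<lambda>p. g p + of_bool (key d (m (b + q)) \<le> p)) \<pi> L f m"
proof -
  have "cnt m (b + q) (b + z) P = of_bool (P (m (b + q))) + cnt m (b + Suc q) (b + z) P" for P
    using cnt_first[of "b + q" "b + z" m P] assms(2) by simp
  then show ?thesis using assms(1) unfolding quota_def by (simp add: algebra_simps)
qed

lemma quota_write:
  assumes "quota d a b x z q j (\<lambda>p. g p + of_bool (key d y \<le> p)) \<pi> L f m" "j < q" "a + 64 * x \<le> b"
  shows "quota d a b x z q (Suc j) g \<pi> L f (m(b + j := y))"
proof -
  have "cnt (m(b + j := y)) b (b + Suc j) P = cnt m b (b + j) P + of_bool (P y)" for P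
    using cnt_store_end[of b "b + j" m y P] by simp
  moreover have "cnt (m(b + j := y)) a (a + 64 * x) P = cnt m a (a + 64 * x) P"
    "cnt (m(b + j := y)) (b + q) (b + z) P = cnt m (b + q) (b + z) P" for P
    using assms by simp_all
  ultimately show ?thesis using assms(1) unfolding quota_def by (simp add: algebra_simps)
qed

text \<open>The slack \<open>4 + 3 * l\<close> has two sources: 4 for the direct effect of a
  corruption, and 3 for each of the \<open>l\<close> failures on this side, since each discarding
  pass may have fallen short of its \<open>x\<close> medians by the number of corruptions.\<close>

definition half :: "bool \<Rightarrow> nat \<Rightarrow> nat \<Rightarrow> nat \<Rightarrow> nat \<Rightarrow> nat \<Rightarrow> mem \<Rightarrow> bool" where
  "half d b x i l f m = quota d (b - 512 * x) b x ((12 - i) * x) 0 0 (\<lambda>_. l * x) 0 (4 + 3 * l) f m"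

definition level_inv :: "nat \<Rightarrow> nat \<Rightarrow> nat \<Rightarrow> nat \<Rightarrow> mem \<Rightarrow> bool" where
  "level_inv x b i f m \<longleftrightarrow> (\<exists>l h. l + h = i \<and> half True b x i l f m \<and> half False b x i h f m)"

lemma level_inv_upd:
  assumes "level_inv x b i f m" "f + of_bool (b - 512 * x \<le> u \<and> u < b + 64 * x) \<le> f'"
  shows "level_inv x b i f' (m(u := v))"
proof -
  define z where "z = (12 - i) * x"
  have "z \<le> 64 * x" unfolding z_def by (rule mult_le_mono1) simp
  then have "f + of_bool (b - 512 * x \<le> u \<and> u < (b - 512 * x) + 64 * x \<or> b \<le> u \<and> u < b + max 0 z) \<le> f'"
    using assms(2) by (auto simp: of_bool_def split: if_splits)
  then have "half d b x i l f' (m(u := v))" if "half d b x i l f m" for d l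
    using quota_upd[of d "b - 512 * x" b x z 0 0 "\<lambda>_. l * x" 0 "4 + 3 * l" f m u f' v] that
    unfolding half_def z_def by simp
  then show ?thesis using assms(1) unfolding level_inv_def by blast
qed

text \<open>At \<open>P\<close> the discarded medians alone demand \<open>9 x\<close> elements where
  at most \<open>8 x + f\<close> are available. The slack is at most \<open>19 * f\<close> because
  \<open>l \<le> 5\<close>, and 20 is 19 + 1.\<close>

lemma half_exhausted:
  assumes "half d b x i l f m" "3 \<le> l" "l \<le> 5"
  shows "x \<le> 20 * f"
proof -
  obtain P where P: "cnt m (b - 512 * x) ((b - 512 * x) + 64 * x) (at_most d P) \<le> 8 * x + f"
    "3 * (l * x) \<le> cnt m (b - 512 * x) ((b - 512 * x) + 64 * x) (at_most d P) + (4 + 3 * l) * f"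
    using assms(1) unfolding half_def quota_def by fastforce
  have "(4 + 3 * l) * f \<le> 19 * f" "3 * x \<le> l * x" using assms by (auto intro: mult_le_mono1)
  then show ?thesis using P by linarith
qed

lemma level_inv_exhausted: "level_inv x b 5 f m \<Longrightarrow> x \<le> 20 * f"
proof -
  assume "level_inv x b 5 f m"
  then obtain l h where lh: "l + h = 5" "half True b x 5 l f m" "half False b x 5 h f m" unfolding level_inv_def by blast
  then have "3 \<le> l \<and> l \<le> 5 \<or> 3 \<le> h \<and> h \<le> 5" by linarith
  then show ?thesis using half_exhausted lh by blast
qed

section \<open>The levels of the pivot search\<close>

text \<open>
  A frame \<open>(i, f)\<close> consists of the number of failures at a level and the number of corruptions at this
  level since it was last started. The arguments \<open>NN\<close>, \<open>b\<close> and \<open>S\<close> are those of the current level, and the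
  head of the list is the frame of the level that encloses it. The last frame belongs to the current
  array at the top level.
\<close>

fun stk :: "nat \<Rightarrow> nat \<Rightarrow> nat \<Rightarrow> nat \<Rightarrow> (nat \<times> nat) list \<Rightarrow> mem \<Rightarrow> bool" where
  "stk N0 NN b S [] m = False"
| "stk N0 NN b S [(i, f)] m = (NN = N0 \<and> b = 8 * N0 \<and> S = 0)"
| "stk N0 NN b S ((i, f) # g # fs) m = (i < 5 \<and> S mod 8 = i \<and> Suc S * NN \<le> N0 \<and> NN < N0 \<and> 72 * NN \<le> b \<and>
     b + 2 * NN \<le> 10 * N0 \<and> (\<exists>x>0. NN = 8 * x \<and> level_inv x (b - 8 * NN) i f m) \<and>
     stk N0 (8 * NN) (b - 8 * NN) (S div 8) (g # fs) m)"

fun bump :: "nat \<Rightarrow> nat \<Rightarrow> nat \<Rightarrow> (nat \<times> nat) list \<Rightarrow> (nat \<times> nat) list" where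
  "bump u NN b [] = []"
| "bump u NN b [(i, f)] = [(i, f + of_bool (u < b))]"
| "bump u NN b ((i, f) # g # fs) =
     (i, f + of_bool (b - 72 * NN \<le> u \<and> u < b)) # bump u (8 * NN) (b - 8 * NN) (g # fs)"

text \<open>
  The fuel that is needed after the current level returns: an instance of size \<open>NN\<close> costs \<open>5 NN\<close> and a
  return from it \<open>NN\<close>, at most \<open>5 - i\<close> returns remain at a level, and a stage with an array of size \<open>mm\<close>
  and all stages after it cost \<open>96 mm\<close>.
\<close>

fun pot :: "nat \<Rightarrow> nat \<Rightarrow> (nat \<times> nat) list \<Rightarrow> nat" where
  "pot mm NN [] = 0"
| "pot mm NN [(i, f)] = 96 * mm - 5 * NN"
| "pot mm NN ((i, f) # g # fs) = (25 - 6 * i) * NN + pot mm (8 * NN) (g # fs)"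

definition total :: "(nat \<times> nat) list \<Rightarrow> nat" where
  "total fs = sum_list (map snd fs)"

lemma stk_facts:
  assumes "stk N0 NN b S fs m"
  shows "8 * NN \<le> b" "b + 2 * NN \<le> 10 * N0" "Suc S * NN \<le> N0" "NN \<le> N0" "fs \<noteq> []"
  using assms by (cases "(N0, NN, b, S, fs, m)" rule: stk.cases; auto)+

lemma bump_Nil [simp]: "bump u NN b fs = [] \<longleftrightarrow> fs = []"
  by (cases "(u, NN, b, fs)" rule: bump.cases) auto

lemma stk_bump: "stk N0 NN b S fs m \<Longrightarrow> stk N0 NN b S (bump u NN b fs) (m(u := v))"
proof (induction N0 NN b S fs m rule: stk.induct)
  case (3 N0 NN b S i f g fs m)
  obtain g' fs' where g: "bump u (8 * NN) (b - 8 * NN) (g # fs) = g' # fs'"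
    by (cases "bump u (8 * NN) (b - 8 * NN) (g # fs)") auto
  obtain x where x: "0 < x" "NN = 8 * x" "level_inv x (b - 8 * NN) i f m" using 3 by auto
  have "72 * NN \<le> b" using 3 by simp
  then have "level_inv x (b - 8 * NN) i (f + of_bool (b - 72 * NN \<le> u \<and> u < b)) (m(u := v))"
    by (intro level_inv_upd[OF x(3)]) (use x in auto)
  moreover have "stk N0 (8 * NN) (b - 8 * NN) (S div 8) (g' # fs') (m(u := v))"
  proof -
    have "stk N0 (8 * NN) (b - 8 * NN) (S div 8) (g # fs) m" using 3(2) by simp
    from 3(1)[OF this] show ?thesis unfolding g .
  qed
  ultimately show ?case using 3(2) g x(1,2) unfolding bump.simps stk.simps g by blast
qed simp_all

text \<open>The ranges of consecutive levels overlap in \<open>[b - 8 * NN, b)\<close>, and no cell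
  lies in three of them. The current level has no frame in \<open>fs\<close>, so a cell in its range
  adds at most one here, leaving room for its own counter.\<close>

lemma total_bump:
  "stk N0 NN b S fs m \<Longrightarrow>
     total (bump u NN b fs) \<le> total fs + (if b \<le> u then 0 else if b - 8 * NN \<le> u then 1 else 2)"
proof (induction N0 NN b S fs m rule: stk.induct)
  case (3 N0 NN b S i f g fs m)
  then have IH: "total (bump u (8 * NN) (b - 8 * NN) (g # fs)) \<le> total (g # fs) +
     (if b - 8 * NN \<le> u then 0 else if b - 8 * NN - 8 * (8 * NN) \<le> u then 1 else 2)" by auto
  have "72 * NN \<le> b" using 3 by simp
  then have "b - 8 * NN - 8 * (8 * NN) = b - 72 * NN" by simp
  then show ?case using IH \<open>72 * NN \<le> b\<close> by (auto simp: total_def split: if_splits)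
qed (auto simp: total_def)

lemma pot_bump [simp]: "pot mm NN (bump u NN b fs) = pot mm NN fs"
proof (induction mm NN fs arbitrary: b rule: pot.induct)
  case (3 mm NN i f g fs)
  obtain h t where b: "bump u (8 * NN) (b - 8 * NN) (g # fs) = h # t"
    by (cases "bump u (8 * NN) (b - 8 * NN) (g # fs)") auto
  have "pot mm (8 * NN) (h # t) = pot mm (8 * NN) (g # fs)" using 3[of "b - 8 * NN"] unfolding b .
  then show ?case using b by simp
qed simp_all

lemma hd_bump:
  "stk N0 NN b S fs m \<Longrightarrow> snd (hd fs) + of_bool (b - 8 * NN \<le> u \<and> u < b) \<le> snd (hd (bump u NN b fs))"
proof (cases "(N0, NN, b, S, fs, m)" rule: stk.cases)
  case (3 N0' NN' b' S' i f g fs' m')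
  moreover assume "stk N0 NN b S fs m"
  ultimately have "72 * NN \<le> b" by simp
  then show ?thesis using 3 by auto
qed auto

definition klo :: "regs \<Rightarrow> nat" where
  "klo s = (if s 6 = 1 then key True (s 4) else 0)"

definition khi :: "regs \<Rightarrow> nat" where
  "khi s = (if s 7 = 1 then key True (s 5) else 2 ^ w + 1)"

lemma klo_upd [simp]: "r \<noteq> 4 \<Longrightarrow> r \<noteq> 6 \<Longrightarrow> klo (s(r := v)) = klo s"
  and khi_upd [simp]: "r \<noteq> 5 \<Longrightarrow> r \<noteq> 7 \<Longrightarrow> khi (s(r := v)) = khi s"
  by (auto simp: klo_def khi_def)

text \<open>
  \<open>\<Phi>\<close> states what is known at the current level, in terms of the corruptions at this level and at the
  enclosing one. A corruption affects at most two levels, hence the factor 2. The corruptions in \<open>con\<close>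
  have already paid for a restart of their level.
\<close>

definition core :: "(nat \<Rightarrow> nat \<Rightarrow> mem \<Rightarrow> bool) \<Rightarrow> nat \<Rightarrow> assn" where
  "core \<Phi> Pt s m \<alpha> \<longleftrightarrow> s 0 = n \<and> outer (s 3) (s 1) (klo s) (khi s) m \<alpha> \<and> s 9 \<le> s 3 \<and> s 3 < 8 * s 9 \<and>
     (\<exists>e. s 8 = 8 ^ e) \<and>
     (\<exists>f fs con. \<Phi> f (snd (hd fs)) m \<and> stk (s 9) (s 8) (s 10) (s 11) fs m \<and>
        con + f + total fs \<le> 2 * \<alpha> \<and>
        16384 * n + Pt + pot (s 3) (s 8) fs \<le> 96 * n + 6400 * con + s 15)"

text \<open>The bookkeeping of the levels is stable once and for all, so only \<open>\<Phi>\<close>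
  has to be checked, with the current and the enclosing counter raised where they should be. The map
  \<open>h\<close> serves assertions about the registers as they will be after pending
  assignments.\<close>

lemma core_stable:
  assumes "\<And>s f fp m u v f' fp'. A s \<Longrightarrow> 8 * s 8 \<le> s 10 \<Longrightarrow> \<Phi> s f fp m \<Longrightarrow>
      f + of_bool (s 10 - 8 * s 8 \<le> u \<and> u < s 10 + s 8) \<le> f' \<Longrightarrow>
      fp + of_bool (s 10 - 8 * s 8 \<le> u \<and> u < s 10) \<le> fp' \<Longrightarrow> \<Phi> s f' fp' (m(u := v))"
  shows "stable (\<lambda>s m \<alpha>. A (h s) \<and> core (\<Phi> (h s)) (Pt (h s)) (h s) m \<alpha>)"
proof -
  have "A s \<and> core (\<Phi> s) (Pt s) s (m(u := v)) (Suc \<alpha>)" if "A s \<and> core (\<Phi> s) (Pt s) s m \<alpha>" for s m \<alpha> u v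
  using that
proof (elim conjE, intro conjI)
  assume A: "A s" and c: "core (\<Phi> s) (Pt s) s m \<alpha>"
  obtain f fs con where f: "\<Phi> s f (snd (hd fs)) m" "stk (s 9) (s 8) (s 10) (s 11) fs m"
     "con + f + total fs \<le> 2 * \<alpha>" "16384 * n + Pt s + pot (s 3) (s 8) fs \<le> 96 * n + 6400 * con + s 15"
    using c unfolding core_def by blast
  let ?fs = "bump u (s 8) (s 10) fs"
  let ?f = "f + of_bool (s 10 - 8 * s 8 \<le> u \<and> u < s 10 + s 8)"
  have "\<Phi> s ?f (snd (hd ?fs)) (m(u := v))"
    by (rule assms[OF A stk_facts(1)[OF f(2)] f(1)]) (use hd_bump[OF f(2)] in auto)
  moreover have "con + ?f + total ?fs \<le> 2 * Suc \<alpha>"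
    using total_bump[OF f(2), of u] f(3) by (auto split: if_splits)
  moreover have "16384 * n + Pt s + pot (s 3) (s 8) ?fs \<le> 96 * n + 6400 * con + s 15" using f(4) by simp
  ultimately have "\<exists>f fs con. \<Phi> s f (snd (hd fs)) (m(u := v)) \<and> stk (s 9) (s 8) (s 10) (s 11) fs (m(u := v)) \<and>
      con + f + total fs \<le> 2 * Suc \<alpha> \<and> 16384 * n + Pt s + pot (s 3) (s 8) fs \<le> 96 * n + 6400 * con + s 15"
    using stk_bump[OF f(2), of u v] by blast
  then show "core (\<Phi> s) (Pt s) s (m(u := v)) (Suc \<alpha>)"
    using c outer_upd unfolding core_def by blast
qed
  then show ?thesis unfolding stable_def by blast
qed

lemma stk_base: "stk N0 NN b S fs m \<Longrightarrow> 8 * N0 \<le> b"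
  by (induction N0 NN b S fs m rule: stk.induct) auto

lemma bump_id: "stk N0 NN b S fs m \<Longrightarrow> b \<le> u \<Longrightarrow> bump u NN b fs = fs"
proof (induction N0 NN b S fs m rule: stk.induct)
  case (3 N0 NN b S i f g fs m)
  then have "bump u (8 * NN) (b - 8 * NN) (g # fs) = g # fs" by (intro 3(1)) auto
  then show ?case using 3(3) by simp
qed auto

lemma outer_other: "outer mm kk lo hi m \<alpha> \<Longrightarrow> mm \<le> u \<Longrightarrow> outer mm kk lo hi (m(u := v)) \<alpha>"
proof -
  assume a: "outer mm kk lo hi m \<alpha>" "mm \<le> u"
  have eq: "cnt (m(u := v)) 0 mm P = cnt m 0 mm P" for P using a(2) by simp
  show ?thesis using a(1) unfolding outer_def eq .
qed

lemma core_store: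
  assumes "core \<Phi> Pt s m \<alpha>" "s 10 \<le> u" "\<And>f fp. \<Phi> f fp m \<Longrightarrow> \<Phi>' f fp (m(u := v))"
  shows "core \<Phi>' Pt s (m(u := v)) \<alpha>"
proof -
  obtain f fs con where f: "\<Phi> f (snd (hd fs)) m" "stk (s 9) (s 8) (s 10) (s 11) fs m"
     "con + f + total fs \<le> 2 * \<alpha> \<and> 16384 * n + Pt + pot (s 3) (s 8) fs \<le> 96 * n + 6400 * con + s 15"
    and c: "s 0 = n" "outer (s 3) (s 1) (klo s) (khi s) m \<alpha>" "s 9 \<le> s 3" "s 3 < 8 * s 9" "\<exists>e. s 8 = 8 ^ e"
    using assms(1) unfolding core_def by blast
  have "stk (s 9) (s 8) (s 10) (s 11) fs (m(u := v))"
    using stk_bump[OF f(2), of u v] bump_id[OF f(2) assms(2)] by simp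
  moreover have "outer (s 3) (s 1) (klo s) (khi s) (m(u := v)) \<alpha>"
    using stk_base[OF f(2)] c assms(2) by (intro outer_other[OF c(2)]) linarith
  moreover note assms(3)[OF f(1)]
  ultimately show ?thesis unfolding core_def using c f(3) by blast
qed

lemma core_bounds:
  assumes "core \<Phi> Pt s m \<alpha>"
  shows "s 0 = n" "8 * s 8 \<le> s 10" "s 10 + 2 * s 8 \<le> 10 * n" "Suc (s 11) * s 8 \<le> n" "s 9 \<le> n" "s 8 \<le> s 9"
    "s 3 \<le> n" "1 \<le> s 8"
proof -
  obtain f fs con where c: "s 0 = n" "outer (s 3) (s 1) (klo s) (khi s) m \<alpha>" "s 9 \<le> s 3"
    "stk (s 9) (s 8) (s 10) (s 11) fs m" "\<exists>e. s 8 = 8 ^ e"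
    using assms unfolding core_def by blast
  then show "s 0 = n" "8 * s 8 \<le> s 10" "s 10 + 2 * s 8 \<le> 10 * n" "Suc (s 11) * s 8 \<le> n" "s 9 \<le> n" "s 8 \<le> s 9"
    "s 3 \<le> n" "1 \<le> s 8"
    using stk_facts[OF c(4)] by (auto simp: outer_def)
qed

lemma core_cong:
  assumes "core \<Phi> Pt s m \<alpha>" "\<And>r. r \<in> {0, 1, 3, 4, 5, 6, 7, 8, 9, 10, 11, 15} \<Longrightarrow> s' r = s r"
    "\<And>f fp. \<Phi> f fp m \<Longrightarrow> \<Phi>' f fp m" "Pt' \<le> Pt"
  shows "core \<Phi>' Pt' s' m \<alpha>"
proof -
  have "klo s' = klo s" "khi s' = khi s" using assms(2) by (simp_all add: klo_def khi_def)
  moreover obtain f fs con where f: "\<Phi> f (snd (hd fs)) m" "stk (s 9) (s 8) (s 10) (s 11) fs m"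
     "con + f + total fs \<le> 2 * \<alpha>" "16384 * n + Pt + pot (s 3) (s 8) fs \<le> 96 * n + 6400 * con + s 15"
    and c: "s 0 = n \<and> outer (s 3) (s 1) (klo s) (khi s) m \<alpha> \<and> s 9 \<le> s 3 \<and> s 3 < 8 * s 9 \<and> (\<exists>e. s 8 = 8 ^ e)"
    using assms(1) unfolding core_def by blast
  moreover have "\<Phi>' f (snd (hd fs)) m" using assms(3) f(1) .
  moreover have "16384 * n + Pt' + pot (s 3) (s 8) fs \<le> 96 * n + 6400 * con + s 15" using f(4) assms(4) by linarith
  ultimately show ?thesis unfolding core_def by (auto simp: assms(2))
qed

section \<open>Word arithmetic without overflow\<close>

lemma aval_N: "c < 2 ^ w \<Longrightarrow> aval w (N c) s = c" by simp

lemma aval_Plus: "aval w a s + aval w b s < 2 ^ w \<Longrightarrow> aval w (Plus a b) s = aval w a s + aval w b s"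
  by simp

lemma aval_Times: "aval w a s * aval w b s < 2 ^ w \<Longrightarrow> aval w (Times a b) s = aval w a s * aval w b s"
  by simp

lemma aval_Minus: "aval w b s \<le> aval w a s \<Longrightarrow> aval w a s < 2 ^ w \<Longrightarrow>
    aval w (Minus a b) s = aval w a s - aval w b s"
proof -
  assume a: "aval w b s \<le> aval w a s" "aval w a s < 2 ^ w"
  then have "int (aval w a s) - int (aval w b s) = int (aval w a s - aval w b s)" by simp
  moreover have "int (aval w a s - aval w b s) < 2 ^ w" using a by (simp add: less_imp_diff_less flip: of_nat_diff)
  ultimately show ?thesis by (simp del: of_nat_diff)
qed

declare aval.simps(1,3,4,5) [simp del]

section \<open>Medians of groups of five\<close>

lemma small_n: "c \<le> 30000 * n \<Longrightarrow> c < (2 :: nat) ^ w"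
  using wide by simp

text \<open>Only the part of the instance that has been read is counted. The slack of 4 per
  corruption is the one with which \<open>half\<close> starts.\<close>

definition medians_bound :: "nat \<Rightarrow> nat \<Rightarrow> nat \<Rightarrow> nat \<Rightarrow> (bool \<Rightarrow> nat \<Rightarrow> nat) \<Rightarrow> nat \<Rightarrow> mem \<Rightarrow> bool" where
  "medians_bound a a' b b' g f m \<longleftrightarrow> (\<forall>d p. 3 * cnt m b b' (at_most d p) + g d p \<le> cnt m a a' (at_most d p) + 4 * f)"

lemma medians_bound_upd:
  assumes "medians_bound a a' b b' g f m" "a \<le> b" "a' \<le> c" "b' \<le> c" "f + of_bool (a \<le> u \<and> u < c) \<le> f'"
  shows "medians_bound a a' b b' g f' (m(u := v))"
  unfolding medians_bound_def
proof (intro allI)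
  fix d p
  have *: "3 * cnt m b b' (at_most d p) + g d p \<le> cnt m a a' (at_most d p) + 4 * f"
    using assms(1) unfolding medians_bound_def by blast
  show "3 * cnt (m(u := v)) b b' (at_most d p) + g d p \<le> cnt (m(u := v)) a a' (at_most d p) + 4 * f'"
  proof (cases "a \<le> u \<and> u < c")
    case True
    then show ?thesis
      using * assms(5) cnt_upd_le[of m u v b b' "at_most d p"] cnt_upd_ge[of m a a' "at_most d p" u v]
      by (auto simp: of_bool_def split: if_splits)
  next
    case False
    then have "u < a \<or> a' \<le> u" "u < b \<or> b' \<le> u" using assms by auto
    then show ?thesis using * assms(5) by simp
  qed
qed

lemma ev_cmp_exch_other: "r \<notin> {i, j, 25} \<Longrightarrow> ev (cmp_exch i j) s r = s r"
  by (simp add: cmp_exch_def)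

text \<open>The zero-one principle: seen through a threshold, an exchange computes a disjunction and
  a conjunction, with the roles swapped for the reversed order.\<close>

lemma ev_cmp_exch:
  assumes "wf_state w s m" "i \<noteq> j" "i \<noteq> 25" "j \<noteq> 25"
  shows "key d (ev (cmp_exch i j) s i) \<le> p \<longleftrightarrow>
      (if d then key d (s i) \<le> p \<or> key d (s j) \<le> p else key d (s i) \<le> p \<and> key d (s j) \<le> p)"
    "key d (ev (cmp_exch i j) s j) \<le> p \<longleftrightarrow>
      (if d then key d (s i) \<le> p \<and> key d (s j) \<le> p else key d (s i) \<le> p \<or> key d (s j) \<le> p)"
proof -
  have "(s i, s j) \<in> le \<longleftrightarrow> key True (s i) \<le> key True (s j)"
    using assms(1) by (simp add: wf_state_def key_le_iff)
  then show "key d (ev (cmp_exch i j) s i) \<le> p \<longleftrightarrow>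
      (if d then key d (s i) \<le> p \<or> key d (s j) \<le> p else key d (s i) \<le> p \<and> key d (s j) \<le> p)"
    "key d (ev (cmp_exch i j) s j) \<le> p \<longleftrightarrow>
      (if d then key d (s i) \<le> p \<and> key d (s j) \<le> p else key d (s i) \<le> p \<or> key d (s j) \<le> p)"
    using assms(2-4) key_rev[of "s i" "s j"] key_rev[of "s j" "s i"]
    by (cases d; auto simp: cmp_exch_def)+
qed

lemma ev_median5_other: "r < 20 \<or> 25 < r \<Longrightarrow> ev median5 s r = s r"
  by (auto simp: median5_def ev_cmp_exch_other)

text \<open>By the zero-one principle only the five truth values of the inputs matter, which leaves
  32 cases for each direction.\<close>

lemma ev_median5:
  assumes "wf_state w s m"
  shows "3 * of_bool (key d (ev median5 s 24) \<le> p) \<le> (\<Sum>i<5. of_bool (key d (s (20 + i)) \<le> p) :: nat)"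
proof -
  define s1 where "s1 = ev (cmp_exch 20 21) s"
  define s2 where "s2 = ev (cmp_exch 22 23) s1"
  define s3 where "s3 = ev (cmp_exch 20 22) s2"
  define s4 where "s4 = ev (cmp_exch 21 23) s3"
  define s5 where "s5 = ev (cmp_exch 21 22) s4"
  define s6 where "s6 = ev (cmp_exch 21 24) s5"
  define s7 where "s7 = ev (cmp_exch 24 22) s6"
  have wf: "wf_state w s1 m" "wf_state w s2 m" "wf_state w s3 m" "wf_state w s4 m" "wf_state w s5 m" "wf_state w s6 m"
    unfolding s1_def s2_def s3_def s4_def s5_def s6_def by (intro ev_wf assms)+
  have s: "ev median5 s = s7"
    unfolding median5_def s1_def s2_def s3_def s4_def s5_def s6_def s7_def by simp
  note E = ev_cmp_exch[where d = d and p = p]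
  have 1: "key d (s1 20) \<le> p \<longleftrightarrow> (if d then key d (s 20) \<le> p \<or> key d (s 21) \<le> p else key d (s 20) \<le> p \<and> key d (s 21) \<le> p)"
    "key d (s1 21) \<le> p \<longleftrightarrow> (if d then key d (s 20) \<le> p \<and> key d (s 21) \<le> p else key d (s 20) \<le> p \<or> key d (s 21) \<le> p)"
    "s1 22 = s 22" "s1 23 = s 23" "s1 24 = s 24"
    unfolding s1_def using E[OF assms, of 20 21] by (simp_all add: ev_cmp_exch_other)
  have 2: "key d (s2 22) \<le> p \<longleftrightarrow> (if d then key d (s1 22) \<le> p \<or> key d (s1 23) \<le> p else key d (s1 22) \<le> p \<and> key d (s1 23) \<le> p)"
    "key d (s2 23) \<le> p \<longleftrightarrow> (if d then key d (s1 22) \<le> p \<and> key d (s1 23) \<le> p else key d (s1 22) \<le> p \<or> key d (s1 23) \<le> p)"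
    "s2 20 = s1 20" "s2 21 = s1 21" "s2 24 = s1 24"
    unfolding s2_def using E[OF wf(1), of 22 23] by (simp_all add: ev_cmp_exch_other)
  have 3: "key d (s3 22) \<le> p \<longleftrightarrow> (if d then key d (s2 20) \<le> p \<and> key d (s2 22) \<le> p else key d (s2 20) \<le> p \<or> key d (s2 22) \<le> p)"
    "s3 21 = s2 21" "s3 23 = s2 23" "s3 24 = s2 24"
    unfolding s3_def using E[OF wf(2), of 20 22] by (simp_all add: ev_cmp_exch_other)
  have 4: "key d (s4 21) \<le> p \<longleftrightarrow> (if d then key d (s3 21) \<le> p \<or> key d (s3 23) \<le> p else key d (s3 21) \<le> p \<and> key d (s3 23) \<le> p)"
    "s4 22 = s3 22" "s4 24 = s3 24"
    unfolding s4_def using E[OF wf(3), of 21 23] by (simp_all add: ev_cmp_exch_other)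
  have 5: "key d (s5 21) \<le> p \<longleftrightarrow> (if d then key d (s4 21) \<le> p \<or> key d (s4 22) \<le> p else key d (s4 21) \<le> p \<and> key d (s4 22) \<le> p)"
    "key d (s5 22) \<le> p \<longleftrightarrow> (if d then key d (s4 21) \<le> p \<and> key d (s4 22) \<le> p else key d (s4 21) \<le> p \<or> key d (s4 22) \<le> p)"
    "s5 24 = s4 24"
    unfolding s5_def using E[OF wf(4), of 21 22] by (simp_all add: ev_cmp_exch_other)
  have 6: "key d (s6 24) \<le> p \<longleftrightarrow> (if d then key d (s5 21) \<le> p \<and> key d (s5 24) \<le> p else key d (s5 21) \<le> p \<or> key d (s5 24) \<le> p)"
    "s6 22 = s5 22"
    unfolding s6_def using E[OF wf(5), of 21 24] by (simp_all add: ev_cmp_exch_other)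
  have 7: "key d (s7 24) \<le> p \<longleftrightarrow> (if d then key d (s6 24) \<le> p \<or> key d (s6 22) \<le> p else key d (s6 24) \<le> p \<and> key d (s6 22) \<le> p)"
    unfolding s7_def using E[OF wf(6), of 24 22] by simp
  have sum: "(\<Sum>i<5. f (20 + i)) = f 20 + f 21 + f 22 + f 23 + f 24" for f :: "nat \<Rightarrow> nat"
    by (simp add: eval_nat_numeral)
  show ?thesis
    unfolding s sum[of "\<lambda>r. of_bool (key d (s r) \<le> p)"] 7 6 5 4 3 2 1
    by (cases d; cases "key d (s 20) \<le> p"; cases "key d (s 21) \<le> p"; cases "key d (s 22) \<le> p";
        cases "key d (s 23) \<le> p"; cases "key d (s 24) \<le> p"; simp)
qed

text \<open>Here \<open>j\<close> elements of the current group have been loaded, and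
  \<open>g\<close> is their contribution until the median is stored. The bound \<open>bd\<close> is
  \<open>12 x\<close> inside the body and \<open>12 x + 1\<close> at the loop head; \<open>v\<close>
  bounds the remaining iterations.\<close>

definition medians_at :: "nat \<Rightarrow> nat \<Rightarrow> nat \<Rightarrow> nat \<Rightarrow> nat \<Rightarrow> (regs \<Rightarrow> bool \<Rightarrow> nat \<Rightarrow> nat) \<Rightarrow> assn" where
  "medians_at x Pt bd v j g s m \<alpha> \<longleftrightarrow> (s 8 = 64 * x \<and> 0 < x \<and> s 16 < bd \<and> bd \<le> 12 * x + 1 \<and> (0 < j \<longrightarrow> bd \<le> 12 * x) \<and> 12 * x - s 16 \<le> v \<and> j \<le> 5) \<and>
     core (\<lambda>f fp m. medians_bound (s 10 - 8 * s 8) (s 10 - 8 * s 8 + (5 * s 16 + j)) (s 10) (s 10 + s 16) (g s) f m) Pt s m \<alpha>"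

lemma medians_at_stable: "stable (\<lambda>s. medians_at x Pt bd v j g (h s))"
  unfolding medians_at_def
proof (rule core_stable[where \<Phi> = "\<lambda>s f fp m. medians_bound (s 10 - 8 * s 8) (s 10 - 8 * s 8 + (5 * s 16 + j)) (s 10) (s 10 + s 16) (g s) f m"
     and Pt = "\<lambda>_. Pt"])
  fix s f fp m u v' f' fp'
  assume a: "s 8 = 64 * x \<and> 0 < x \<and> s 16 < bd \<and> bd \<le> 12 * x + 1 \<and> (0 < j \<longrightarrow> bd \<le> 12 * x) \<and> 12 * x - s 16 \<le> v \<and> j \<le> 5"
    "8 * s 8 \<le> s 10" and f: "f + of_bool (s 10 - 8 * s 8 \<le> u \<and> u < s 10 + s 8) \<le> f'"
    and M: "medians_bound (s 10 - 8 * s 8) (s 10 - 8 * s 8 + (5 * s 16 + j)) (s 10) (s 10 + s 16) (g s) f m"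
  show "medians_bound (s 10 - 8 * s 8) (s 10 - 8 * s 8 + (5 * s 16 + j)) (s 10) (s 10 + s 16) (g s) f' (m(u := v'))"
    by (rule medians_bound_upd[OF M _ _ _ f]) (use a in auto)
qed

lemma n_pos: "1 \<le> n"
  using k by simp

lemmas arith_simps = aval_N aval_Plus aval_Times aval_Minus small_n

definition read_sum :: "nat \<Rightarrow> regs \<Rightarrow> bool \<Rightarrow> nat \<Rightarrow> nat" where
  "read_sum j s d p = (\<Sum>i<j. of_bool (key d (s (20 + i)) \<le> p))"

lemma H_load5:
  assumes "j < 5"
  shows "H (medians_at x Pt (12 * x) v j (read_sum j)) (load5 j) 1 (medians_at x Pt (12 * x) v (Suc j) (read_sum (Suc j)))"
  unfolding load5_def
proof (rule H_Load)
  show "stable (medians_at x Pt (12 * x) v j (read_sum j))" using medians_at_stable[where h = "\<lambda>s. s"] .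
  fix s m \<alpha>
  assume M: "medians_at x Pt (12 * x) v j (read_sum j) s m \<alpha>"
  note b = core_bounds[OF conjunct2[OF M[unfolded medians_at_def]]]
  have M': "s 8 = 64 * x" "0 < x" "s 16 < 12 * x" "12 * x - s 16 \<le> v" using M unfolding medians_at_def by auto
  let ?a = "s 10 - 8 * s 8"
  have addr: "aval w (Plus addrA (Plus (Times (N 5) (R 16)) (N j))) s = ?a + (5 * s 16 + j)"
    using b M' n_pos assms by (simp add: arith_simps)
  let ?s = "s(20 + j := m (?a + (5 * s 16 + j)))"
  have s: "?s r = s r" if "r < 20" for r using that by simp
  have "core (\<lambda>f fp m. medians_bound ?a (?a + (5 * s 16 + Suc j)) (s 10) (s 10 + s 16) (read_sum (Suc j) ?s) f m) Pt ?s m \<alpha>"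
  proof (rule core_cong[OF conjunct2[OF M[unfolded medians_at_def]]])
    fix f fp assume "medians_bound ?a (?a + (5 * s 16 + j)) (s 10) (s 10 + s 16) (read_sum j s) f m"
    moreover have "read_sum (Suc j) ?s d p = read_sum j s d p + of_bool (key d (m (?a + (5 * s 16 + j))) \<le> p)" for d p
    proof -
      have "read_sum j ?s d p = read_sum j s d p" unfolding read_sum_def by (rule sum.cong) auto
      then show ?thesis by (simp add: read_sum_def)
    qed
    ultimately show "medians_bound ?a (?a + (5 * s 16 + Suc j)) (s 10) (s 10 + s 16) (read_sum (Suc j) ?s) f m"
      unfolding medians_bound_def by (simp add: cnt_last)
  qed auto
  then show "medians_at x Pt (12 * x) v (Suc j) (read_sum (Suc j)) (s(20 + j := m (aval w (Plus addrA (Plus (Times (N 5) (R 16)) (N j))) s))) m \<alpha>"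
    unfolding addr medians_at_def using M' assms by simp
qed simp


lemma H_medians_body:
  "H (medians_at x Pt (12 * x) v 0 (\<lambda>_ _ _. 0)) medians_body 62
     (\<lambda>s m \<alpha>. medians_at x Pt (12 * x + 1) (v - 1) 0 (\<lambda>_ _ _. 0) s m \<alpha> \<and> 12 * x - s 16 < v)"
proof -
  let ?M = "\<lambda>j. medians_at x Pt (12 * x) v j (read_sum j)"
  have st: "stable (medians_at x Pt bd v j g)" for j bd g using medians_at_stable[where h = "\<lambda>s. s"] .
  have "H (?M j) (load5 j) 1 (?M (j + 1))" if "j < 5" for j using H_load5[OF that] by simp
  from this[of 0] this[of 1] this[of 2] this[of 3] this[of 4]
  have l: "H (?M 0) (load5 0) 1 (?M 1)" "H (?M 1) (load5 1) 1 (?M 2)" "H (?M 2) (load5 2) 1 (?M 3)"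
    "H (?M 3) (load5 3) 1 (?M 4)" "H (?M 4) (load5 4) 1 (?M 5)"
    by (simp_all del: One_nat_def)
  let ?g = "\<lambda>s d p. 3 * of_bool (key d (s 24) \<le> p)"
  let ?N = "medians_at x Pt (12 * x) v 5 ?g"
  have med: "H (?M 5) median5 48 ?N"
  proof (rule H_reg[OF _ st])
    fix s m \<alpha>
    assume wf: "wf_state w s m" and M: "?M 5 s m \<alpha>"
    let ?s = "ev median5 s"
    have s: "?s r = s r" if "r < 20" for r using ev_median5_other that by simp
    have "core (\<lambda>f fp m. medians_bound (s 10 - 8 * s 8) (s 10 - 8 * s 8 + (5 * s 16 + 5)) (s 10) (s 10 + s 16) (?g ?s) f m) Pt ?s m \<alpha>"
    proof (rule core_cong[OF conjunct2[OF M[unfolded medians_at_def]]])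
      fix f fp
      assume "medians_bound (s 10 - 8 * s 8) (s 10 - 8 * s 8 + (5 * s 16 + 5)) (s 10) (s 10 + s 16) (read_sum 5 s) f m"
      then show "medians_bound (s 10 - 8 * s 8) (s 10 - 8 * s 8 + (5 * s 16 + 5)) (s 10) (s 10 + s 16) (?g ?s) f m"
        unfolding medians_bound_def read_sum_def using ev_median5[OF wf] by (meson add_left_mono le_trans)
    qed (use s in auto)
    then show "?N ?s m \<alpha>" using M s unfolding medians_at_def by simp
  qed (simp_all add: median5_def cmp_exch_def)
  \<comment> \<open>After the store the median lies in memory while the index is still the old one;
    the assertion \<open>?J\<close> therefore speaks about the registers after the pending
    increment.\<close>
  let ?h = "\<lambda>s. s(16 := Suc (s 16))"
  let ?I = "\<lambda>s. medians_at x Pt (12 * x + 1) (v - 1) 0 (\<lambda>_ _ _. 0) s"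
  let ?J = "\<lambda>s. medians_at x Pt (12 * x + 1) (v - 1) 0 (\<lambda>_ _ _. 0) (?h s)"
  have stJ: "stable (\<lambda>s m \<alpha>. 0 < v \<and> ?J s m \<alpha>)"
    using medians_at_stable[where h = ?h] unfolding stable_def by blast
  have store: "H ?N (Store (Plus (R 10) (R 16)) (R 24)) 1 (\<lambda>s m \<alpha>. 0 < v \<and> ?J s m \<alpha>)"
  proof (rule H_Store[OF st])
    fix s m \<alpha>
    assume M: "?N s m \<alpha>"
    note c = conjunct2[OF M[unfolded medians_at_def]]
    note b = core_bounds[OF c]
    have M': "s 8 = 64 * x" "0 < x" "s 16 < 12 * x" "12 * x - s 16 \<le> v" using M unfolding medians_at_def by auto
    have addr: "aval w (Plus (R 10) (R 16)) s = s 10 + s 16" using b M' n_pos by (simp add: arith_simps)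
    show "0 < v \<and> ?J s (m(aval w (Plus (R 10) (R 16)) s := aval w (R 24) s)) \<alpha>"
      unfolding addr medians_at_def
    proof (intro conjI)
      have "core (\<lambda>f fp m. medians_bound (s 10 - 8 * s 8) (s 10 - 8 * s 8 + 5 * Suc (s 16)) (s 10) (s 10 + Suc (s 16)) (\<lambda>_ _. 0) f m) Pt s
          (m(s 10 + s 16 := aval w (R 24) s)) \<alpha>"
      proof (rule core_store[OF c])
        fix f fp
        assume a: "medians_bound (s 10 - 8 * s 8) (s 10 - 8 * s 8 + (5 * s 16 + 5)) (s 10) (s 10 + s 16) (?g s) f m"
        have "s 10 - 8 * s 8 + 5 * Suc (s 16) \<le> s 10" using b M' by simp
        moreover have "s 10 - 8 * s 8 + 5 * Suc (s 16) = s 10 - 8 * s 8 + (5 * s 16 + 5)" by simp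
        moreover have "cnt (m(s 10 + s 16 := v)) (s 10) (s 10 + Suc (s 16)) P = cnt m (s 10) (s 10 + s 16) P + of_bool (P v)" for v P
          using cnt_store_end[of "s 10" "s 10 + s 16"] by simp
        ultimately show "medians_bound (s 10 - 8 * s 8) (s 10 - 8 * s 8 + 5 * Suc (s 16)) (s 10) (s 10 + Suc (s 16)) (\<lambda>_ _. 0) f
           (m(s 10 + s 16 := aval w (R 24) s))"
          using a unfolding medians_bound_def by (simp add: algebra_simps)
      qed simp
      then show "core (\<lambda>f fp m. medians_bound ((?h s) 10 - 8 * (?h s) 8) ((?h s) 10 - 8 * (?h s) 8 + (5 * (?h s) 16 + 0)) ((?h s) 10)
          ((?h s) 10 + (?h s) 16) (\<lambda>_ _. 0) f m) Pt (?h s) (m(s 10 + s 16 := aval w (R 24) s)) \<alpha>"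
        by (rule core_cong) auto
    qed (use M' in auto)
  qed simp
  have inc: "H (\<lambda>s m \<alpha>. 0 < v \<and> ?J s m \<alpha>) (incr 16) 1 (\<lambda>s m \<alpha>. ?I s m \<alpha> \<and> 12 * x - s 16 < v)"
  proof (rule H_reg[OF _ stJ])
    fix s m \<alpha>
    assume M: "0 < v \<and> ?J s m \<alpha>"
    then have M': "s 8 = 64 * x" "Suc (s 16) \<le> 12 * x" "12 * x - Suc (s 16) \<le> v - 1" unfolding medians_at_def by auto
    note c = conjunct2[OF conjunct2[OF M, unfolded medians_at_def]]
    have "Suc (s 16) \<le> n" using core_bounds(5,6)[OF c] M' by simp
    then have "ev (incr 16) s = ?h s" using n_pos by (simp add: incr_def arith_simps)
    then show "?I (ev (incr 16) s) m \<alpha> \<and> 12 * x - ev (incr 16) s 16 < v" using M M' by auto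
  qed (simp_all add: incr_def)
  have start: "H (medians_at x Pt (12 * x) v 0 (\<lambda>_ _ _. 0)) (load5 0) 1 (?M 1)"
  proof -
    have "read_sum 0 = (\<lambda>_ _ _. 0)" by (simp add: read_sum_def fun_eq_iff)
    then show ?thesis using l(1) by simp
  qed
  show ?thesis
    unfolding medians_body_def
    using H_seq[OF start st H_seq[OF l(2) st H_seq[OF l(3) st H_seq[OF l(4) st H_seq[OF l(5) st
      H_seq[OF med st H_seq[OF store stJ inc]]]]]]]
    by simp
qed


lemma H_medians:
  "H (\<lambda>s m \<alpha>. (s 8 = 64 * x \<and> 0 < x) \<and> core (\<lambda>_ _ _. True) Pt s m \<alpha>) medians (800 * x)
     (\<lambda>s m \<alpha>. s 8 = 64 * x \<and> core (\<lambda>f fp m. level_inv x (s 10) 0 f m) Pt s m \<alpha>)"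
proof -
  let ?I = "\<lambda>s m \<alpha>. \<exists>v. medians_at x Pt (12 * x + 1) v 0 (\<lambda>_ _ _. 0) s m \<alpha>"
  have st: "stable ?I" using medians_at_stable[where h = "\<lambda>s. s"] unfolding stable_def by blast
  have st0: "stable (\<lambda>s m \<alpha>. (s 8 = 64 * x \<and> 0 < x) \<and> core (\<lambda>_ _ _. True) Pt s m \<alpha>)"
    using core_stable[where A = "\<lambda>s. s 8 = 64 * x \<and> 0 < x" and \<Phi> = "\<lambda>_ _ _ _. True" and Pt = "\<lambda>_. Pt" and h = "\<lambda>s. s"] by simp
  let ?b = "Less (Times (N 16) (R 16)) (Times (N 3) (R 8))"
  have guard: "bval w le ?b s \<longleftrightarrow> s 16 < 12 * x" if I: "?I s m \<alpha>" for s m \<alpha>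
  proof -
    obtain v where v: "medians_at x Pt (12 * x + 1) v 0 (\<lambda>_ _ _. 0) s m \<alpha>" using I by blast
    note b = core_bounds[OF conjunct2[OF v[unfolded medians_at_def]]]
    have "s 8 = 64 * x" "s 16 \<le> 12 * x" using v unfolding medians_at_def by auto
    then show ?thesis using b n_pos by (simp add: arith_simps)
  qed
  have loop: "H (\<lambda>s m \<alpha>. ?I s m \<alpha> \<and> 12 * x - s 16 \<le> 12 * x) (While ?b medians_body) (800 * x - 2)
     (\<lambda>s m \<alpha>. ?I s m \<alpha> \<and> \<not> bval w le ?b s)"
    if "0 < x"
  proof (rule H_for[OF st, where T = 62])
    fix v
    show "H (\<lambda>s m \<alpha>. ?I s m \<alpha> \<and> bval w le ?b s \<and> 12 * x - s 16 = v) medians_body 62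
      (\<lambda>s m \<alpha>. ?I s m \<alpha> \<and> 12 * x - s 16 < v)"
    proof (rule H_conseq[OF H_medians_body[of x Pt v]])
      fix s m \<alpha>
      assume "?I s m \<alpha> \<and> bval w le ?b s \<and> 12 * x - s 16 = v"
      then show "medians_at x Pt (12 * x) v 0 (\<lambda>_ _ _. 0) s m \<alpha>" using guard by (auto simp: medians_at_def)
    qed auto
  next
    fix s m \<alpha>
    assume "?I s m \<alpha>" "bval w le ?b s"
    then show "0 < 12 * x - s 16" using guard by auto
  qed (use that in auto)
  show ?thesis
    unfolding medians_def
  proof (cases "0 < x")
    case True
    show "H (\<lambda>s m \<alpha>. (s 8 = 64 * x \<and> 0 < x) \<and> core (\<lambda>_ _ _. True) Pt s m \<alpha>)
      (Assign 16 (N 0) ;; While ?b medians_body) (800 * x)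
      (\<lambda>s m \<alpha>. s 8 = 64 * x \<and> core (\<lambda>f fp m. level_inv x (s 10) 0 f m) Pt s m \<alpha>)"
    proof (rule H_Seq[OF _ st H_conseq[OF loop[OF True]]])
      show "H (\<lambda>s m \<alpha>. (s 8 = 64 * x \<and> 0 < x) \<and> core (\<lambda>_ _ _. True) Pt s m \<alpha>) (Assign 16 (N 0)) 1 ?I"
      proof (rule H_Assign[OF st0])
        fix s m \<alpha>
        assume a: "(s 8 = 64 * x \<and> 0 < x) \<and> core (\<lambda>_ _ _. True) Pt s m \<alpha>"
        have "core (\<lambda>f fp m. medians_bound (s 10 - 8 * s 8) (s 10 - 8 * s 8 + 0) (s 10) (s 10 + 0) (\<lambda>_ _. 0) f m) Pt (s(16 := 0)) m \<alpha>"
          by (rule core_cong[OF conjunct2[OF a]]) (auto simp: medians_bound_def)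
        then have "medians_at x Pt (12 * x + 1) (12 * x) 0 (\<lambda>_ _ _. 0) (s(16 := 0)) m \<alpha>"
          using a unfolding medians_at_def by simp
        moreover have "aval w (N 0) s = 0" by (simp add: aval.simps)
        ultimately show "?I (s(16 := aval w (N 0) s)) m \<alpha>" by auto
      qed simp
    next
      fix s m \<alpha>
      assume wf: "wf_state w s m" and a: "?I s m \<alpha> \<and> \<not> bval w le ?b s"
      then obtain v where v: "medians_at x Pt (12 * x + 1) v 0 (\<lambda>_ _ _. 0) s m \<alpha>" by blast
      have "\<not> s 16 < 12 * x" using guard[of s m \<alpha>] a by blast
      then have q: "s 16 = 12 * x" "s 8 = 64 * x" using v unfolding medians_at_def by linarith+
      have "core (\<lambda>f fp m. level_inv x (s 10) 0 f m) Pt s m \<alpha>"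
      proof (rule core_cong[OF conjunct2[OF v[unfolded medians_at_def]]])
        fix f fp
        assume "medians_bound (s 10 - 8 * s 8) (s 10 - 8 * s 8 + (5 * s 16 + 0)) (s 10) (s 10 + s 16) (\<lambda>_ _. 0) f m"
        then have M: "3 * cnt m (s 10) (s 10 + 12 * x) (at_most d p) \<le>
            cnt m (s 10 - 512 * x) (s 10 - 512 * x + 60 * x) (at_most d p) + 4 * f" for d p
          unfolding medians_bound_def q by (simp add: algebra_simps)
        have sub: "cnt m (s 10 - 512 * x) (s 10 - 512 * x + 60 * x) P \<le> cnt m (s 10 - 512 * x) (s 10 - 512 * x + 64 * x) P" for P
          by (rule cnt_subset) auto
        \<comment> \<open>Keys are at least 1, so \<open>P = 0\<close> is a witness for which the
          bound \<open>8 * x + f\<close> is trivial: no pivot has failed yet.\<close>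
        have "cnt m c e (at_most d 0) = 0" for c e d
        proof -
          have "(key d (m y) \<le> 0) = False" for y using key_pos[of "m y" d] wf unfolding wf_state_def by auto
          then show ?thesis unfolding cnt_def by (simp only: of_bool_eq sum.neutral_const)
        qed
        note z = this
        have "half d (s 10) x 0 0 f m" for d
          unfolding half_def quota_def
        proof (intro exI[of _ 0] conjI allI impI)
          fix p
          show "3 * (cnt m (s 10) (s 10 + 0) (at_most d p) +
             cnt m (s 10 + 0) (s 10 + (12 - 0) * x) (at_most d p) + 0 * x)
             \<le> cnt m (s 10 - 512 * x) (s 10 - 512 * x + 64 * x) (at_most d p) + (4 + 3 * 0) * f"
            using M[of d p] sub[of "at_most d p"] by simp
        qed (simp_all only: z le0)
        then show "level_inv x (s 10) 0 f m" unfolding level_inv_def by blast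
      qed auto
      then show "s 8 = 64 * x \<and> core (\<lambda>f fp m. level_inv x (s 10) 0 f m) Pt s m \<alpha>" using q by simp
    qed (use True in auto)
  qed (simp add: H_def)
qed

section \<open>Verifying a pivot and discarding medians\<close>

lemma of_bool_weaken: "(f :: nat) + of_bool B \<le> f' \<Longrightarrow> (A \<Longrightarrow> B) \<Longrightarrow> f + of_bool A \<le> f'"
  by (auto simp: of_bool_def split: if_splits)

lemma level_inv_stable:
  assumes "\<And>s. A s \<Longrightarrow> s 8 = 64 * x"
  shows "stable (\<lambda>s m \<alpha>. A s \<and> core (\<lambda>f fp m. level_inv x (s 10) (g s) f m) Pt s m \<alpha>)"
proof (rule core_stable[where h = "\<lambda>s. s" and Pt = "\<lambda>_. Pt" and \<Phi> = "\<lambda>s f fp m. level_inv x (s 10) (g s) f m"])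
  fix s :: regs and f fp m u v f' fp'
  assume a: "A s" "level_inv x (s 10) (g s) f m" and f: "f + of_bool (s 10 - 8 * s 8 \<le> u \<and> u < s 10 + s 8) \<le> f'"
  show "level_inv x (s 10) (g s) f' (m(u := v))"
    by (rule level_inv_upd[OF a(2) of_bool_weaken[OF f]]) (use assms[OF a(1)] in auto)
qed

definition tally :: "bool \<Rightarrow> regs \<Rightarrow> nat" where
  "tally d s = (if d then s 18 else s 19)"

text \<open>What a returned pivot promises to the enclosing level: its subinstance consists of the
  first \<open>8 x\<close> medians, and an eighth of these lies on either side, up to the
  corruptions at that level.\<close>

definition contract :: "nat \<Rightarrow> regs \<Rightarrow> nat \<Rightarrow> mem \<Rightarrow> bool" where
  "contract x s f m \<longleftrightarrow> (\<forall>d. x \<le> cnt m (s 10) (s 10 + 8 * x) (at_most d (key d (s 13))) + f)"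

text \<open>The two bounds use different counters because they have different consumers. The upper
  bound justifies a failure, which is recorded at the current level and hence in terms of
  \<open>f\<close>; the lower bound justifies a success, which is reported to the enclosing level
  and hence in terms of \<open>fp\<close>. The offset \<open>e\<close> stands for an element that
  has been read but not tallied.\<close>

definition count_inv :: "nat \<Rightarrow> nat \<Rightarrow> (bool \<Rightarrow> nat) \<Rightarrow> regs \<Rightarrow> nat \<Rightarrow> nat \<Rightarrow> mem \<Rightarrow> bool" where
  "count_inv x q e s f fp m \<longleftrightarrow> level_inv x (s 10) (s 12) f m \<and> contract x s f m \<and>
     (\<forall>d. cnt m (s 10 - 8 * s 8) (s 10 - 8 * s 8 + q) (at_most d (key d (s 13))) \<le> tally d s + e d + f \<and>
        tally d s + e d \<le> cnt m (s 10 - 8 * s 8) (s 10 - 8 * s 8 + q) (at_most d (key d (s 13))) + fp)"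

lemma contract_upd:
  assumes "contract x s f m" "f + of_bool (s 10 \<le> u \<and> u < s 10 + 8 * x) \<le> f'"
  shows "contract x s f' (m(u := v))"
  unfolding contract_def
proof
  fix d
  show "x \<le> cnt (m(u := v)) (s 10) (s 10 + 8 * x) (at_most d (key d (s 13))) + f'"
  proof -
    have "x \<le> cnt m (s 10) (s 10 + 8 * x) (at_most d (key d (s 13))) + f"
      using assms(1) unfolding contract_def by blast
    then show ?thesis
      using assms(2) cnt_upd_ge[of m "s 10" "s 10 + 8 * x" "at_most d (key d (s 13))" u v] by linarith
  qed
qed

lemma count_inv_upd:
  assumes "count_inv x q e s f fp m" "s 8 = 64 * x" "q \<le> 64 * x" "8 * s 8 \<le> s 10"
    "f + of_bool (s 10 - 8 * s 8 \<le> u \<and> u < s 10 + s 8) \<le> f'"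
    "fp + of_bool (s 10 - 8 * s 8 \<le> u \<and> u < s 10) \<le> fp'"
  shows "count_inv x q e s f' fp' (m(u := v))"
proof -
  let ?a = "s 10 - 8 * s 8"
  have "level_inv x (s 10) (s 12) f' (m(u := v))"
    by (rule level_inv_upd[OF _ of_bool_weaken[OF assms(5)]]) (use assms in \<open>auto simp: count_inv_def\<close>)
  moreover have "contract x s f' (m(u := v))"
    by (rule contract_upd[OF _ of_bool_weaken[OF assms(5)]]) (use assms in \<open>auto simp: count_inv_def\<close>)
  moreover have "cnt (m(u := v)) ?a (?a + q) (at_most d (key d (s 13))) \<le> tally d s + e d + f' \<and>
        tally d s + e d \<le> cnt (m(u := v)) ?a (?a + q) (at_most d (key d (s 13))) + fp'" for d
  proof (cases "?a \<le> u \<and> u < ?a + q")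
    case True
    then have "?a \<le> u \<and> u < s 10 + s 8" "?a \<le> u \<and> u < s 10" using assms by auto
    then have "f + 1 \<le> f'" "fp + 1 \<le> fp'" using assms(5,6) by simp_all
    moreover have "cnt m ?a (?a + q) (at_most d (key d (s 13))) \<le> tally d s + e d + f"
        "tally d s + e d \<le> cnt m ?a (?a + q) (at_most d (key d (s 13))) + fp"
      using assms(1) unfolding count_inv_def by blast+
    moreover have "cnt (m(u := v)) ?a (?a + q) (at_most d (key d (s 13))) \<le> cnt m ?a (?a + q) (at_most d (key d (s 13))) + 1"
        "cnt m ?a (?a + q) (at_most d (key d (s 13))) \<le> cnt (m(u := v)) ?a (?a + q) (at_most d (key d (s 13))) + 1"
      using cnt_upd_le[of m u v ?a "?a + q" "at_most d (key d (s 13))"]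
        cnt_upd_ge[of m ?a "?a + q" "at_most d (key d (s 13))" u v] True by simp_all
    ultimately show ?thesis by linarith
  next
    case False
    then have "u < ?a \<or> ?a + q \<le> u" by auto
    then have "cnt (m(u := v)) ?a (?a + q) (at_most d (key d (s 13))) = cnt m ?a (?a + q) (at_most d (key d (s 13)))" by simp
    moreover have "f \<le> f'" "fp \<le> fp'" using assms(5,6) by simp_all
    moreover have "cnt m ?a (?a + q) (at_most d (key d (s 13))) \<le> tally d s + e d + f"
        "tally d s + e d \<le> cnt m ?a (?a + q) (at_most d (key d (s 13))) + fp"
      using assms(1) unfolding count_inv_def by blast+
    ultimately show ?thesis by linarith
  qed
  ultimately show ?thesis unfolding count_inv_def by blast
qed

definition count_bounds :: "nat \<Rightarrow> nat \<Rightarrow> nat \<Rightarrow> regs \<Rightarrow> bool" where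
  "count_bounds x i b s \<longleftrightarrow> s 8 = 64 * x \<and> 0 < x \<and> s 16 < b \<and> b \<le> 64 * x + 1 \<and> s 18 \<le> s 16 \<and> s 19 \<le> s 16 \<and>
     s 14 = 1 \<and> s 12 = i \<and> i \<le> 4"

lemma cnt_stable:
  "stable (\<lambda>s m \<alpha>. count_bounds x i b (h s) \<and> core (count_inv x (h s 16) (\<lambda>_. 0) (h s)) Pt (h s) m \<alpha>)"
  by (rule core_stable[where A = "count_bounds x i b" and \<Phi> = "\<lambda>s. count_inv x (s 16) (\<lambda>_. 0) s" and Pt = "\<lambda>_. Pt"], erule count_inv_upd)
    (auto simp: count_bounds_def)

lemma cnt_stable':
  "stable (\<lambda>s m \<alpha>. count_bounds x i (64 * x) s \<and> core (count_inv x (Suc (s 16)) (\<lambda>d. of_bool (key d (s 20) \<le> key d (s 13))) s) Pt s m \<alpha>)"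
  by (rule core_stable[where A = "count_bounds x i (64 * x)" and \<Phi> = "\<lambda>s. count_inv x (Suc (s 16)) (\<lambda>d. of_bool (key d (s 20) \<le> key d (s 13))) s"
        and Pt = "\<lambda>_. Pt" and h = "\<lambda>s. s"], erule count_inv_upd)
    (auto simp: count_bounds_def)

lemma Elem_le_key:
  "wf_state w s m \<Longrightarrow> (s i, s j) \<in> le \<longleftrightarrow> key True (s i) \<le> key True (s j)"
  by (simp add: wf_state_def key_le_iff)

lemma H_count_body:
  "H (\<lambda>s m \<alpha>. (count_bounds x i (64 * x) s \<and> 64 * x - s 16 = v) \<and> core (count_inv x (s 16) (\<lambda>_. 0) s) Pt s m \<alpha>) count_body 11
     (\<lambda>s m \<alpha>. (count_bounds x i (64 * x + 1) s \<and> 64 * x - s 16 < v) \<and> core (count_inv x (s 16) (\<lambda>_. 0) s) Pt s m \<alpha>)"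
proof -
  let ?P = "\<lambda>s m \<alpha>. (count_bounds x i (64 * x) s \<and> 64 * x - s 16 = v) \<and> core (count_inv x (s 16) (\<lambda>_. 0) s) Pt s m \<alpha>"
  let ?e = "\<lambda>s d. of_bool (key d (s 20) \<le> key d (s 13))"
  let ?M = "\<lambda>s m \<alpha>. (count_bounds x i (64 * x) s \<and> 64 * x - s 16 = v) \<and> core (count_inv x (Suc (s 16)) (?e s) s) Pt s m \<alpha>"
  have stP: "stable ?P" using cnt_stable[where h = "\<lambda>s. s"] unfolding stable_def by blast
  have stM: "stable ?M" using cnt_stable' unfolding stable_def by blast
  have load: "H ?P (Load 20 (Plus addrA (R 16))) 1 ?M"
  proof (rule H_Load[OF stP])
    fix s m \<alpha>
    assume P: "?P s m \<alpha>"
    note c = conjunct2[OF P]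
    note b = core_bounds[OF c]
    have A: "s 8 = 64 * x" "0 < x" "s 16 < 64 * x" using P unfolding count_bounds_def by auto
    let ?a = "s 10 - 8 * s 8"
    have addr: "aval w (Plus addrA (R 16)) s = ?a + s 16" using b A n_pos by (simp add: arith_simps)
    let ?s = "s(20 := m (?a + s 16))"
    have "core (count_inv x (Suc (?s 16)) (?e ?s) ?s) Pt ?s m \<alpha>"
    proof (rule core_cong[OF c])
      fix f fp
      assume "count_inv x (s 16) (\<lambda>_. 0) s f fp m"
      moreover have "tally d ?s = tally d s" for d by (simp add: tally_def)
      ultimately show "count_inv x (Suc (?s 16)) (?e ?s) ?s f fp m"
        unfolding count_inv_def contract_def by (simp add: cnt_last)
    qed auto
    moreover have "count_bounds x i (64 * x) ?s \<and> 64 * x - ?s 16 = v" using P unfolding count_bounds_def by simp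
    ultimately show "?M (s(20 := m (aval w (Plus addrA (R 16)) s))) m \<alpha>" unfolding addr by blast
  qed simp
  let ?Q = "\<lambda>s m \<alpha>. (count_bounds x i (64 * x + 1) s \<and> 64 * x - s 16 < v) \<and> core (count_inv x (s 16) (\<lambda>_. 0) s) Pt s m \<alpha>"
  let ?c = "If (Elem_le (R 20) (R 13)) (incr 18) SKIP ;; If (Elem_le (R 13) (R 20)) (incr 19) SKIP ;; incr 16"
  have reg: "H ?M ?c 9 ?Q"
  proof (rule H_reg[OF _ stM])
    fix s m \<alpha>
    assume wf: "wf_state w s m" and M: "?M s m \<alpha>"
    note c = conjunct2[OF M]
    note b = core_bounds[OF c]
    have A: "s 8 = 64 * x" "0 < x" "s 16 < 64 * x" "s 18 \<le> s 16" "s 19 \<le> s 16" "64 * x - s 16 = v"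
      using M unfolding count_bounds_def by auto
    define s' where "s' = s(18 := s 18 + ?e s True, 19 := s 19 + ?e s False, 16 := Suc (s 16))"
    have ev: "ev ?c s = s'"
      using b A n_pos Elem_le_key[OF wf, of 20 13] Elem_le_key[OF wf, of 13 20] key_rev[of "s 20" "s 13"]
      by (auto simp: s'_def incr_def arith_simps fun_eq_iff)
    have "core (count_inv x (s' 16) (\<lambda>_. 0) s') Pt s' m \<alpha>"
    proof (rule core_cong[OF c])
      fix f fp
      assume a: "count_inv x (Suc (s 16)) (?e s) s f fp m"
      have "tally d s' = tally d s + ?e s d" for d by (simp add: tally_def s'_def)
      moreover have "s' 10 = s 10" "s' 8 = s 8" "s' 12 = s 12" "s' 13 = s 13" "s' 16 = Suc (s 16)" by (simp_all add: s'_def)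
      ultimately show "count_inv x (s' 16) (\<lambda>_. 0) s' f fp m" using a unfolding count_inv_def contract_def by simp
    qed (auto simp: s'_def)
    moreover have "count_bounds x i (64 * x + 1) s' \<and> 64 * x - s' 16 < v" using M unfolding count_bounds_def s'_def by (auto simp: of_bool_def)
    ultimately show "?Q (ev ?c s) m \<alpha>" unfolding ev by blast
  qed (simp_all add: incr_def)
  show ?thesis unfolding count_body_def using H_seq[OF load stM reg] by simp
qed

lemma H_count:
  "H (\<lambda>s m \<alpha>. (s 8 = 64 * x \<and> 0 < x \<and> s 14 = 1 \<and> s 12 = i \<and> i \<le> 4) \<and>
        core (\<lambda>f fp m. level_inv x (s 10) (s 12) f m \<and> contract x s f m) Pt s m \<alpha>) count (900 * x)
     (\<lambda>s m \<alpha>. (s 8 = 64 * x \<and> 0 < x \<and> s 14 = 1 \<and> s 12 = i \<and> i \<le> 4 \<and> s 18 \<le> 64 * x \<and> s 19 \<le> 64 * x) \<and>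
        core (count_inv x (64 * x) (\<lambda>_. 0) s) Pt s m \<alpha>)"
proof (cases "0 < x")
  case True
  let ?P = "\<lambda>s m \<alpha>. (s 8 = 64 * x \<and> 0 < x \<and> s 14 = 1 \<and> s 12 = i \<and> i \<le> 4) \<and>
        core (\<lambda>f fp m. level_inv x (s 10) (s 12) f m \<and> contract x s f m) Pt s m \<alpha>"
  let ?I = "\<lambda>s m \<alpha>. count_bounds x i (64 * x + 1) s \<and> core (count_inv x (s 16) (\<lambda>_. 0) s) Pt s m \<alpha>"
  have st: "stable ?I" using cnt_stable[where h = "\<lambda>s. s"] .
  have stP: "stable ?P"
  proof (rule core_stable[where A = "\<lambda>s. s 8 = 64 * x \<and> 0 < x \<and> s 14 = 1 \<and> s 12 = i \<and> i \<le> 4" and h = "\<lambda>s. s" and Pt = "\<lambda>_. Pt"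
        and \<Phi> = "\<lambda>s f fp m. level_inv x (s 10) (s 12) f m \<and> contract x s f m"])
    fix s f fp m u v f' fp'
    assume a: "s 8 = 64 * x \<and> 0 < x \<and> s 14 = 1 \<and> s 12 = i \<and> i \<le> 4" "8 * s 8 \<le> s 10"
      and l: "level_inv x (s 10) (s 12) f m \<and> contract x s f m"
      and f: "f + of_bool (s 10 - 8 * s 8 \<le> u \<and> u < s 10 + s 8) \<le> f'"
    show "level_inv x (s 10) (s 12) f' (m(u := v)) \<and> contract x s f' (m(u := v))"
      by (intro conjI level_inv_upd[OF conjunct1[OF l] of_bool_weaken[OF f]] contract_upd[OF conjunct2[OF l] of_bool_weaken[OF f]])
        (use a in auto)
  qed
  let ?b = "Less (R 16) (R 8)"
  have loop: "H (\<lambda>s m \<alpha>. ?I s m \<alpha> \<and> 64 * x - s 16 \<le> 64 * x) (While ?b count_body) (64 * x * (11 + 2) + 1)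
     (\<lambda>s m \<alpha>. ?I s m \<alpha> \<and> \<not> bval w le ?b s)"
  proof (rule H_for[OF st _ _ le_refl])
    fix v
    show "H (\<lambda>s m \<alpha>. ?I s m \<alpha> \<and> bval w le ?b s \<and> 64 * x - s 16 = v) count_body 11
      (\<lambda>s m \<alpha>. ?I s m \<alpha> \<and> 64 * x - s 16 < v)"
      by (rule H_conseq[OF H_count_body[of x i v Pt]]) (auto simp: count_bounds_def)
  qed (auto simp: count_bounds_def)
  let ?i = "Assign 16 (N 0) ;; Assign 18 (N 0) ;; Assign 19 (N 0)"
  have init: "H ?P ?i 5 ?I"
  proof (rule H_reg[OF _ stP])
    fix s m \<alpha>
    assume P: "?P s m \<alpha>"
    let ?s = "s(16 := 0, 18 := 0, 19 := 0)"
    have "ev ?i s = ?s" by (simp add: aval.simps)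
    moreover have "core (count_inv x (?s 16) (\<lambda>_. 0) ?s) Pt ?s m \<alpha>"
      by (rule core_cong[OF conjunct2[OF P]]) (auto simp: count_inv_def contract_def tally_def)
    moreover have "count_bounds x i (64 * x + 1) ?s" using P unfolding count_bounds_def by simp
    ultimately show "?I (ev ?i s) m \<alpha>" by metis
  qed simp_all
  show ?thesis
    unfolding count_def
  proof (rule H_Seq[OF init st H_conseq[OF loop]])
    fix s m \<alpha>
    assume a: "?I s m \<alpha> \<and> \<not> bval w le ?b s"
    then have "s 16 = 64 * x" unfolding count_bounds_def by auto
    then show "(s 8 = 64 * x \<and> 0 < x \<and> s 14 = 1 \<and> s 12 = i \<and> i \<le> 4 \<and> s 18 \<le> 64 * x \<and> s 19 \<le> 64 * x) \<and>
        core (count_inv x (64 * x) (\<lambda>_. 0) s) Pt s m \<alpha>"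
      using a unfolding count_bounds_def by auto
  qed (use True in auto)
qed (simp add: H_def)


section \<open>The discarding pass after a failed pivot\<close>

lemma quota_start:
  assumes "quota d a b x z q j g 0 L f m" "cnt m a (a + 64 * x) (at_most d \<pi>) \<le> 8 * x + f"
  shows "quota d a b x z q j g \<pi> L f m"
proof -
  obtain P where P: "cnt m a (a + 64 * x) (at_most d P) \<le> 8 * x + f"
    "\<forall>p\<ge>P. 3 * (cnt m b (b + j) (at_most d p) + cnt m (b + q) (b + z) (at_most d p) + g p)
        \<le> cnt m a (a + 64 * x) (at_most d p) + L * f"
    using assms(1) unfolding quota_def by blast
  show ?thesis unfolding quota_def
    \<comment> \<open>The count at the larger of the two thresholds is the count at one of them, and
      both are small.\<close>
    by (rule exI[of _ "max P \<pi>"]) (use P assms(2) in \<open>auto simp: max_def\<close>)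
qed

text \<open>Kept medians beyond \<open>z'\<close> are simply forgotten, which only lowers the
  left-hand side. The last assumption allows a shortfall in the number of discarded medians to be
  converted into a larger slack.\<close>

lemma quota_final:
  assumes "quota d a b x z z j g \<pi> L f m" "z' \<le> j" "\<And>p. 3 * g' p + L * f \<le> 3 * g p + L' * f"
  shows "quota d a b x z' 0 0 g' 0 L' f m"
proof -
  obtain P where P: "cnt m a (a + 64 * x) (at_most d P) \<le> 8 * x + f"
    "\<And>p. P \<le> p \<Longrightarrow> 3 * (cnt m b (b + j) (at_most d p) + cnt m (b + z) (b + z) (at_most d p) + g p)
        \<le> cnt m a (a + 64 * x) (at_most d p) + L * f"
    using assms(1) unfolding quota_def by blast
  show ?thesis unfolding quota_def
  proof (intro exI[of _ P] conjI allI impI)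
    fix p assume "P \<le> p"
    have "cnt m (b + 0) (b + z') (at_most d p) \<le> cnt m b (b + j) (at_most d p)"
      by (rule cnt_subset) (use assms(2) in auto)
    then show "3 * (cnt m b (b + 0) (at_most d p) + cnt m (b + 0) (b + z') (at_most d p) + g' p)
        \<le> cnt m a (a + 64 * x) (at_most d p) + L' * f"
      using P(2)[OF \<open>P \<le> p\<close>] assms(3)[of p] by simp
  qed (use P in auto)
qed

text \<open>Here \<open>e\<close> medians have been dropped, and \<open>\<delta>\<close> stands for
  the one in the register. Credit for dropped medians is given only on the side of the failure. The
  last clause carries the promise of the pivot along: while fewer than \<open>x\<close> medians have
  been dropped, every suitable one was dropped, so the missing ones are still unread among the first
  \<open>8 x\<close> or have been corrupted.\<close>

definition drop_mem :: "nat \<Rightarrow> nat \<Rightarrow> nat \<Rightarrow> nat \<Rightarrow> (bool \<Rightarrow> nat \<Rightarrow> nat) \<Rightarrow> regs \<Rightarrow> nat \<Rightarrow> mem \<Rightarrow> bool" where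
  "drop_mem x q j e \<delta> s f m \<longleftrightarrow> (\<exists>l h. l + h = s 12 \<and>
     quota (s 27 = 0) (s 10 - 512 * x) (s 10) x ((12 - s 12) * x) q j (\<lambda>p. l * x + e + \<delta> (s 27 = 0) p) (key (s 27 = 0) (s 13)) (4 + 3 * l) f m \<and>
     quota (s 27 \<noteq> 0) (s 10 - 512 * x) (s 10) x ((12 - s 12) * x) q j (\<lambda>p. h * x + \<delta> (s 27 \<noteq> 0) p) 0 (4 + 3 * h) f m \<and>
     (e < x \<longrightarrow> x \<le> e + \<delta> (s 27 = 0) (key (s 27 = 0) (s 13)) +
       cnt m (s 10 + q) (s 10 + 8 * x) (at_most (s 27 = 0) (key (s 27 = 0) (s 13))) + f))"

lemma drop_mem_upd:
  assumes "drop_mem x q j e \<delta> s f m" "j \<le> q" "q \<le> 12 * x"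
    "f + of_bool (s 10 - 512 * x \<le> u \<and> u < s 10 + 64 * x) \<le> f'" "512 * x \<le> s 10"
  shows "drop_mem x q j e \<delta> s f' (m(u := v))"
proof -
  define d where "d = (s 27 = 0)"
  obtain l h where lh: "l + h = s 12"
    "quota d (s 10 - 512 * x) (s 10) x ((12 - s 12) * x) q j (\<lambda>p. l * x + e + \<delta> d p) (key d (s 13)) (4 + 3 * l) f m"
    "quota (\<not> d) (s 10 - 512 * x) (s 10) x ((12 - s 12) * x) q j (\<lambda>p. h * x + \<delta> (\<not> d) p) 0 (4 + 3 * h) f m"
    "e < x \<longrightarrow> x \<le> e + \<delta> d (key d (s 13)) + cnt m (s 10 + q) (s 10 + 8 * x) (at_most d (key d (s 13))) + f"
    using assms(1) unfolding drop_mem_def d_def by blast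
  define z where "z = (12 - s 12) * x"
  have "z \<le> 12 * x" unfolding z_def by (rule mult_le_mono1) simp
  then have "f + of_bool (s 10 - 512 * x \<le> u \<and> u < s 10 - 512 * x + 64 * x \<or> s 10 \<le> u \<and> u < s 10 + max j z) \<le> f'"
    by (intro of_bool_weaken[OF assms(4)]) (use assms in \<open>auto simp: max_def split: if_splits\<close>)
  then have "quota d (s 10 - 512 * x) (s 10) x ((12 - s 12) * x) q j (\<lambda>p. l * x + e + \<delta> d p) (key d (s 13)) (4 + 3 * l) f' (m(u := v))"
    "quota (\<not> d) (s 10 - 512 * x) (s 10) x ((12 - s 12) * x) q j (\<lambda>p. h * x + \<delta> (\<not> d) p) 0 (4 + 3 * h) f' (m(u := v))"
    using lh(2,3) assms(2) unfolding z_def by (auto intro: quota_upd)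
  moreover have "f + of_bool (s 10 + q \<le> u \<and> u < s 10 + 8 * x) \<le> f'"
    by (rule of_bool_weaken[OF assms(4)]) auto
  then have "e < x \<longrightarrow> x \<le> e + \<delta> d (key d (s 13)) + cnt (m(u := v)) (s 10 + q) (s 10 + 8 * x) (at_most d (key d (s 13))) + f'"
    using lh(4) cnt_upd_ge[of m "s 10 + q" "s 10 + 8 * x" "at_most d (key d (s 13))" u v] by linarith
  ultimately show ?thesis using lh(1) unfolding drop_mem_def d_def by blast
qed

definition drop_bounds :: "nat \<Rightarrow> nat \<Rightarrow> regs \<Rightarrow> bool" where
  "drop_bounds x i s \<longleftrightarrow> s 8 = 64 * x \<and> 0 < x \<and> s 12 = i \<and> i \<le> 4 \<and> s 16 \<le> (12 - s 12) * x \<and> s 17 \<le> s 16 \<and> s 16 - s 17 \<le> x"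

lemma drop_bounds_le: "drop_bounds x i s \<Longrightarrow> s 16 \<le> 12 * x"
proof -
  assume "drop_bounds x i s"
  then have "s 16 \<le> (12 - s 12) * x" unfolding drop_bounds_def by blast
  also have "\<dots> \<le> 12 * x" by (rule mult_le_mono1) simp
  finally show ?thesis .
qed

definition drop_inv :: "nat \<Rightarrow> nat \<Rightarrow> nat \<Rightarrow> assn" where
  "drop_inv x i Pt s m \<alpha> \<longleftrightarrow> drop_bounds x i s \<and> core (\<lambda>f fp m. drop_mem x (s 16) (s 17) (s 16 - s 17) (\<lambda>_ _. 0) s f m) Pt s m \<alpha>"

lemma drop_inv_stable: "stable (\<lambda>s. drop_inv x i Pt (h s))"
  unfolding drop_inv_def
  by (rule core_stable[where A = "drop_bounds x i" and Pt = "\<lambda>_. Pt"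
      and \<Phi> = "\<lambda>s f fp m. drop_mem x (s 16) (s 17) (s 16 - s 17) (\<lambda>_ _. 0) s f m"], erule drop_mem_upd)
    (use drop_bounds_le in \<open>auto simp: drop_bounds_def\<close>)

definition drop_read :: "nat \<Rightarrow> nat \<Rightarrow> nat \<Rightarrow> nat \<Rightarrow> assn" where
  "drop_read x i Pt v s m \<alpha> \<longleftrightarrow> (drop_bounds x i s \<and> s 16 < (12 - s 12) * x \<and> (12 - s 12) * x - s 16 = v) \<and>
     core (\<lambda>f fp m. drop_mem x (Suc (s 16)) (s 17) (s 16 - s 17) (\<lambda>d p. of_bool (key d (s 20) \<le> p)) s f m) Pt s m \<alpha>"

lemma drop_read_stable: "stable (drop_read x i Pt v)"
  unfolding drop_read_def
proof (rule core_stable[where A = "\<lambda>s. drop_bounds x i s \<and> s 16 < (12 - s 12) * x \<and> (12 - s 12) * x - s 16 = v" and Pt = "\<lambda>_. Pt" and h = "\<lambda>s. s"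
      and \<Phi> = "\<lambda>s f fp m. drop_mem x (Suc (s 16)) (s 17) (s 16 - s 17) (\<lambda>d p. of_bool (key d (s 20) \<le> p)) s f m"], erule drop_mem_upd)
  fix s :: regs
  assume a: "drop_bounds x i s \<and> s 16 < (12 - s 12) * x \<and> (12 - s 12) * x - s 16 = v"
  have "(12 - s 12) * x \<le> 12 * x" by (rule mult_le_mono1) simp
  then show "Suc (s 16) \<le> 12 * x" using a by linarith
qed (auto simp: drop_bounds_def)

lemma quota_le: "quota d a b x z q j g \<pi> L f m \<Longrightarrow> (\<And>p. \<pi> \<le> p \<Longrightarrow> g' p \<le> g p) \<Longrightarrow> quota d a b x z q j g' \<pi> L f m"
  by (erule quota_mono) auto

lemma H_drop_body:
  "H (\<lambda>s m \<alpha>. drop_inv x i Pt s m \<alpha> \<and> s 16 < (12 - s 12) * x \<and> (12 - s 12) * x - s 16 = v) drop_body 9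
     (\<lambda>s m \<alpha>. drop_inv x i Pt s m \<alpha> \<and> (12 - s 12) * x - s 16 < v)"
proof -
  let ?P = "\<lambda>s m \<alpha>. drop_inv x i Pt s m \<alpha> \<and> s 16 < (12 - s 12) * x \<and> (12 - s 12) * x - s 16 = v"
  let ?Q = "\<lambda>s m \<alpha>. drop_inv x i Pt s m \<alpha> \<and> (12 - s 12) * x - s 16 < v"
  have bnd: "s 16 < 12 * x" if "s 16 < (12 - s 12) * x" for s :: regs
  proof -
    have "(12 - s 12) * x \<le> 12 * x" by (rule mult_le_mono1) simp
    then show ?thesis using that by linarith
  qed
  have stP: "stable ?P" using drop_inv_stable[where h = "\<lambda>s. s"] unfolding stable_def by blast
  have load: "H ?P (Load 20 (Plus (R 10) (R 16))) 1 (drop_read x i Pt v)"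
  proof (rule H_Load[OF stP])
    fix s m \<alpha>
    assume P: "?P s m \<alpha>"
    note c = conjunct2[OF conjunct1[OF P, unfolded drop_inv_def]]
    note b = core_bounds[OF c]
    have A: "s 8 = 64 * x" "0 < x" "s 16 < 12 * x" using P bnd unfolding drop_inv_def drop_bounds_def by auto
    have addr: "aval w (Plus (R 10) (R 16)) s = s 10 + s 16" using b A n_pos by (simp add: arith_simps)
    let ?s = "s(20 := m (s 10 + s 16))"
    have "core (\<lambda>f fp m. drop_mem x (Suc (?s 16)) (?s 17) (?s 16 - ?s 17) (\<lambda>d p. of_bool (key d (?s 20) \<le> p)) ?s f m) Pt ?s m \<alpha>"
    proof (rule core_cong[OF c])
      fix f fp
      define d where "d = (s 27 = 0)"
      assume "drop_mem x (s 16) (s 17) (s 16 - s 17) (\<lambda>_ _. 0) s f m"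
      then obtain l h where lh: "l + h = s 12"
        "quota d (s 10 - 512 * x) (s 10) x ((12 - s 12) * x) (s 16) (s 17) (\<lambda>p. l * x + (s 16 - s 17) + 0) (key d (s 13)) (4 + 3 * l) f m"
        "quota (\<not> d) (s 10 - 512 * x) (s 10) x ((12 - s 12) * x) (s 16) (s 17) (\<lambda>p. h * x + 0) 0 (4 + 3 * h) f m"
        "s 16 - s 17 < x \<longrightarrow> x \<le> s 16 - s 17 + 0 + cnt m (s 10 + s 16) (s 10 + 8 * x) (at_most d (key d (s 13))) + f"
        unfolding drop_mem_def d_def by blast
      have q: "s 16 < (12 - s 12) * x" using P by blast
      have "cnt m (s 10 + s 16) (s 10 + 8 * x) Q \<le> of_bool (Q (m (s 10 + s 16))) + cnt m (s 10 + Suc (s 16)) (s 10 + 8 * x) Q" for Q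
        using cnt_first[of "s 10 + s 16" "s 10 + 8 * x" m Q] by (cases "s 16 < 8 * x") auto
      from this[of "at_most d (key d (s 13))"]
      have "s 16 - s 17 < x \<longrightarrow> x \<le> s 16 - s 17 + of_bool (key d (m (s 10 + s 16)) \<le> key d (s 13)) +
          cnt m (s 10 + Suc (s 16)) (s 10 + 8 * x) (at_most d (key d (s 13))) + f"
        using lh(4) by linarith
      then show "drop_mem x (Suc (?s 16)) (?s 17) (?s 16 - ?s 17) (\<lambda>d p. of_bool (key d (?s 20) \<le> p)) ?s f m"
        using lh(1) quota_read[OF lh(2) q] quota_read[OF lh(3) q] unfolding drop_mem_def d_def
        by (intro exI[of _ l] exI[of _ h]) simp
    qed auto
    then show "drop_read x i Pt v (s(20 := m (aval w (Plus (R 10) (R 16)) s))) m \<alpha>"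
      using P unfolding drop_read_def drop_inv_def addr by (auto simp: drop_bounds_def)
  qed simp
  let ?c = "And (Less (Times (N 64) (R 16)) (Plus (R 8) (Times (N 64) (R 17))))
          (Not (And (Not (And (Eq (R 27) (N 0)) (Elem_le (R 20) (R 13))))
                    (Not (And (Not (Eq (R 27) (N 0))) (Elem_le (R 13) (R 20))))))"
  have cond: "bval w le ?c s \<longleftrightarrow> s 16 - s 17 < x \<and> key (s 27 = 0) (s 20) \<le> key (s 27 = 0) (s 13)"
    if wf: "wf_state w s m" and M: "drop_read x i Pt v s m \<alpha>" for s m \<alpha>
  proof -
    note b = core_bounds[OF conjunct2[OF M[unfolded drop_read_def]]]
    have A: "s 8 = 64 * x" "0 < x" "s 16 < 12 * x" "s 17 \<le> s 16" using M bnd unfolding drop_read_def drop_bounds_def by auto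
    have "aval w (Times (N 64) (R 16)) s = 64 * s 16" "aval w (Plus (R 8) (Times (N 64) (R 17))) s = 64 * x + 64 * s 17"
      "aval w (N 0) s = 0"
      using b A n_pos by (simp_all add: arith_simps)
    moreover have "64 * s 16 < 64 * x + 64 * s 17 \<longleftrightarrow> s 16 - s 17 < x" using A by linarith
    ultimately show ?thesis
      using Elem_le_key[OF wf, of 20 13] Elem_le_key[OF wf, of 13 20] key_rev[of "s 20" "s 13"]
      by (cases "s 27 = 0") auto
  qed
  have stC: "stable (\<lambda>s m \<alpha>. drop_read x i Pt v s m \<alpha> \<and> bval w le ?c s)" "stable (\<lambda>s m \<alpha>. drop_read x i Pt v s m \<alpha> \<and> \<not> bval w le ?c s)"
    using drop_read_stable unfolding stable_def by blast+
  have incr16: "ev (incr 16) s = s(16 := Suc (s 16))" if "core \<Phi> Pt s m \<alpha>" "s 16 < 12 * x" "s 8 = 64 * x" for \<Phi> s m \<alpha>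
    using core_bounds[OF that(1)] that n_pos by (simp add: incr_def arith_simps)
  have yes: "H (\<lambda>s m \<alpha>. drop_read x i Pt v s m \<alpha> \<and> bval w le ?c s) (incr 16) 1 ?Q"
  proof (rule H_reg[OF _ stC(1)])
    fix s m \<alpha>
    assume wf: "wf_state w s m" and a: "drop_read x i Pt v s m \<alpha> \<and> bval w le ?c s"
    note c = conjunct2[OF conjunct1[OF a, unfolded drop_read_def]]
    have C: "s 16 - s 17 < x" "key (s 27 = 0) (s 20) \<le> key (s 27 = 0) (s 13)" using cond[OF wf] a by blast+
    have A: "drop_bounds x i s" "s 16 < (12 - s 12) * x" "(12 - s 12) * x - s 16 = v" using a unfolding drop_read_def by auto
    let ?s = "s(16 := Suc (s 16))"
    have ev: "ev (incr 16) s = ?s" by (rule incr16[OF c]) (use A bnd in \<open>auto simp: drop_bounds_def\<close>)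
    have e: "Suc (s 16) - s 17 = Suc (s 16 - s 17)" using A unfolding drop_bounds_def by auto
    have "core (\<lambda>f fp m. drop_mem x (?s 16) (?s 17) (?s 16 - ?s 17) (\<lambda>_ _. 0) ?s f m) Pt ?s m \<alpha>"
    proof (rule core_cong[OF c])
      fix f fp
      assume "drop_mem x (Suc (s 16)) (s 17) (s 16 - s 17) (\<lambda>d p. of_bool (key d (s 20) \<le> p)) s f m"
      then obtain l h where lh: "l + h = s 12"
        "quota (s 27 = 0) (s 10 - 512 * x) (s 10) x ((12 - s 12) * x) (Suc (s 16)) (s 17)
           (\<lambda>p. l * x + (s 16 - s 17) + of_bool (key (s 27 = 0) (s 20) \<le> p)) (key (s 27 = 0) (s 13)) (4 + 3 * l) f m"
        "quota (s 27 \<noteq> 0) (s 10 - 512 * x) (s 10) x ((12 - s 12) * x) (Suc (s 16)) (s 17)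
           (\<lambda>p. h * x + of_bool (key (s 27 \<noteq> 0) (s 20) \<le> p)) 0 (4 + 3 * h) f m"
        "s 16 - s 17 < x \<longrightarrow> x \<le> s 16 - s 17 + of_bool (key (s 27 = 0) (s 20) \<le> key (s 27 = 0) (s 13)) +
        cnt m (s 10 + Suc (s 16)) (s 10 + 8 * x) (at_most (s 27 = 0) (key (s 27 = 0) (s 13))) + f"
        unfolding drop_mem_def by blast
      \<comment> \<open>The dropped median does not exceed the pivot, hence no threshold from
        \<open>P\<close> on: its credit becomes independent of \<open>p\<close>.\<close>
      have "quota (s 27 = 0) (s 10 - 512 * x) (s 10) x ((12 - s 12) * x) (Suc (s 16)) (s 17)
           (\<lambda>p. l * x + (Suc (s 16 - s 17)) + 0) (key (s 27 = 0) (s 13)) (4 + 3 * l) f m"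
        by (rule quota_le[OF lh(2)]) (use C in auto)
      moreover have "quota (s 27 \<noteq> 0) (s 10 - 512 * x) (s 10) x ((12 - s 12) * x) (Suc (s 16)) (s 17)
           (\<lambda>p. h * x + 0) 0 (4 + 3 * h) f m"
        by (rule quota_le[OF lh(3)]) auto
      moreover have "Suc (s 16 - s 17) < x \<longrightarrow> x \<le> Suc (s 16 - s 17) + 0 +
        cnt m (s 10 + Suc (s 16)) (s 10 + 8 * x) (at_most (s 27 = 0) (key (s 27 = 0) (s 13))) + f"
        using lh(4) C by auto
      ultimately show "drop_mem x (?s 16) (?s 17) (?s 16 - ?s 17) (\<lambda>_ _. 0) ?s f m"
        using lh(1) e unfolding drop_mem_def by (intro exI[of _ l] exI[of _ h]) simp
    qed auto
    then have "drop_inv x i Pt ?s m \<alpha>" using A C e unfolding drop_inv_def drop_bounds_def by simp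
    then show "?Q (ev (incr 16) s) m \<alpha>" unfolding ev using A by auto
  qed (simp_all add: incr_def)
  let ?h = "\<lambda>s. s(17 := Suc (s 17), 16 := Suc (s 16))"
  let ?J = "\<lambda>s m \<alpha>. drop_inv x i Pt (?h s) m \<alpha> \<and> (12 - s 12) * x - Suc (s 16) < v"
  have stJ: "stable ?J" using drop_inv_stable[where h = ?h] unfolding stable_def by blast
  have store: "H (\<lambda>s m \<alpha>. drop_read x i Pt v s m \<alpha> \<and> \<not> bval w le ?c s) (Store (Plus (R 10) (R 17)) (R 20)) 1 ?J"
  proof (rule H_Store[OF stC(2)])
    fix s m \<alpha>
    assume wf: "wf_state w s m" and a: "drop_read x i Pt v s m \<alpha> \<and> \<not> bval w le ?c s"
    note c = conjunct2[OF conjunct1[OF a, unfolded drop_read_def]]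
    note b = core_bounds[OF c]
    have C: "\<not> (s 16 - s 17 < x \<and> key (s 27 = 0) (s 20) \<le> key (s 27 = 0) (s 13))" using cond[OF wf] a by blast
    have A: "drop_bounds x i s" "s 16 < (12 - s 12) * x" "(12 - s 12) * x - s 16 = v" using a unfolding drop_read_def by auto
    have A': "s 17 \<le> s 16" "s 16 < 12 * x" "s 8 = 64 * x" using A bnd unfolding drop_bounds_def by auto
    have addr: "aval w (Plus (R 10) (R 17)) s = s 10 + s 17" using b A' n_pos by (simp add: arith_simps)
    let ?m = "m(s 10 + s 17 := s 20)"
    have "core (\<lambda>f fp m. drop_mem x (Suc (s 16)) (Suc (s 17)) (s 16 - s 17) (\<lambda>_ _. 0) s f m) Pt s ?m \<alpha>"
    proof (rule core_store[OF c])
      fix f fp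
      assume "drop_mem x (Suc (s 16)) (s 17) (s 16 - s 17) (\<lambda>d p. of_bool (key d (s 20) \<le> p)) s f m"
      then obtain l h where lh: "l + h = s 12"
        "quota (s 27 = 0) (s 10 - 512 * x) (s 10) x ((12 - s 12) * x) (Suc (s 16)) (s 17)
           (\<lambda>p. l * x + (s 16 - s 17) + of_bool (key (s 27 = 0) (s 20) \<le> p)) (key (s 27 = 0) (s 13)) (4 + 3 * l) f m"
        "quota (s 27 \<noteq> 0) (s 10 - 512 * x) (s 10) x ((12 - s 12) * x) (Suc (s 16)) (s 17)
           (\<lambda>p. h * x + of_bool (key (s 27 \<noteq> 0) (s 20) \<le> p)) 0 (4 + 3 * h) f m"
        "s 16 - s 17 < x \<longrightarrow> x \<le> s 16 - s 17 + of_bool (key (s 27 = 0) (s 20) \<le> key (s 27 = 0) (s 13)) +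
        cnt m (s 10 + Suc (s 16)) (s 10 + 8 * x) (at_most (s 27 = 0) (key (s 27 = 0) (s 13))) + f"
        unfolding drop_mem_def by blast
      have ab: "s 10 - 512 * x + 64 * x \<le> s 10" "s 17 < Suc (s 16)" using b(2) A' by auto
      have "s 16 - s 17 < x \<longrightarrow> x \<le> s 16 - s 17 + 0 +
        cnt ?m (s 10 + Suc (s 16)) (s 10 + 8 * x) (at_most (s 27 = 0) (key (s 27 = 0) (s 13))) + f"
        using lh(4) C A' by auto
      then show "drop_mem x (Suc (s 16)) (Suc (s 17)) (s 16 - s 17) (\<lambda>_ _. 0) s f ?m"
        using lh(1) quota_write[OF lh(2) ab(2,1)] quota_write[OF lh(3) ab(2,1)] unfolding drop_mem_def
        by (intro exI[of _ l] exI[of _ h]) simp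
    qed simp
    then have "core (\<lambda>f fp m. drop_mem x (?h s 16) (?h s 17) (?h s 16 - ?h s 17) (\<lambda>_ _. 0) (?h s) f m) Pt (?h s) ?m \<alpha>"
      by (rule core_cong) (auto simp: drop_mem_def)
    then show "?J s (m(aval w (Plus (R 10) (R 17)) s := aval w (R 20) s)) \<alpha>"
      using A unfolding addr drop_inv_def drop_bounds_def by auto
  qed simp
  have inc: "H ?J (incr 17 ;; incr 16) 3 ?Q"
  proof (rule H_reg[OF _ stJ])
    fix s m \<alpha>
    assume a: "?J s m \<alpha>"
    note b = core_bounds[OF conjunct2[OF conjunct1[OF a, unfolded drop_inv_def]]]
    have A: "s 8 = 64 * x" "Suc (s 16) \<le> 12 * x" "s 17 \<le> s 16"
      using conjunct1[OF conjunct1[OF a, unfolded drop_inv_def]] drop_bounds_le[of x i "?h s"] unfolding drop_bounds_def by auto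
    have "ev (incr 17 ;; incr 16) s = ?h s" using b A n_pos by (simp add: incr_def arith_simps)
    then show "?Q (ev (incr 17 ;; incr 16) s) m \<alpha>" using a by auto
  qed (simp_all add: incr_def)
  have "H (drop_read x i Pt v) (If ?c (incr 16) (Store (Plus (R 10) (R 17)) (R 20) ;; incr 17 ;; incr 16)) 6 ?Q"
    by (rule H_If[OF drop_read_stable yes H_seq[OF store stJ inc]]) auto
  then show ?thesis unfolding drop_body_def using H_Seq[OF load drop_read_stable] by simp
qed


lemma discard_pre_stable:
  "stable (\<lambda>s m \<alpha>. (s 8 = 64 * x \<and> 0 < x \<and> s 12 = i \<and> i \<le> 4) \<and> core (\<lambda>f fp m. level_inv x (s 10) (s 12) f m \<and> contract x s f m \<and>
        cnt m (s 10 - 512 * x) (s 10 - 512 * x + 64 * x) (at_most (s 27 = 0) (key (s 27 = 0) (s 13))) \<le> 8 * x + f) Pt s m \<alpha>)"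
    (is "stable (\<lambda>s m \<alpha>. ?A s \<and> core (?\<Phi> s) Pt s m \<alpha>)")
proof (rule core_stable[where A = ?A and h = "\<lambda>s. s" and Pt = "\<lambda>_. Pt" and \<Phi> = ?\<Phi>])
    fix s :: regs and f fp m u v f' fp'
    assume a: "?A s" "8 * s 8 \<le> s 10" and l: "?\<Phi> s f fp m"
      and f: "f + of_bool (s 10 - 8 * s 8 \<le> u \<and> u < s 10 + s 8) \<le> f'"
    have "f + of_bool (s 10 - 512 * x \<le> u \<and> u < s 10 - 512 * x + 64 * x) \<le> f'"
      by (rule of_bool_weaken[OF f]) (use a in auto)
    then have "cnt (m(u := v)) (s 10 - 512 * x) (s 10 - 512 * x + 64 * x) (at_most (s 27 = 0) (key (s 27 = 0) (s 13))) \<le> 8 * x + f'"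
      using cnt_upd_le[of m u v "s 10 - 512 * x" "s 10 - 512 * x + 64 * x" "at_most (s 27 = 0) (key (s 27 = 0) (s 13))"] l
      by linarith
    then show "?\<Phi> s f' fp' (m(u := v))"
      by (intro conjI level_inv_upd[OF conjunct1[OF l] of_bool_weaken[OF f]]
          contract_upd[OF conjunct1[OF conjunct2[OF l]] of_bool_weaken[OF f]])
        (use a in auto)
  qed

lemma H_discard:
  "H (\<lambda>s m \<alpha>. (s 8 = 64 * x \<and> 0 < x \<and> s 12 = i \<and> i \<le> 4) \<and> core (\<lambda>f fp m. level_inv x (s 10) (s 12) f m \<and> contract x s f m \<and>
        cnt m (s 10 - 512 * x) (s 10 - 512 * x + 64 * x) (at_most (s 27 = 0) (key (s 27 = 0) (s 13))) \<le> 8 * x + f) Pt s m \<alpha>)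
     discard (200 * x)
     (\<lambda>s m \<alpha>. (s 8 = 64 * x \<and> 0 < x \<and> s 12 = i \<and> i \<le> 4) \<and> core (\<lambda>f fp m. level_inv x (s 10) (Suc (s 12)) f m) Pt s m \<alpha>)"
proof (cases "0 < x")
  case True
  let ?\<Phi> = "\<lambda>s f fp m. level_inv x (s 10) (s 12) f m \<and> contract x s f m \<and>
        cnt m (s 10 - 512 * x) (s 10 - 512 * x + 64 * x) (at_most (s 27 = 0) (key (s 27 = 0) (s 13))) \<le> 8 * x + f"
  let ?A = "\<lambda>s. s 8 = 64 * x \<and> 0 < x \<and> s 12 = i \<and> i \<le> 4"
  let ?P = "\<lambda>s m \<alpha>. ?A s \<and> core (?\<Phi> s) Pt s m \<alpha>"
  have stP: "stable ?P" by (rule discard_pre_stable)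
  let ?b = "Less (Plus (Times (N 64) (R 16)) (Times (R 12) (R 8))) (Times (N 12) (R 8))"
  have st: "stable (drop_inv x i Pt)" using drop_inv_stable[where h = "\<lambda>s. s"] .
  have guard: "bval w le ?b s \<longleftrightarrow> s 16 < (12 - s 12) * x" if I: "drop_inv x i Pt s m \<alpha>" for s m \<alpha>
  proof -
    note b = core_bounds[OF conjunct2[OF I[unfolded drop_inv_def]]]
    have A: "s 8 = 64 * x" "s 16 \<le> 12 * x" "s 12 \<le> 4" using I drop_bounds_le unfolding drop_inv_def drop_bounds_def by auto
    have i: "s 12 * s 8 \<le> 4 * s 8" using A by (intro mult_le_mono1) simp
    have "s 12 * s 8 < 2 ^ w" by (rule small_n) (use i b n_pos in linarith)
    then have t1: "aval w (Times (R 12) (R 8)) s = s 12 * s 8" by (simp add: aval_Times)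
    have t2: "aval w (Times (N 64) (R 16)) s = 64 * s 16" 
      "aval w (Times (N 12) (R 8)) s = 12 * s 8"
      using b A n_pos by (simp_all add: arith_simps)
    have "64 * s 16 + s 12 * s 8 < 2 ^ w" by (rule small_n) (use b A i n_pos in linarith)
    then have "aval w (Plus (Times (N 64) (R 16)) (Times (R 12) (R 8))) s = 64 * s 16 + s 12 * s 8"
      using t1 t2 by (simp add: aval_Plus)
    moreover have "64 * s 16 + s 12 * s 8 < 12 * s 8 \<longleftrightarrow> s 16 + s 12 * x < 12 * x"
      using A(1) by (auto simp: algebra_simps)
    moreover have "s 16 + s 12 * x < 12 * x \<longleftrightarrow> s 16 < (12 - s 12) * x" by (auto simp: diff_mult_distrib)
    ultimately show ?thesis using t2 by simp
  qed
  let ?\<mu> = "\<lambda>s. (12 - s 12) * x - s 16"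
  have loop: "H (\<lambda>s m \<alpha>. drop_inv x i Pt s m \<alpha> \<and> ?\<mu> s \<le> 12 * x) (While ?b drop_body) (12 * x * (9 + 2) + 1)
     (\<lambda>s m \<alpha>. drop_inv x i Pt s m \<alpha> \<and> \<not> bval w le ?b s)"
  proof (rule H_for[OF st _ _ le_refl])
    fix v
    show "H (\<lambda>s m \<alpha>. drop_inv x i Pt s m \<alpha> \<and> bval w le ?b s \<and> ?\<mu> s = v) drop_body 9
      (\<lambda>s m \<alpha>. drop_inv x i Pt s m \<alpha> \<and> ?\<mu> s < v)"
      by (rule H_conseq[OF H_drop_body[of x i Pt v]]) (use guard in auto)
  next
    show "0 < ?\<mu> s" if "drop_inv x i Pt s m \<alpha>" "bval w le ?b s" for s m \<alpha> using guard[OF that(1)] that(2) by simp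
  qed
  let ?i = "Assign 16 (N 0) ;; Assign 17 (N 0)"
  have init: "H ?P ?i 3 (\<lambda>s m \<alpha>. drop_inv x i Pt s m \<alpha> \<and> ?\<mu> s \<le> 12 * x)"
  proof (rule H_reg[OF _ stP])
    fix s m \<alpha>
    assume P: "?P s m \<alpha>"
    let ?s = "s(16 := 0, 17 := 0)"
    have ev: "ev ?i s = ?s" by (simp add: aval.simps)
    have "core (\<lambda>f fp m. drop_mem x (?s 16) (?s 17) (?s 16 - ?s 17) (\<lambda>_ _. 0) ?s f m) Pt ?s m \<alpha>"
    proof (rule core_cong[OF conjunct2[OF P]])
      fix f fp
      assume a: "?\<Phi> s f fp m"
      define d where "d = (s 27 = 0)"
      obtain l h where lh: "l + h = s 12" "half d (s 10) x (s 12) l f m" "half (\<not> d) (s 10) x (s 12) h f m"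
        using a unfolding level_inv_def by (cases d) (auto, metis add.commute)
      have 1: "quota d (s 10 - 512 * x) (s 10) x ((12 - s 12) * x) 0 0 (\<lambda>_. l * x) (key d (s 13)) (4 + 3 * l) f m"
        by (rule quota_start) (use lh(2) a in \<open>auto simp: half_def d_def\<close>)
      have "x \<le> cnt m (s 10) (s 10 + 8 * x) (at_most d (key d (s 13))) + f"
        using a unfolding contract_def by blast
      then show "drop_mem x (?s 16) (?s 17) (?s 16 - ?s 17) (\<lambda>_ _. 0) ?s f m"
        using 1 lh(1,3) unfolding drop_mem_def half_def
        by (intro exI[of _ l] exI[of _ h]) (simp add: d_def)
    qed auto
    then show "drop_inv x i Pt (ev ?i s) m \<alpha> \<and> ?\<mu> (ev ?i s) \<le> 12 * x"
      unfolding ev drop_inv_def using P by (simp add: drop_bounds_def)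
  qed simp_all
  have stI: "stable (\<lambda>s m \<alpha>. drop_inv x i Pt s m \<alpha> \<and> ?\<mu> s \<le> 12 * x)" using st unfolding stable_def by blast
  show ?thesis
    unfolding discard_def
  proof (rule H_Seq[OF init stI H_post[OF loop]])
    fix s m \<alpha>
    assume a: "drop_inv x i Pt s m \<alpha> \<and> \<not> bval w le ?b s"
    then have A: "drop_bounds x i s" "\<not> s 16 < (12 - s 12) * x" using guard unfolding drop_inv_def by blast+
    define z where "z = (12 - s 12) * x"
    have q: "s 16 = z" and A': "s 17 \<le> s 16" "s 16 - s 17 \<le> x" "s 12 \<le> 4" using A unfolding drop_bounds_def z_def by auto
    have z8: "8 * x \<le> z" unfolding z_def by (rule mult_le_mono1) (use A' in auto)
    have z': "(12 - Suc (s 12)) * x = z - x" unfolding z_def by (simp add: diff_mult_distrib)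
    have "core (\<lambda>f fp m. level_inv x (s 10) (Suc (s 12)) f m) Pt s m \<alpha>"
    proof (rule core_cong[OF conjunct2[OF conjunct1[OF a, unfolded drop_inv_def]]])
      fix f fp
      define d where "d = (s 27 = 0)"
      define e where "e = s 16 - s 17"
      assume "drop_mem x (s 16) (s 17) (s 16 - s 17) (\<lambda>_ _. 0) s f m"
      then obtain l h where lh: "l + h = s 12"
        "quota d (s 10 - 512 * x) (s 10) x z z (s 17) (\<lambda>p. l * x + e + 0) (key d (s 13)) (4 + 3 * l) f m"
        "quota (\<not> d) (s 10 - 512 * x) (s 10) x z z (s 17) (\<lambda>p. h * x + 0) 0 (4 + 3 * h) f m"
        "e < x \<longrightarrow> x \<le> e + 0 + cnt m (s 10 + z) (s 10 + 8 * x) (at_most d (key d (s 13))) + f"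
        unfolding drop_mem_def q[symmetric] z_def[symmetric] d_def e_def by (auto simp: q z_def)
      \<comment> \<open>If fewer than \<open>x\<close> medians were dropped, then no suitable one is
        left unread, since the pass covers the first \<open>8 x\<close> medians; the shortfall is
        due to corruptions.\<close>
      have e: "x \<le> e + f" using lh(4) z8 A'(2) unfolding e_def by (cases "e < x") (auto simp: e_def)
      have zj: "z - x \<le> s 17" using A' q by linarith
      have "half d (s 10) x (Suc (s 12)) (Suc l) f m" unfolding half_def z'
        by (rule quota_final[OF lh(2) zj]) (use e in \<open>simp add: algebra_simps\<close>)
      moreover have "half (\<not> d) (s 10) x (Suc (s 12)) h f m" unfolding half_def z'
        by (rule quota_final[OF lh(3) zj]) simp
      ultimately show "level_inv x (s 10) (Suc (s 12)) f m"
        using lh(1) unfolding level_inv_def by (cases d; simp; metis add_Suc add_Suc_right add.commute)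
    qed auto
    then show "(s 8 = 64 * x \<and> 0 < x \<and> s 12 = i \<and> i \<le> 4) \<and> core (\<lambda>f fp m. level_inv x (s 10) (Suc (s 12)) f m) Pt s m \<alpha>"
      using A unfolding drop_bounds_def by blast
  qed (use True in auto)
qed (simp add: H_def)

section \<open>Rounds of the pivot search\<close>

definition good :: "regs \<Rightarrow> nat \<Rightarrow> nat \<Rightarrow> mem \<Rightarrow> bool" where
  "good s f fp m \<longleftrightarrow> (\<forall>d. s 8 \<le> 8 * (cnt m (s 10 - 8 * s 8) (s 10 - 8 * s 8 + s 8) (at_most d (key d (s 13))) + fp))"

lemma good_upd:
  assumes "good s f fp m" "8 * s 8 \<le> s 10" "fp + of_bool (s 10 - 8 * s 8 \<le> u \<and> u < s 10) \<le> fp'"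
  shows "good s f' fp' (m(u := v))"
proof -
  define a where "a = s 10 - 8 * s 8"
  have "a + s 8 \<le> s 10 \<or> s 8 = 0" using assms(2) unfolding a_def by linarith
  then have f: "fp + of_bool (a \<le> u \<and> u < a + s 8) \<le> fp'"
    by (intro of_bool_weaken[OF assms(3)]) (auto simp: a_def)
  have "s 8 \<le> 8 * (cnt (m(u := v)) a (a + s 8) (at_most d (key d (s 13))) + fp')" for d
  proof -
    have "s 8 \<le> 8 * (cnt m a (a + s 8) (at_most d (key d (s 13))) + fp)"
      using assms(1) unfolding good_def a_def by blast
    also have "\<dots> \<le> 8 * (cnt (m(u := v)) a (a + s 8) (at_most d (key d (s 13))) + fp')"
      using f cnt_upd_ge[of m a "a + s 8" "at_most d (key d (s 13))" u v] by (intro mult_le_mono2) linarith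
    finally show ?thesis .
  qed
  then show ?thesis unfolding good_def a_def by blast
qed

definition ready :: assn where
  "ready s m \<alpha> \<longleftrightarrow> s 14 = 0 \<and> core (\<lambda>_ _ _. True) (5 * s 8) s m \<alpha>"

definition returning :: assn where
  "returning s m \<alpha> \<longleftrightarrow> s 14 = 1 \<and> core (good s) 0 s m \<alpha>"

lemma ready_stable: "stable ready"
  unfolding ready_def
  by (rule core_stable[where h = "\<lambda>s. s" and A = "\<lambda>s. s 14 = 0" and \<Phi> = "\<lambda>_ _ _ _. True" and Pt = "\<lambda>s. 5 * s 8"]) auto

lemma returning_stable: "stable (\<lambda>s. returning (h s))"
  unfolding returning_def
  by (rule core_stable[where h = h and A = "\<lambda>s. s 14 = 1" and \<Phi> = good and Pt = "\<lambda>_. 0"]) (rule good_upd, assumption+)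

lemma power8_cases: "(s :: nat) = 8 ^ e \<Longrightarrow> s < 9 \<or> (\<exists>x>0. s = 64 * x)"
  by (cases e; cases "e - 1") auto

lemma core_power: "core \<Phi> Pt s m \<alpha> \<Longrightarrow> s 8 < 9 \<or> (\<exists>x>0. s 8 = 64 * x)"
  unfolding core_def using power8_cases by blast

text \<open>The fuel \<open>(240 - 48 * i) * x\<close> provides \<open>48 x\<close> for each of the
  \<open>5 - i\<close> remaining subcalls: \<open>40 x\<close> for the search in a subinstance of
  size \<open>8 x\<close> and \<open>8 x\<close> for the return from it.\<close>

lemma H_push:
  "H (\<lambda>s m \<alpha>. (s 8 = 64 * x \<and> 0 < x \<and> s 12 = i \<and> i \<le> 4) \<and> core (\<lambda>f fp m. level_inv x (s 10) i f m) ((240 - 48 * i) * x) s m \<alpha>)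
     push 7 ready"
proof (rule H_reg)
  let ?A = "\<lambda>s. s 8 = 64 * x \<and> 0 < x \<and> s 12 = i \<and> i \<le> 4"
  show "stable (\<lambda>s m \<alpha>. ?A s \<and> core (\<lambda>f fp m. level_inv x (s 10) i f m) ((240 - 48 * i) * x) s m \<alpha>)"
    by (rule level_inv_stable) simp
  fix s m \<alpha>
  assume a: "?A s \<and> core (\<lambda>f fp m. level_inv x (s 10) i f m) ((240 - 48 * i) * x) s m \<alpha>"
  then have A: "s 8 = 64 * x" "0 < x" "s 12 = i" "i \<le> 4" and c: "core (\<lambda>f fp m. level_inv x (s 10) i f m) ((240 - 48 * i) * x) s m \<alpha>"
    by auto
  note b = core_bounds[OF c]
  obtain f fs con where f: "level_inv x (s 10) i f m" "stk (s 9) (s 8) (s 10) (s 11) fs m"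
     "con + f + total fs \<le> 2 * \<alpha>" "16384 * n + (240 - 48 * i) * x + pot (s 3) (s 8) fs \<le> 96 * n + 6400 * con + s 15"
    and c': "s 0 = n \<and> outer (s 3) (s 1) (klo s) (khi s) m \<alpha> \<and> s 9 \<le> s 3 \<and> s 3 < 8 * s 9" "\<exists>e. s 8 = 8 ^ e"
    using c unfolding core_def by blast
  obtain g fs' where fs: "fs = g # fs'" using stk_facts(5)[OF f(2)] by (cases fs) auto
  have "Suc (s 11) * 1 \<le> Suc (s 11) * s 8" using b(8) by (intro mult_le_mono2)
  then have S: "s 11 < n" using le_trans[OF _ b(4)] by fastforce
  define s' where "s' = s(11 := 8 * s 11 + i, 10 := s 10 + 64 * x, 8 := 8 * x, 14 := 0)"
  have ev: "ev push s = s'"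
    using A b S n_pos by (simp add: push_def s'_def arith_simps)
  have "stk (s 9) (8 * x) (s 10 + 64 * x) (8 * s 11 + i) ((i, f) # fs) m"
  proof -
    \<comment> \<open>The packed digits grow by a factor of 8 per level while the size shrinks by 8,
      so the product stays below the outermost size and the digits fit into a word.\<close>
    have "Suc (8 * s 11 + i) * (8 * x) \<le> Suc (s 11) * (64 * x)"
    proof -
      have "Suc (8 * s 11 + i) * (8 * x) \<le> (8 * Suc (s 11)) * (8 * x)" by (rule mult_le_mono1) (use A in auto)
      then show ?thesis by (simp add: algebra_simps)
    qed
    then have "Suc (8 * s 11 + i) * (8 * x) \<le> s 9" using stk_facts(3)[OF f(2)] A by simp
    moreover have "8 * x < s 9" using stk_facts(4)[OF f(2)] A by simp
    moreover have "512 * x \<le> s 10" "s 10 + 128 * x \<le> 10 * s 9" using stk_facts(1,2)[OF f(2)] A by auto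
    moreover have "stk (s 9) (64 * x) (s 10) (s 11) (g # fs') m" using f(2) fs A by simp
    ultimately show ?thesis using A f(1) unfolding fs by (auto intro!: exI[of _ x])
  qed
  moreover have "\<exists>e. 8 * x = 8 ^ e"
  proof -
    obtain e where "64 * x = 8 ^ e" using c'(2) A by auto
    then show ?thesis using A(2) by (cases e; cases "e - 1") (auto intro: exI[of _ "e - 1"])
  qed
  moreover have "16384 * n + 40 * x + pot (s 3) (8 * x) ((i, f) # fs) \<le> 96 * n + 6400 * con + s 15"
  proof -
    have "40 * x + (25 - 6 * i) * (8 * x) = (240 - 48 * i) * x" using A(4)
      by (simp add: diff_mult_distrib algebra_simps)
    moreover have "pot (s 3) (8 * x) ((i, f) # fs) = (25 - 6 * i) * (8 * x) + pot (s 3) (s 8) fs"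
      using A(1) unfolding fs by simp
    ultimately show ?thesis using f(4) by linarith
  qed
  moreover have "con + 0 + total ((i, f) # fs) \<le> 2 * \<alpha>" using f(3) by (simp add: total_def)
  ultimately have "\<exists>f fs con. stk (s 9) (8 * x) (s 10 + 64 * x) (8 * s 11 + i) fs m \<and> con + f + total fs \<le> 2 * \<alpha> \<and>
      16384 * n + 40 * x + pot (s 3) (8 * x) fs \<le> 96 * n + 6400 * con + s 15" "\<exists>e. 8 * x = 8 ^ e" by blast+
  moreover have "klo s' = klo s" "khi s' = khi s" by (simp_all add: s'_def)
  ultimately have "core (\<lambda>_ _ _. True) (5 * s' 8) s' m \<alpha>" using c' unfolding core_def by (simp add: s'_def)
  then show "ready (ev push s) m \<alpha>" unfolding ev ready_def by (simp add: s'_def)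
qed (simp_all add: push_def)

lemma H_call:
  "H (\<lambda>s m \<alpha>. s 8 = v \<and> core (\<lambda>_ _ _. True) (4 * s 8) s m \<alpha>) call (20 * v + 20)
     (\<lambda>s m \<alpha>. ready s m \<alpha> \<or> returning s m \<alpha>)"
proof -
  let ?P = "\<lambda>s m \<alpha>. s 8 = v \<and> core (\<lambda>_ _ _. True) (4 * s 8) s m \<alpha>"
  let ?Q = "\<lambda>s m \<alpha>. ready s m \<alpha> \<or> returning s m \<alpha>"
  have st: "stable ?P"
    by (rule core_stable[where A = "\<lambda>s. s 8 = v" and h = "\<lambda>s. s" and Pt = "\<lambda>s. 4 * s 8" and \<Phi> = "\<lambda>_ _ _ _. True"]) auto
  let ?c = "Less (R 8) (N 9)"
  have c9: "bval w le ?c s \<longleftrightarrow> s 8 < 9" for s using n_pos by (simp add: arith_simps)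
  have stt: "stable (\<lambda>s m \<alpha>. ?P s m \<alpha> \<and> bval w le ?c s)" using st unfolding stable_def by blast
  let ?M = "\<lambda>s m \<alpha>. s 8 < 9 \<and> core (good s) 0 s m \<alpha>"
  have stM: "stable ?M"
    by (rule core_stable[where A = "\<lambda>s. s 8 < 9" and h = "\<lambda>s. s" and Pt = "\<lambda>s. 0" and \<Phi> = good])
      (rule good_upd, assumption+)
  have base1: "H (\<lambda>s m \<alpha>. ?P s m \<alpha> \<and> bval w le ?c s) (Load 13 addrA) 1 ?M"
  proof (rule H_Load[OF stt])
    fix s m \<alpha>
    assume a: "?P s m \<alpha> \<and> bval w le ?c s"
    then have c: "core (\<lambda>_ _ _. True) (4 * s 8) s m \<alpha>" and s8: "s 8 < 9" using c9 by auto
    note b = core_bounds[OF c]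
    have addr: "aval w addrA s = s 10 - 8 * s 8" using b n_pos by (simp add: arith_simps)
    let ?s = "s(13 := m (s 10 - 8 * s 8))"
    have "core (good ?s) 0 ?s m \<alpha>"
    proof (rule core_cong[OF c])
      fix f fp
      show "good ?s f fp m"
        unfolding good_def
      proof
        fix d
        let ?a = "?s 10 - 8 * ?s 8"
        \<comment> \<open>The chosen element counts for both directions, and the instance has at
          most eight elements.\<close>
        have "cnt m ?a (?a + ?s 8) (at_most d (key d (?s 13))) = 1 + cnt m (Suc ?a) (?a + ?s 8) (at_most d (key d (?s 13)))"
          using cnt_first[of ?a "?a + ?s 8"] b(8) by simp
        moreover note s8
        ultimately show "?s 8 \<le> 8 * (cnt m ?a (?a + ?s 8) (at_most d (key d (?s 13))) + fp)"
          by simp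
      qed
    qed auto
    then show "?M (s(13 := m (aval w addrA s))) m \<alpha>" unfolding addr using s8 by simp
  qed simp
  have base2: "H ?M (Assign 14 (N 1)) 1 ?Q"
  proof (rule H_Assign[OF stM])
    fix s m \<alpha>
    assume M: "?M s m \<alpha>"
    have "core (good (s(14 := 1))) 0 (s(14 := 1)) m \<alpha>"
      by (rule core_cong[OF conjunct2[OF M]]) (auto simp: good_def)
    then show "?Q (s(14 := aval w (N 1) s)) m \<alpha>" unfolding returning_def using n_pos by (simp add: arith_simps)
  qed simp
  have base: "H (\<lambda>s m \<alpha>. ?P s m \<alpha> \<and> bval w le ?c s) (Load 13 addrA ;; Assign 14 (N 1)) (20 * v + 19) ?Q"
    by (rule H_Seq[OF base1 stM base2]) simp
  have rec: "H (\<lambda>s m \<alpha>. ?P s m \<alpha> \<and> \<not> bval w le ?c s) (medians ;; (Assign 12 (N 0) ;; push)) (20 * v + 19) ?Q"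
  proof (cases "\<exists>x>0. v = 64 * x")
    case True
    then obtain x where x: "0 < x" "v = 64 * x" by blast
    \<comment> \<open>Of the \<open>5 * 64 x\<close> for this instance, \<open>64 x\<close> has been
      charged for the present round; the remaining \<open>256 x\<close> covers the
      \<open>240 x\<close> of five subcalls.\<close>
    let ?R = "\<lambda>s m \<alpha>. s 8 = 64 * x \<and> core (\<lambda>f fp m. level_inv x (s 10) 0 f m) (256 * x) s m \<alpha>"
    let ?S = "\<lambda>s m \<alpha>. (s 8 = 64 * x \<and> 0 < x \<and> s 12 = 0 \<and> (0 :: nat) \<le> 4) \<and> core (\<lambda>f fp m. level_inv x (s 10) 0 f m) ((240 - 48 * 0) * x) s m \<alpha>"
    have stab: "stable (\<lambda>s m \<alpha>. B s \<and> core (\<lambda>f fp m. level_inv x (s 10) 0 f m) Pt s m \<alpha>)" if B: "\<And>s. B s \<Longrightarrow> s 8 = 64 * x" for B Pt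
      by (rule level_inv_stable) (rule B)
    have stR: "stable ?R" by (rule stab) simp
    have stS: "stable ?S" by (rule stab) simp
    have "H ?R (Assign 12 (N 0)) 1 ?S"
    proof (rule H_Assign[OF stR])
      fix s m \<alpha>
      assume R: "?R s m \<alpha>"
      have "core (\<lambda>f fp m. level_inv x (s 10) 0 f m) ((240 - 48 * 0) * x) (s(12 := 0)) m \<alpha>"
        by (rule core_cong[OF conjunct2[OF R]]) auto
      then show "?S (s(12 := aval w (N 0) s)) m \<alpha>" using R x by (simp add: aval.simps)
    qed simp
    from H_seq[OF this stS H_push] have "H ?R (Assign 12 (N 0) ;; push) 9 ready" by simp
    then have R: "H ?R (Assign 12 (N 0) ;; push) 9 ?Q" by (rule H_post) simp
    have "H (\<lambda>s m \<alpha>. ?P s m \<alpha> \<and> \<not> bval w le ?c s) medians (800 * x) ?R"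
      by (rule H_pre[OF H_medians]) (use x in auto)
    from H_Seq[OF this stR R] show ?thesis using x by simp
  next
    case False
    have "H (\<lambda>s m \<alpha>. False) (medians ;; (Assign 12 (N 0) ;; push)) (20 * v + 19) ?Q" by (simp add: H_def)
    then show ?thesis by (rule H_pre) (use False core_power c9 in blast)
  qed
  show ?thesis unfolding call_def by (rule H_If[OF st base rec]) auto
qed


text \<open>The charge for this round has been paid already; adding \<open>s 8\<close> to register
  15 states the invariant as it was before. The counter of the finished level is dropped, and the
  first counter of the stack becomes the current one.\<close>

lemma H_pop:
  "H (\<lambda>s m \<alpha>. (s 8 = v \<and> s 8 \<noteq> s 9) \<and> returning (s(15 := s 15 + s 8)) m \<alpha>) pop 7
     (\<lambda>s m \<alpha>. \<exists>x i. v = 8 * x \<and> (s 8 = 64 * x \<and> 0 < x \<and> s 14 = 1 \<and> s 12 = i \<and> i \<le> 4) \<and>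
        core (\<lambda>f fp m. level_inv x (s 10) (s 12) f m \<and> contract x s f m) ((192 - 48 * i) * x) s m \<alpha>)"
proof (rule H_reg)
  let ?P = "\<lambda>s m \<alpha>. (s 8 = v \<and> s 8 \<noteq> s 9) \<and> returning (s(15 := s 15 + s 8)) m \<alpha>"
  show "stable ?P" using returning_stable[where h = "\<lambda>s. s(15 := s 15 + s 8)"] unfolding stable_def by blast
  fix s m \<alpha>
  assume wf: "wf_state w s m" and P: "?P s m \<alpha>"
  let ?t = "s(15 := s 15 + s 8)"
  have c: "core (good ?t) 0 ?t m \<alpha>" and s14: "s 14 = 1" using P unfolding returning_def by auto
  obtain f fs con e where f: "good ?t f (snd (hd fs)) m" "stk (s 9) (s 8) (s 10) (s 11) fs m"
     "con + f + total fs \<le> 2 * \<alpha>" "16384 * n + pot (s 3) (s 8) fs \<le> 96 * n + 6400 * con + (s 15 + s 8)"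
    and c': "s 0 = n \<and> outer (s 3) (s 1) (klo s) (khi s) m \<alpha> \<and> s 9 \<le> s 3 \<and> s 3 < 8 * s 9" "s 8 = 8 ^ e"
    using c unfolding core_def by auto
  note b = core_bounds[OF c, simplified]
  obtain i g g' fs' where fs: "fs = (i, g) # g' # fs'"
    using f(2) P by (cases "(s 9, s 8, s 10, s 11, fs, m)" rule: stk.cases) auto
  obtain x where x: "0 < x" "s 8 = 8 * x" "level_inv x (s 10 - 8 * s 8) i g m" "i < 5" "s 11 mod 8 = i" "72 * s 8 \<le> s 10"
    and tl: "stk (s 9) (64 * x) (s 10 - 8 * s 8) (s 11 div 8) (g' # fs') m"
    using f(2) unfolding fs by auto
  define s' where "s' = s(8 := 64 * x, 10 := s 10 - 64 * x, 12 := i, 11 := s 11 div 8)"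
  have s11: "s 11 < 2 ^ w" using wf unfolding wf_state_def by blast
  have ev: "ev pop s = s'"
  proof -
    have "aval w (Times (N 8) (R 8)) s = 64 * x" using b x n_pos by (simp add: arith_simps)
    moreover have "s 10 < 2 ^ w" "64 * x \<le> s 10" using wf x unfolding wf_state_def by auto
    moreover have "aval w (N 8) s = 8" for s using n_pos by (simp add: arith_simps)
    ultimately show ?thesis using x(5) by (simp add: pop_def s'_def aval_Minus fun_eq_iff)
  qed
  have "contract x s' g m"
    unfolding contract_def
  proof
    fix d
    have a: "s 10 - 8 * s 8 = s 10 - 64 * x" "s 10 - 8 * s 8 + s 8 = s 10 - 64 * x + 8 * x" using x(2) by simp_all
    have "8 * x \<le> 8 * (cnt m (s 10 - 64 * x) (s 10 - 64 * x + 8 * x) (at_most d (key d (s 13))) + g)"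
      using f(1)[unfolded good_def, rule_format, of d] unfolding fs by (simp add: x(2))
    then show "x \<le> cnt m (s' 10) (s' 10 + 8 * x) (at_most d (key d (s' 13))) + g" by (simp add: s'_def)
  qed
  moreover have "level_inv x (s' 10) (s' 12) g m" using x by (simp add: s'_def)
  moreover have "con + g + total (g' # fs') \<le> 2 * \<alpha>" using f(3) unfolding fs by (simp add: total_def)
  moreover have "16384 * n + (192 - 48 * i) * x + pot (s 3) (64 * x) (g' # fs') \<le> 96 * n + 6400 * con + s 15"
  proof -
    have "(25 - 6 * i) * (8 * x) = (192 - 48 * i) * x + 8 * x" using x(4)
      by (simp add: diff_mult_distrib algebra_simps)
    moreover have "pot (s 3) (s 8) fs = (25 - 6 * i) * (8 * x) + pot (s 3) (64 * x) (g' # fs')"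
      using x(2) unfolding fs by simp
    ultimately show ?thesis using f(4) x(2) by linarith
  qed
  ultimately have "\<exists>f fs con. (level_inv x (s' 10) (s' 12) f m \<and> contract x s' f m) \<and> stk (s 9) (64 * x) (s 10 - 64 * x) (s 11 div 8) fs m \<and>
      con + f + total fs \<le> 2 * \<alpha> \<and>
      16384 * n + (192 - 48 * i) * x + pot (s 3) (64 * x) fs \<le> 96 * n + 6400 * con + s 15"
    using tl x(2) by (intro exI[of _ g] exI[of _ "g' # fs'"] exI[of _ con]) simp
  moreover have "\<exists>e. 64 * x = 8 ^ e" using c'(2) x(2) by (intro exI[of _ "Suc e"]) simp
  moreover have "klo s' = klo s" "khi s' = khi s" by (simp_all add: s'_def)
  ultimately have "core (\<lambda>f fp m. level_inv x (s' 10) (s' 12) f m \<and> contract x s' f m) ((192 - 48 * i) * x) s' m \<alpha>"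
    using c' unfolding core_def by (simp add: s'_def)
  then show "\<exists>x i. v = 8 * x \<and> (ev pop s 8 = 64 * x \<and> 0 < x \<and> ev pop s 14 = 1 \<and> ev pop s 12 = i \<and> i \<le> 4) \<and>
        core (\<lambda>f fp m. level_inv x (ev pop s 10) (ev pop s 12) f m \<and> contract x (ev pop s) f m) ((192 - 48 * i) * x) (ev pop s) m \<alpha>"
    unfolding ev using x s14 P by (intro exI[of _ x] exI[of _ i]) (simp add: s'_def)
qed (simp_all add: pop_def)

lemma H_select_side:
  assumes "i \<le> 4"
  shows "H (\<lambda>s m \<alpha>. ((s 8 = 64 * x \<and> 0 < x \<and> s 14 = 1 \<and> s 12 = i \<and> i \<le> 4 \<and> s 18 \<le> 64 * x \<and> s 19 \<le> 64 * x) \<and>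
        core (count_inv x (64 * x) (\<lambda>_. 0) s) Pt s m \<alpha>) \<and>
        \<not> bval w le (And (Not (Less (Times (N 8) (R 18)) (R 8))) (Not (Less (Times (N 8) (R 19)) (R 8)))) s)
     (If (Less (Times (N 8) (R 18)) (R 8)) (Assign 27 (N 0)) (Assign 27 (N 1))) 2
     (\<lambda>s m \<alpha>. (s 8 = 64 * x \<and> 0 < x \<and> s 12 = i \<and> i \<le> 4) \<and> core (\<lambda>f fp m. level_inv x (s 10) (s 12) f m \<and> contract x s f m \<and>
        cnt m (s 10 - 512 * x) (s 10 - 512 * x + 64 * x) (at_most (s 27 = 0) (key (s 27 = 0) (s 13))) \<le> 8 * x + f) Pt s m \<alpha>)"
    (is "H ?P ?c 2 ?Q")
proof (rule H_reg)
  let ?A = "\<lambda>s. s 8 = 64 * x \<and> 0 < x \<and> s 14 = 1 \<and> s 12 = i \<and> i \<le> 4 \<and> s 18 \<le> 64 * x \<and> s 19 \<le> 64 * x"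
  have "stable (\<lambda>s m \<alpha>. ?A s \<and> core (count_inv x (64 * x) (\<lambda>_. 0) s) Pt s m \<alpha>)"
    by (rule core_stable[where A = ?A and h = "\<lambda>s. s" and Pt = "\<lambda>_. Pt" and \<Phi> = "\<lambda>s. count_inv x (64 * x) (\<lambda>_. 0) s"], erule count_inv_upd) auto
  then show "stable ?P" unfolding stable_def by blast
  fix s m \<alpha>
  assume P: "?P s m \<alpha>"
  then have A: "?A s" and c: "core (count_inv x (64 * x) (\<lambda>_. 0) s) Pt s m \<alpha>" by blast+
  note b = core_bounds[OF c]
  have t: "aval w (Times (N 8) (R 18)) s = 8 * s 18" "aval w (Times (N 8) (R 19)) s = 8 * s 19"
    using A b n_pos by (simp_all add: arith_simps)
  define d where "d = (s 18 < 8 * x)"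
  have d: "tally d s < 8 * x" using P A t unfolding d_def tally_def by auto
  let ?s = "s(27 := if d then 0 else 1)"
  have ev: "ev ?c s = ?s" using t A n_pos by (auto simp: d_def arith_simps)
  have d27: "(?s 27 = 0) = d" by simp
  have "core (\<lambda>f fp m. level_inv x (?s 10) (?s 12) f m \<and> contract x ?s f m \<and>
        cnt m (?s 10 - 512 * x) (?s 10 - 512 * x + 64 * x) (\<lambda>y. key (?s 27 = 0) y \<le> key (?s 27 = 0) (?s 13)) \<le> 8 * x + f) Pt ?s m \<alpha>"
    unfolding d27
  proof (rule core_cong[OF c])
    fix f fp
    assume a: "count_inv x (64 * x) (\<lambda>_. 0) s f fp m"
    then have "cnt m (s 10 - 8 * s 8) (s 10 - 8 * s 8 + 64 * x) (at_most d (key d (s 13))) \<le> tally d s + 0 + f"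
      unfolding count_inv_def by blast
    moreover have "8 * s 8 = 512 * x" using A by simp
    ultimately have "cnt m (s 10 - 512 * x) (s 10 - 512 * x + 64 * x) (at_most d (key d (s 13))) \<le> 8 * x + f"
      using d by simp
    then show "level_inv x (?s 10) (?s 12) f m \<and> contract x ?s f m \<and>
        cnt m (?s 10 - 512 * x) (?s 10 - 512 * x + 64 * x) (at_most d (key d (?s 13))) \<le> 8 * x + f"
      using a unfolding count_inv_def contract_def by simp
  qed auto
  then show "?Q (ev ?c s) m \<alpha>" unfolding ev using A by simp
qed simp_all

lemma H_next_round:
  "H (\<lambda>s m \<alpha>. (s 8 = 64 * x \<and> 0 < x \<and> s 12 = i \<and> i \<le> 4) \<and> core (\<lambda>f fp m. level_inv x (s 10) (Suc (s 12)) f m) ((192 - 48 * i) * x) s m \<alpha>)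
     (incr 12 ;; If (Eq (R 12) (N 5)) (Assign 14 (N 0)) push) 10 ready"
proof -
  let ?A = "\<lambda>j s. s 8 = 64 * x \<and> 0 < x \<and> s 12 = j \<and> i \<le> 4"
  let ?P = "\<lambda>s m \<alpha>. ?A i s \<and> core (\<lambda>f fp m. level_inv x (s 10) (Suc (s 12)) f m) ((192 - 48 * i) * x) s m \<alpha>"
  let ?M = "\<lambda>s m \<alpha>. ?A (Suc i) s \<and> core (\<lambda>f fp m. level_inv x (s 10) (s 12) f m) ((192 - 48 * i) * x) s m \<alpha>"
  have st: "stable (\<lambda>s m \<alpha>. ?A j s \<and> core (\<lambda>f fp m. level_inv x (s 10) (h s) f m) ((192 - 48 * i) * x) s m \<alpha>)" for j and h :: "regs \<Rightarrow> nat"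
    by (rule level_inv_stable) simp
  have stM: "stable ?M" by (rule st)
  have inc: "H ?P (incr 12) 1 ?M"
  proof (rule H_reg[OF _ st])
    fix s m \<alpha>
    assume P: "?P s m \<alpha>"
    have ev: "ev (incr 12) s = s(12 := Suc i)" using P n_pos by (simp add: incr_def arith_simps)
    have "core (\<lambda>f fp m. level_inv x ((s(12 := Suc i)) 10) ((s(12 := Suc i)) 12) f m) ((192 - 48 * i) * x) (s(12 := Suc i)) m \<alpha>"
      by (rule core_cong[OF conjunct2[OF P]]) (use P in auto)
    then show "?M (ev (incr 12) s) m \<alpha>" unfolding ev using P by simp
  qed (simp_all add: incr_def)
  let ?c = "Eq (R 12) (N 5)"
  have c5: "bval w le ?c s \<longleftrightarrow> s 12 = 5" for s using n_pos by (simp add: arith_simps)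
  have restart: "H (\<lambda>s m \<alpha>. ?M s m \<alpha> \<and> bval w le ?c s) (Assign 14 (N 0)) 1 ready"
  proof (rule H_Assign)
    show "stable (\<lambda>s m \<alpha>. ?M s m \<alpha> \<and> bval w le ?c s)" using stM unfolding stable_def by blast
    fix s m \<alpha>
    assume a: "?M s m \<alpha> \<and> bval w le ?c s"
    then have A: "s 8 = 64 * x" "s 12 = 5" "i = 4" using c5 by auto
    have c: "core (\<lambda>f fp m. level_inv x (s 10) 5 f m) ((192 - 48 * i) * x) s m \<alpha>"
      using a unfolding A(2) by blast
    obtain f fs con where f: "level_inv x (s 10) 5 f m" "stk (s 9) (s 8) (s 10) (s 11) fs m"
     "con + f + total fs \<le> 2 * \<alpha>" "16384 * n + (192 - 48 * i) * x + pot (s 3) (s 8) fs \<le> 96 * n + 6400 * con + s 15"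
      and c': "s 0 = n \<and> outer (s 3) (s 1) (klo s) (khi s) m \<alpha> \<and> s 9 \<le> s 3 \<and> s 3 < 8 * s 9" "\<exists>e. s 8 = 8 ^ e"
      using c unfolding core_def by blast
    \<comment> \<open>The corruptions \<open>f\<close> of this level move into \<open>con\<close>:
      since \<open>x \<le> 20 * f\<close>, they buy the \<open>5 * 64 x = 320 x\<close> units of a
      new search. The counter restarts at 0, so no corruption pays twice.\<close>
    have "16384 * n + 5 * s 8 + pot (s 3) (s 8) fs \<le> 96 * n + 6400 * (con + f) + s 15"
      using level_inv_exhausted[OF f(1)] f(4) A by simp
    moreover have "(con + f) + 0 + total fs \<le> 2 * \<alpha>" using f(3) by simp
    ultimately have "\<exists>f fs con. stk (s 9) (s 8) (s 10) (s 11) fs m \<and> con + f + total fs \<le> 2 * \<alpha> \<and>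
       16384 * n + 5 * s 8 + pot (s 3) (s 8) fs \<le> 96 * n + 6400 * con + s 15" using f(2) by blast
    then have "core (\<lambda>_ _ _. True) (5 * s 8) s m \<alpha>" unfolding core_def using c' by blast
    then have "core (\<lambda>_ _ _. True) (5 * s 8) (s(14 := 0)) m \<alpha>" by (rule core_cong) auto
    then show "ready (s(14 := aval w (N 0) s)) m \<alpha>" unfolding ready_def by (simp add: aval.simps)
  qed simp
  have again: "H (\<lambda>s m \<alpha>. ?M s m \<alpha> \<and> \<not> bval w le ?c s) push 7 ready"
  proof (cases "i \<le> 3")
    case True
    then have eq: "(240 - 48 * Suc i) * x = (192 - 48 * i) * x" by simp
    show ?thesis
    proof (rule H_pre[OF H_push[of x "Suc i"]])
      fix s m \<alpha>
      assume a: "?M s m \<alpha> \<and> \<not> bval w le ?c s"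
      then have s12: "s 12 = Suc i" by blast
      have "core (\<lambda>f fp m. level_inv x (s 10) (Suc i) f m) ((240 - 48 * Suc i) * x) s m \<alpha>"
        using a unfolding eq s12 by blast
      then show "(s 8 = 64 * x \<and> 0 < x \<and> s 12 = Suc i \<and> Suc i \<le> 4) \<and>
          core (\<lambda>f fp m. level_inv x (s 10) (Suc i) f m) ((240 - 48 * Suc i) * x) s m \<alpha>" using a True by simp
    qed
  next
    case False
    have "H (\<lambda>s m \<alpha>. False) push 7 ready" by (simp add: H_def)
    then show ?thesis by (rule H_pre) (use False c5 in auto)
  qed
  have "H ?M (If ?c (Assign 14 (N 0)) push) 8 ready" by (rule H_If[OF stM restart again]) auto
  from H_seq[OF inc stM this] show ?thesis by simp
qed

lemma H_round:
  "H (\<lambda>s m \<alpha>. (s 8 = v \<and> s 8 \<noteq> s 9) \<and> returning (s(15 := s 15 + s 8)) m \<alpha>)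
     (pop ;; count ;;
      If (And (Not (Less (Times (N 8) (R 18)) (R 8))) (Not (Less (Times (N 8) (R 19)) (R 8)))) SKIP
        (If (Less (Times (N 8) (R 18)) (R 8)) (Assign 27 (N 0)) (Assign 27 (N 1)) ;; discard ;;
         (incr 12 ;; If (Eq (R 12) (N 5)) (Assign 14 (N 0)) push))) (150 * v + 40)
     (\<lambda>s m \<alpha>. ready s m \<alpha> \<or> returning s m \<alpha>)"
    (is "H _ (pop ;; count ;; If ?c SKIP ?d) _ ?Q")
proof -
  let ?A = "\<lambda>x i s. s 8 = 64 * x \<and> 0 < x \<and> s 14 = 1 \<and> s 12 = i \<and> i \<le> 4"
  let ?\<Phi> = "\<lambda>x s f fp m. level_inv x (s 10) (s 12) f m \<and> contract x s f m"
  let ?R = "\<lambda>s m \<alpha>. \<exists>x i. v = 8 * x \<and> ?A x i s \<and> core (?\<Phi> x s) ((192 - 48 * i) * x) s m \<alpha>"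
  have stR1: "stable (\<lambda>s m \<alpha>. ?A x i s \<and> core (?\<Phi> x s) Pt s m \<alpha>)" for x i Pt
  proof (rule core_stable[where A = "?A x i" and h = "\<lambda>s. s" and Pt = "\<lambda>_. Pt" and \<Phi> = "?\<Phi> x"])
    fix s :: regs and f fp m u v f' fp'
    assume a: "?A x i s" "8 * s 8 \<le> s 10" and l: "?\<Phi> x s f fp m"
      and f: "f + of_bool (s 10 - 8 * s 8 \<le> u \<and> u < s 10 + s 8) \<le> f'"
    show "?\<Phi> x s f' fp' (m(u := v))"
      by (intro conjI level_inv_upd[OF conjunct1[OF l] of_bool_weaken[OF f]] contract_upd[OF conjunct2[OF l] of_bool_weaken[OF f]])
        (use a in auto)
  qed
  have stR: "stable ?R" using stR1 unfolding stable_def by blast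
  have main: "H ?R (count ;; If ?c SKIP ?d) (150 * v + 30) ?Q"
  proof (intro H_ex)
    fix x i
    show "H (\<lambda>s m \<alpha>. v = 8 * x \<and> ?A x i s \<and> core (?\<Phi> x s) ((192 - 48 * i) * x) s m \<alpha>) (count ;; If ?c SKIP ?d) (150 * v + 30) ?Q"
    proof (rule H_pure)
      assume v: "v = 8 * x"
      show "H (\<lambda>s m \<alpha>. ?A x i s \<and> core (?\<Phi> x s) ((192 - 48 * i) * x) s m \<alpha>) (count ;; If ?c SKIP ?d) (150 * v + 30) ?Q"
      proof (cases "i \<le> 4")
        case True
        let ?B = "\<lambda>s. s 8 = 64 * x \<and> 0 < x \<and> s 14 = 1 \<and> s 12 = i \<and> i \<le> 4 \<and> s 18 \<le> 64 * x \<and> s 19 \<le> 64 * x"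
        let ?C = "\<lambda>s m \<alpha>. ?B s \<and> core (count_inv x (64 * x) (\<lambda>_. 0) s) ((192 - 48 * i) * x) s m \<alpha>"
        have stC: "stable ?C"
          by (rule core_stable[where A = ?B and h = "\<lambda>s. s" and Pt = "\<lambda>_. (192 - 48 * i) * x" and \<Phi> = "\<lambda>s. count_inv x (64 * x) (\<lambda>_. 0) s"], erule count_inv_upd) auto
        have yes: "H (\<lambda>s m \<alpha>. ?C s m \<alpha> \<and> bval w le ?c s) SKIP 0 ?Q"
        proof (rule H_SKIP)
          fix s m \<alpha>
          assume a: "?C s m \<alpha> \<and> bval w le ?c s"
          then have B: "?B s" and c: "core (count_inv x (64 * x) (\<lambda>_. 0) s) ((192 - 48 * i) * x) s m \<alpha>" by blast+
          note b = core_bounds[OF c]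
          have t: "aval w (Times (N 8) (R 18)) s = 8 * s 18" "aval w (Times (N 8) (R 19)) s = 8 * s 19"
            using B b n_pos by (simp_all add: arith_simps)
          have tl: "8 * x \<le> tally d s" for d using a B t unfolding tally_def by auto
          have "core (good s) 0 s m \<alpha>"
          proof (rule core_cong[OF c])
            fix f fp
            assume p: "count_inv x (64 * x) (\<lambda>_. 0) s f fp m"
            show "good s f fp m"
              unfolding good_def
            proof
              fix d
              have "tally d s + 0 \<le> cnt m (s 10 - 8 * s 8) (s 10 - 8 * s 8 + 64 * x) (at_most d (key d (s 13))) + fp"
                using p unfolding count_inv_def by blast
              then have "8 * (8 * x) \<le> 8 * (cnt m (s 10 - 8 * s 8) (s 10 - 8 * s 8 + 64 * x) (at_most d (key d (s 13))) + fp)"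
                using tl[of d] by (intro mult_le_mono2) linarith
              then show "s 8 \<le> 8 * (cnt m (s 10 - 8 * s 8) (s 10 - 8 * s 8 + s 8) (at_most d (key d (s 13))) + fp)"
                using B by simp
            qed
          qed auto
          then show "?Q s m \<alpha>" using B unfolding returning_def by simp
        qed
        let ?D = "\<lambda>s m \<alpha>. (s 8 = 64 * x \<and> 0 < x \<and> s 12 = i \<and> i \<le> 4) \<and> core (\<lambda>f fp m. level_inv x (s 10) (s 12) f m \<and> contract x s f m \<and>
          cnt m (s 10 - 512 * x) (s 10 - 512 * x + 64 * x) (at_most (s 27 = 0) (key (s 27 = 0) (s 13))) \<le> 8 * x + f) ((192 - 48 * i) * x) s m \<alpha>"
        let ?E = "\<lambda>s m \<alpha>. (s 8 = 64 * x \<and> 0 < x \<and> s 12 = i \<and> i \<le> 4) \<and> core (\<lambda>f fp m. level_inv x (s 10) (Suc (s 12)) f m) ((192 - 48 * i) * x) s m \<alpha>"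
        have stE: "stable ?E" by (rule level_inv_stable) simp
        have no: "H (\<lambda>s m \<alpha>. ?C s m \<alpha> \<and> \<not> bval w le ?c s) ?d (200 * x + 14) ?Q"
        proof -
          have n: "H ?E (incr 12 ;; If (Eq (R 12) (N 5)) (Assign 14 (N 0)) push) 10 ?Q"
            by (rule H_post[OF H_next_round]) simp
          show ?thesis by (rule H_Seq[OF H_select_side[OF True] discard_pre_stable H_seq[OF H_discard stE n]]) simp
        qed
        have "H ?C (If ?c SKIP ?d) (200 * x + 15) ?Q" by (rule H_If[OF stC yes no]) auto
        from H_Seq[OF H_count stC this] show ?thesis using v by simp
      next
        case False
        then show ?thesis by (auto simp: H_def)
      qed
    qed
  qed
  show ?thesis by (rule H_Seq[OF H_pop stR main]) simp
qed

section \<open>Partitioning the current array\<close>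

definition near :: "nat \<Rightarrow> nat \<Rightarrow> nat \<Rightarrow> bool" where
  "near a b \<alpha> \<longleftrightarrow> a \<le> b + \<alpha> \<and> b \<le> a + \<alpha>"

text \<open>Disjoint ranges share no cell, so a corruption changes the sum by one, not by two. This
  is what keeps the final error at exactly \<open>\<alpha>\<close> although elements move
  around.\<close>

lemma cnt2_upd:
  assumes "b \<le> c"
  shows "cnt (m(u := v)) a b P + cnt (m(u := v)) c d P \<le> cnt m a b P + cnt m c d P + 1"
    "cnt m a b P + cnt m c d P \<le> cnt (m(u := v)) a b P + cnt (m(u := v)) c d P + 1"
proof -
  have "u < b \<or> c \<le> u \<or> b \<le> u \<and> u < c" by auto
  then show "cnt (m(u := v)) a b P + cnt (m(u := v)) c d P \<le> cnt m a b P + cnt m c d P + 1"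
    "cnt m a b P + cnt m c d P \<le> cnt (m(u := v)) a b P + cnt (m(u := v)) c d P + 1"
    using cnt_upd_le[of m u v a b P] cnt_upd_ge[of m a b P u v]
      cnt_upd_le[of m u v c d P] cnt_upd_ge[of m c d P u v] assms
    by (auto simp: of_bool_def split: if_splits)
qed

lemma near2_upd:
  assumes "b \<le> c" "near C (z + cnt m a b P + cnt m c d P + e) \<alpha>"
  shows "near C (z + cnt (m(u := v)) a b P + cnt (m(u := v)) c d P + e) (Suc \<alpha>)"
  using assms(2) cnt2_upd[OF assms(1), where m = m and u = u and v = v and a = a and P = P and d = d] unfolding near_def by linarith

section \<open>The state between two stages\<close>

definition staged :: assn where
  "staged s m \<alpha> \<longleftrightarrow> s 0 = n \<and> outer (s 3) (s 1) (klo s) (khi s) m \<alpha> \<and>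
     (\<exists>con\<le>2 * \<alpha>. 16384 * n + 96 * s 3 \<le> 96 * n + 6400 * con + s 15)"

lemma staged_upd: "staged s m \<alpha> \<Longrightarrow> staged s (m(u := v)) (Suc \<alpha>)"
  unfolding staged_def using outer_upd by (metis le_SucI mult_Suc_right trans_le_add2)

lemma stable_STG: "stable (\<lambda>s m \<alpha>. A s \<and> staged (h s) m \<alpha>)"
  unfolding stable_def using staged_upd by blast

lemma staged_cong: "staged s m \<alpha> \<Longrightarrow> (\<And>r. r \<in> {0, 1, 3, 4, 5, 6, 7, 15} \<Longrightarrow> s' r = s r) \<Longrightarrow> staged s' m \<alpha>"
proof -
  assume a: "staged s m \<alpha>" "\<And>r. r \<in> {0, 1, 3, 4, 5, 6, 7, 15} \<Longrightarrow> s' r = s r"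
  have "klo s' = klo s" "khi s' = khi s" unfolding klo_def khi_def by (simp_all add: a(2))
  then show ?thesis using a(1) unfolding staged_def by (simp add: a(2))
qed

lemma H_new_stage: "H (\<lambda>s m \<alpha>. s 3 \<le> M \<and> staged s m \<alpha>) new_stage (3 * M + 12) ready"
proof -
  let ?P = "\<lambda>s m \<alpha>. s 3 \<le> M \<and> staged s m \<alpha>"
  let ?I = "\<lambda>s m \<alpha>. ((\<exists>e. s 8 = 8 ^ e) \<and> s 8 \<le> s 3 \<and> s 3 \<le> M) \<and> staged s m \<alpha>"
  have st: "stable ?I" by (rule stable_STG)
  have stP: "stable ?P" by (rule stable_STG)
  let ?b = "Not (Less (R 3) (Times (N 8) (R 8)))"
  have bnd: "s 3 \<le> n" "1 \<le> s 3" if "staged s m \<alpha>" for s m \<alpha> using that unfolding staged_def outer_def by auto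
  have t8: "aval w (Times (N 8) (R 8)) s = 8 * s 8" if "staged s m \<alpha>" "s 8 \<le> s 3" for s m \<alpha>
    using bnd[OF that(1)] that n_pos by (simp add: arith_simps)
  have init: "H ?P (Assign 8 (N 1)) 1 (\<lambda>s m \<alpha>. ?I s m \<alpha> \<and> s 3 - s 8 \<le> M)"
  proof (rule H_Assign[OF stP])
    fix s m \<alpha>
    assume P: "?P s m \<alpha>"
    then have "1 \<le> s 3" using bnd by blast
    moreover have "staged (s(8 := 1)) m \<alpha>" by (rule staged_cong[OF conjunct2[OF P]]) auto
    ultimately show "?I (s(8 := aval w (N 1) s)) m \<alpha> \<and> (s(8 := aval w (N 1) s)) 3 - (s(8 := aval w (N 1) s)) 8 \<le> M"
      using P n_pos by (auto simp: arith_simps intro: exI[of _ 0])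
  qed simp
  have loop: "H (\<lambda>s m \<alpha>. ?I s m \<alpha> \<and> s 3 - s 8 \<le> M) (While ?b (Assign 8 (Times (N 8) (R 8)))) (M * (1 + 2) + 1)
     (\<lambda>s m \<alpha>. ?I s m \<alpha> \<and> \<not> bval w le ?b s)"
  proof (rule H_for[OF st _ _ le_refl])
    fix v
    show "H (\<lambda>s m \<alpha>. ?I s m \<alpha> \<and> bval w le ?b s \<and> s 3 - s 8 = v) (Assign 8 (Times (N 8) (R 8))) 1
      (\<lambda>s m \<alpha>. ?I s m \<alpha> \<and> s 3 - s 8 < v)"
    proof (rule H_Assign)
      show "stable (\<lambda>s m \<alpha>. ?I s m \<alpha> \<and> bval w le ?b s \<and> s 3 - s 8 = v)" using st unfolding stable_def by blast
      fix s m \<alpha>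
      assume a: "?I s m \<alpha> \<and> bval w le ?b s \<and> s 3 - s 8 = v"
      then have S: "staged s m \<alpha>" and s8: "s 8 \<le> s 3" by blast+
      obtain e where e: "s 8 = 8 ^ e" using a by blast
      have g: "8 * s 8 \<le> s 3" using a t8[OF S s8] by auto
      have "staged (s(8 := 8 * s 8)) m \<alpha>" by (rule staged_cong[OF S]) auto
      moreover have "\<exists>e. 8 * s 8 = 8 ^ e" using e by (intro exI[of _ "Suc e"]) simp
      moreover have "s 3 - 8 * s 8 < s 3 - s 8"
      proof -
        have "0 < s 8" using e by simp
        then show ?thesis using g by linarith
      qed
      ultimately show "?I (s(8 := aval w (Times (N 8) (R 8)) s)) m \<alpha> \<and>
         (s(8 := aval w (Times (N 8) (R 8)) s)) 3 - (s(8 := aval w (Times (N 8) (R 8)) s)) 8 < v"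
        unfolding t8[OF S s8] using a g by auto
    qed simp
  next
    fix s m \<alpha>
    assume a: "?I s m \<alpha>" "bval w le ?b s"
    then have S: "staged s m \<alpha>" and s8: "s 8 \<le> s 3" by blast+
    obtain e where e: "s 8 = 8 ^ e" using a by blast
    then have "0 < s 8" by simp
    then show "0 < s 3 - s 8" using a t8[OF S s8] by auto
  qed
  let ?c = "Assign 9 (R 8) ;; Assign 10 (Times (N 8) (R 8)) ;; Assign 11 (N 0) ;; Assign 14 (N 0)"
  have fin: "H (\<lambda>s m \<alpha>. ?I s m \<alpha> \<and> \<not> bval w le ?b s) ?c 7 ready"
  proof (rule H_reg)
    show "stable (\<lambda>s m \<alpha>. ?I s m \<alpha> \<and> \<not> bval w le ?b s)" using st unfolding stable_def by blast
    fix s m \<alpha>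
    assume a: "?I s m \<alpha> \<and> \<not> bval w le ?b s"
    then have S: "staged s m \<alpha>" and s8: "s 8 \<le> s 3" and e: "\<exists>e. s 8 = 8 ^ e" by blast+
    have g: "s 3 < 8 * s 8" using a t8[OF S s8] by auto
    define s' where "s' = s(9 := s 8, 10 := 8 * s 8, 11 := 0, 14 := 0)"
    have ev: "ev ?c s = s'" using bnd[OF S] s8 n_pos by (simp add: s'_def arith_simps)
    obtain con where con: "con \<le> 2 * \<alpha>" "16384 * n + 96 * s 3 \<le> 96 * n + 6400 * con + s 15"
      using S unfolding staged_def by blast
    have "16384 * n + 5 * s 8 + pot (s 3) (s 8) [(0, 0)] \<le> 96 * n + 6400 * con + s 15" using con(2) s8 by simp
    then have "\<exists>f fs con. stk (s 8) (s 8) (8 * s 8) 0 fs m \<and> con + f + total fs \<le> 2 * \<alpha> \<and>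
       16384 * n + 5 * s 8 + pot (s 3) (s 8) fs \<le> 96 * n + 6400 * con + s 15"
      using con(1) by (intro exI[of _ 0] exI[of _ "[(0, 0)]"] exI[of _ con]) (simp add: total_def)
    moreover have "klo s' = klo s" "khi s' = khi s" by (simp_all add: s'_def)
    ultimately have "core (\<lambda>_ _ _. True) (5 * s' 8) s' m \<alpha>"
      using S s8 g e unfolding core_def staged_def by (simp add: s'_def)
    then show "ready (ev ?c s) m \<alpha>" unfolding ev ready_def by (simp add: s'_def)
  qed simp_all
  have stI': "stable (\<lambda>s m \<alpha>. ?I s m \<alpha> \<and> s 3 - s 8 \<le> M)" using st unfolding stable_def by blast
  have stN: "stable (\<lambda>s m \<alpha>. ?I s m \<alpha> \<and> \<not> bval w le ?b s)" using st unfolding stable_def by blast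
  show ?thesis unfolding new_stage_def
    by (rule H_Seq[OF init stI' H_seq[OF loop stN fin]]) simp
qed

text \<open>
  For a threshold up to the pivot key \<open>\<pi>\<close>, only the low part and the unread cells count; beyond \<open>\<pi>\<close>, the low
  part and the elements equal to the pivot count by their number, which corruptions cannot change.
  The last two conditions only involve numbers and unread cells; they decide on which side of the
  pivot the answer lies. The function \<open>e\<close> accounts for an element that has been read but not yet written.
\<close>

definition split_ok :: "nat \<Rightarrow> nat \<Rightarrow> nat \<Rightarrow> nat \<Rightarrow> nat \<Rightarrow> nat \<Rightarrow> nat \<Rightarrow> nat \<Rightarrow> nat \<Rightarrow> (nat \<Rightarrow> nat) \<Rightarrow> mem \<Rightarrow> nat \<Rightarrow> bool" where
  "split_ok lo hi \<pi> c mm q jl eq jh e m \<alpha> \<longleftrightarrow>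
     (\<forall>t. lo < t \<longrightarrow> t \<le> hi \<longrightarrow> t \<le> \<pi> \<longrightarrow>
        near (cl t) (c + cnt m 0 jl (under t) + cnt m q mm (under t) + e t) \<alpha>) \<and>
     (\<forall>t. lo < t \<longrightarrow> t \<le> hi \<longrightarrow> \<pi> < t \<longrightarrow>
        near (cl t) (c + jl + eq + cnt m q mm (under t) + cnt m n (n + jh) (under t) + e t) \<alpha>) \<and>
     (lo < \<pi> \<longrightarrow> cl \<pi> \<le> c + jl + cnt m q mm (under \<pi>) + e \<pi> + \<alpha>) \<and>
     (\<pi> < hi \<longrightarrow> c + jl + eq + cnt m q mm (under (Suc \<pi>)) + e (Suc \<pi>) \<le> cl (Suc \<pi>) + \<alpha>)"

lemma split_ok_upd:
  assumes "split_ok lo hi \<pi> c mm q jl eq jh e m \<alpha>" "jl \<le> q" "mm \<le> n"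
  shows "split_ok lo hi \<pi> c mm q jl eq jh e (m(u := v)) (Suc \<alpha>)"
  unfolding split_ok_def
proof (intro conjI allI impI)
  fix t assume "lo < t" "t \<le> hi" "t \<le> \<pi>"
  then show "near (cl t) (c + cnt (m(u := v)) 0 jl (under t) + cnt (m(u := v)) q mm (under t) + e t) (Suc \<alpha>)"
    using assms(1) unfolding split_ok_def by (intro near2_upd[OF assms(2)]) blast
next
  fix t assume "lo < t" "t \<le> hi" "\<pi> < t"
  then show "near (cl t) (c + jl + eq + cnt (m(u := v)) q mm (under t) +
      cnt (m(u := v)) n (n + jh) (under t) + e t) (Suc \<alpha>)"
    using assms(1) unfolding split_ok_def by (intro near2_upd[OF assms(3)]) blast
next
  assume "lo < \<pi>"
  then have "cl \<pi> \<le> c + jl + cnt m q mm (under \<pi>) + e \<pi> + \<alpha>" using assms(1) unfolding split_ok_def by blast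
  then show "cl \<pi> \<le> c + jl + cnt (m(u := v)) q mm (under \<pi>) + e \<pi> + Suc \<alpha>"
    using cnt_upd_ge[of m q mm "under \<pi>" u v] by (auto simp: of_bool_def split: if_splits)
next
  assume "\<pi> < hi"
  then have "c + jl + eq + cnt m q mm (under (Suc \<pi>)) + e (Suc \<pi>) \<le> cl (Suc \<pi>) + \<alpha>" using assms(1) unfolding split_ok_def by blast
  then show "c + jl + eq + cnt (m(u := v)) q mm (under (Suc \<pi>)) + e (Suc \<pi>) \<le> cl (Suc \<pi>) + Suc \<alpha>"
    using cnt_upd_le[of m u v q mm "under (Suc \<pi>)"] by (auto simp: of_bool_def split: if_splits)
qed

lemma split_ok_read:
  assumes "split_ok lo hi \<pi> c mm q jl eq jh (\<lambda>_. 0) m \<alpha>" "q < mm" "lo \<le> \<pi>" "\<pi> \<le> hi"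
  shows "split_ok lo hi \<pi> c mm (Suc q) jl eq jh (\<lambda>t. of_bool (min hi (max lo (key True (m q))) < t)) m \<alpha>"
proof -
  have *: "min hi (max lo x) < t \<longleftrightarrow> x < t" if "lo < t" "t \<le> hi" for x t using that by auto
  have "cnt m q mm P = of_bool (P (m q)) + cnt m (Suc q) mm P" for P using cnt_first[OF assms(2)] .
  then show ?thesis using assms unfolding split_ok_def by (simp add: * add.commute add.left_commute add.assoc)
qed

lemma split_ok_low:
  assumes "split_ok lo hi \<pi> c mm q jl eq jh (\<lambda>t. of_bool (key True y < t)) m \<alpha>" "key True y < \<pi>" "jl < q" "jl < n"
  shows "split_ok lo hi \<pi> c mm q (Suc jl) eq jh (\<lambda>_. 0) (m(jl := y)) \<alpha>"
proof -
  have "cnt (m(jl := y)) 0 (Suc jl) P = cnt m 0 jl P + of_bool (P y)" "cnt (m(jl := y)) q mm P = cnt m q mm P"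
    "cnt (m(jl := y)) n (n + jh) P = cnt m n (n + jh) P" for P
    using cnt_store_end[of 0 jl m y P] assms by simp_all
  then show ?thesis using assms(1,2) unfolding split_ok_def by (simp add: add.commute add.left_commute add.assoc)
qed

lemma split_ok_eq:
  assumes "split_ok lo hi \<pi> c mm q jl eq jh (\<lambda>t. of_bool (key True y < t)) m \<alpha>" "key True y = \<pi>"
  shows "split_ok lo hi \<pi> c mm q jl (Suc eq) jh (\<lambda>_. 0) m \<alpha>"
  using assms unfolding split_ok_def by (simp add: add.commute add.left_commute add.assoc)

lemma split_ok_high:
  assumes "split_ok lo hi \<pi> c mm q jl eq jh (\<lambda>t. of_bool (key True y < t)) m \<alpha>" "\<pi> < key True y" "jl \<le> n" "mm \<le> n"
  shows "split_ok lo hi \<pi> c mm q jl eq (Suc jh) (\<lambda>_. 0) (m(n + jh := y)) \<alpha>"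
proof -
  have "cnt (m(n + jh := y)) n (n + Suc jh) P = cnt m n (n + jh) P + of_bool (P y)" "cnt (m(n + jh := y)) q mm P = cnt m q mm P"
    "cnt (m(n + jh := y)) 0 jl P = cnt m 0 jl P" for P
    using cnt_store_end[of n "n + jh" m y P] assms by simp_all
  then show ?thesis using assms(1,2) unfolding split_ok_def by (simp add: add.commute add.left_commute add.assoc)
qed

definition clampk :: "regs \<Rightarrow> nat \<Rightarrow> nat" where
  "clampk s x = min (khi s) (max (klo s) x)"

lemma clampk_bounds: "klo s \<le> khi s \<Longrightarrow> klo s \<le> clampk s x \<and> clampk s x \<le> khi s"
  by (auto simp: clampk_def)

lemma clampk_idem: "klo s \<le> khi s \<Longrightarrow> clampk s (clampk s x) = clampk s x"
  by (auto simp: clampk_def)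

lemma ev_clamp_other: "r' \<noteq> r \<Longrightarrow> ev (clamp r) s r' = s r'"
  by (simp add: clamp_def)

lemma key_ev_clamp:
  assumes "wf_state w s m" "klo s \<le> khi s" "7 < r"
  shows "key True (ev (clamp r) s r) = clampk s (key True (s r))"
proof -
  let ?s1 = "ev (If (And (Eq (R 6) (N 1)) (Elem_le (R r) (R 4))) (Assign r (R 4)) SKIP) s"
  have n1: "aval w (N 1) s = 1" for s using n_pos by (simp add: arith_simps)
  \<comment> \<open>An upper end that is not set stands for \<open>2 ^ w + 1\<close>, above every
    key, so taking the minimum with it has no effect.\<close>
  have b: "key True x \<le> 2 ^ w" for x by (rule key_True_le)
  have wf1: "wf_state w ?s1 m" by (rule ev_wf[OF assms(1)])
  have o: "?s1 5 = s 5" "?s1 6 = s 6" "?s1 7 = s 7" "?s1 4 = s 4" using assms(3) by simp_all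
  have s1: "key True (?s1 r) = max (klo s) (key True (s r))"
    using assms(3) n1 Elem_le_key[OF assms(1), of r 4] by (auto simp: klo_def)
  have "ev (clamp r) s r = (if s 7 = 1 \<and> key True (s 5) \<le> key True (?s1 r) then s 5 else ?s1 r)"
    using n1 Elem_le_key[OF wf1, of 5 r] o unfolding clamp_def by (simp del: One_nat_def)
  then show ?thesis using s1 b[of "?s1 r"] unfolding clampk_def khi_def by (auto simp: min_def)
qed

text \<open>Up to \<open>f\<close> corruptions, one eighth of the outermost instance ends up on this side of the pivot.\<close>

definition progress :: "nat \<Rightarrow> (nat \<Rightarrow> bool) \<Rightarrow> nat \<Rightarrow> nat \<Rightarrow> nat \<Rightarrow> nat \<Rightarrow> mem \<Rightarrow> bool" where
  "progress N0 P z e q f m \<longleftrightarrow> N0 \<le> 8 * (z + cnt m q N0 P + e + f)"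

lemma progress_upd: "progress N0 P z e q f m \<Longrightarrow> progress N0 P z e q (Suc f) (m(u := v))"
proof -
  assume "progress N0 P z e q f m"
  then have "N0 \<le> 8 * (z + cnt m q N0 P + e + f)" unfolding progress_def .
  also have "\<dots> \<le> 8 * (z + cnt (m(u := v)) q N0 P + e + Suc f)"
    using cnt_upd_ge[of m q N0 P u v] by (intro mult_le_mono2) (auto simp: of_bool_def split: if_splits)
  finally show ?thesis unfolding progress_def .
qed

lemma progress_read: "progress N0 P z 0 q f m \<Longrightarrow> progress N0 P z (of_bool (P (m q))) (Suc q) f m"
  using cnt_first[of q N0 m P] unfolding progress_def by (cases "q < N0") auto

definition ckey :: "regs \<Rightarrow> nat" where
  "ckey s = clampk s (key True (s 20))"

definition part_bounds :: "nat \<Rightarrow> bool \<Rightarrow> regs \<Rightarrow> bool" where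
  "part_bounds v b s \<longleftrightarrow> s 0 = n \<and> s 17 + s 18 + s 19 = s 16 \<and> s 16 + of_bool b \<le> s 3 \<and> 1 \<le> s 1 \<and> s 1 \<le> s 3 \<and> s 1 \<le> k \<and>
     s 3 \<le> n \<and> klo s \<le> key True (s 13) \<and> key True (s 13) \<le> khi s \<and> s 9 \<le> s 3 \<and> s 3 < 8 * v"

text \<open>The flag \<open>b\<close> says that register 20 holds an element that has been read but
  not placed. The term \<open>6 * s 9\<close> is the fuel spent in this stage,
  \<open>5 * s 9\<close> on the search and \<open>s 9\<close> on this round; it is recovered when
  the array shrinks.\<close>

definition part_inv :: "nat \<Rightarrow> bool \<Rightarrow> assn" where
  "part_inv v b s m \<alpha> \<longleftrightarrow> part_bounds v b s \<and> cl (klo s) < k + \<alpha> \<and> k \<le> cl (Suc (khi s)) + \<alpha> \<and>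
     split_ok (klo s) (khi s) (key True (s 13)) (k - s 1) (s 3) (s 16 + of_bool b) (s 17) (s 18) (s 19) (\<lambda>t. of_bool (b \<and> ckey s < t)) m \<alpha> \<and>
     (\<exists>f con. con + f \<le> 2 * \<alpha> \<and> 16384 * n + 96 * s 3 \<le> 96 * n + 6400 * con + s 15 + 6 * s 9 \<and>
        progress (s 9) (\<lambda>y. clampk s (key True y) \<le> key True (s 13)) (s 17 + s 18) (of_bool (b \<and> ckey s \<le> key True (s 13))) (s 16 + of_bool b) f m \<and>
        progress (s 9) (\<lambda>y. key True (s 13) \<le> clampk s (key True y)) (s 18 + s 19) (of_bool (b \<and> key True (s 13) \<le> ckey s)) (s 16 + of_bool b) f m)"

lemma part_inv_upd:
  assumes "part_inv v b s m \<alpha>"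
  shows "part_inv v b s (m(u := w')) (Suc \<alpha>)"
proof -
  have A: "part_bounds v b s" and P: "split_ok (klo s) (khi s) (key True (s 13)) (k - s 1) (s 3) (s 16 + of_bool b) (s 17) (s 18) (s 19) (\<lambda>t. of_bool (b \<and> ckey s < t)) m \<alpha>"
    and c: "cl (klo s) < k + \<alpha> \<and> k \<le> cl (Suc (khi s)) + \<alpha>"
    using assms unfolding part_inv_def by blast+
  obtain f con where f: "con + f \<le> 2 * \<alpha>" "16384 * n + 96 * s 3 \<le> 96 * n + 6400 * con + s 15 + 6 * s 9"
      "progress (s 9) (\<lambda>y. clampk s (key True y) \<le> key True (s 13)) (s 17 + s 18) (of_bool (b \<and> ckey s \<le> key True (s 13))) (s 16 + of_bool b) f m"
      "progress (s 9) (\<lambda>y. key True (s 13) \<le> clampk s (key True y)) (s 18 + s 19) (of_bool (b \<and> key True (s 13) \<le> ckey s)) (s 16 + of_bool b) f m"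
    using assms unfolding part_inv_def by blast
  have "split_ok (klo s) (khi s) (key True (s 13)) (k - s 1) (s 3) (s 16 + of_bool b) (s 17) (s 18) (s 19) (\<lambda>t. of_bool (b \<and> ckey s < t)) (m(u := w')) (Suc \<alpha>)"
    by (rule split_ok_upd[OF P]) (use A in \<open>auto simp: part_bounds_def\<close>)
  moreover have "con + Suc f \<le> 2 * Suc \<alpha>" using f(1) by simp
  moreover have "cl (klo s) < k + Suc \<alpha> \<and> k \<le> cl (Suc (khi s)) + Suc \<alpha>" using c by simp
  ultimately show ?thesis using A f(2) progress_upd[OF f(3)] progress_upd[OF f(4)] unfolding part_inv_def by blast
qed

lemma part_inv_stable: "stable (\<lambda>s m \<alpha>. B s \<and> part_inv v b (h s) m \<alpha>)"
  unfolding stable_def using part_inv_upd by blast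

lemma part_inv_regs:
  assumes "part_inv v b s m \<alpha>" "part_bounds v b' s'"
    "klo s' = klo s" "khi s' = khi s" "s' 1 = s 1" "s' 3 = s 3" "s' 9 = s 9" "s' 15 = s 15" "key True (s' 13) = key True (s 13)"
    "split_ok (klo s) (khi s) (key True (s 13)) (k - s 1) (s 3) (s 16 + of_bool b) (s 17) (s 18) (s 19) (\<lambda>t. of_bool (b \<and> ckey s < t)) m \<alpha> \<Longrightarrow>
     split_ok (klo s) (khi s) (key True (s 13)) (k - s 1) (s 3) (s' 16 + of_bool b') (s' 17) (s' 18) (s' 19) (\<lambda>t. of_bool (b' \<and> ckey s' < t)) m' \<alpha>"
    "\<And>f. progress (s 9) (\<lambda>y. clampk s (key True y) \<le> key True (s 13)) (s 17 + s 18) (of_bool (b \<and> ckey s \<le> key True (s 13))) (s 16 + of_bool b) f m \<Longrightarrow>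
      progress (s 9) (\<lambda>y. clampk s (key True y) \<le> key True (s 13)) (s' 17 + s' 18) (of_bool (b' \<and> ckey s' \<le> key True (s 13))) (s' 16 + of_bool b') f m'"
    "\<And>f. progress (s 9) (\<lambda>y. key True (s 13) \<le> clampk s (key True y)) (s 18 + s 19) (of_bool (b \<and> key True (s 13) \<le> ckey s)) (s 16 + of_bool b) f m \<Longrightarrow>
      progress (s 9) (\<lambda>y. key True (s 13) \<le> clampk s (key True y)) (s' 18 + s' 19) (of_bool (b' \<and> key True (s 13) \<le> ckey s')) (s' 16 + of_bool b') f m'"
  shows "part_inv v b' s' m' \<alpha>"
proof -
  have cl': "clampk s' = clampk s" using assms(3,4) by (simp add: clampk_def fun_eq_iff)
  have c: "cl (klo s) < k + \<alpha>" "k \<le> cl (Suc (khi s)) + \<alpha>"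
    and P: "split_ok (klo s) (khi s) (key True (s 13)) (k - s 1) (s 3) (s 16 + of_bool b) (s 17) (s 18) (s 19) (\<lambda>t. of_bool (b \<and> ckey s < t)) m \<alpha>"
    using assms(1) unfolding part_inv_def by blast+
  obtain f con where f: "con + f \<le> 2 * \<alpha>" "16384 * n + 96 * s 3 \<le> 96 * n + 6400 * con + s 15 + 6 * s 9"
      "progress (s 9) (\<lambda>y. clampk s (key True y) \<le> key True (s 13)) (s 17 + s 18) (of_bool (b \<and> ckey s \<le> key True (s 13))) (s 16 + of_bool b) f m"
      "progress (s 9) (\<lambda>y. key True (s 13) \<le> clampk s (key True y)) (s 18 + s 19) (of_bool (b \<and> key True (s 13) \<le> ckey s)) (s 16 + of_bool b) f m"
    using assms(1) unfolding part_inv_def by blast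
  show ?thesis unfolding part_inv_def assms(3-9) cl'
    using assms(2) c assms(10)[OF P] f(1,2) assms(11)[OF f(3)] assms(12)[OF f(4)] by blast
qed

lemma H_part_body:
  "H (\<lambda>s m \<alpha>. (s 16 < s 3 \<and> s 3 - s 16 = z) \<and> part_inv v False s m \<alpha>) part_body 18
     (\<lambda>s m \<alpha>. s 3 - s 16 < z \<and> part_inv v False s m \<alpha>)"
proof -
  let ?P = "\<lambda>s m \<alpha>. (s 16 < s 3 \<and> s 3 - s 16 = z) \<and> part_inv v False s m \<alpha>"
  let ?Q = "\<lambda>s m \<alpha>. s 3 - s 16 < z \<and> part_inv v False s m \<alpha>"
  let ?L = "\<lambda>s m \<alpha>. (s 16 < s 3 \<and> s 3 - s 16 = z) \<and> part_inv v True s m \<alpha>"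
  let ?C = "\<lambda>s m \<alpha>. (s 16 < s 3 \<and> s 3 - s 16 = z \<and> key True (s 20) = ckey s) \<and> part_inv v True s m \<alpha>"
  have stP: "stable ?P" and stL: "stable ?L" and stC: "stable ?C" by (rule part_inv_stable)+
  have load: "H ?P (Load 20 (R 16)) 1 ?L"
  proof (rule H_Load[OF stP])
    fix s m \<alpha>
    assume P: "?P s m \<alpha>"
    let ?s = "s(20 := m (s 16))"
    have A: "part_bounds v False s" using P unfolding part_inv_def by blast
    have ck: "ckey ?s = clampk s (key True (m (s 16)))" by (simp add: ckey_def clampk_def)
    have "part_inv v True ?s m \<alpha>"
    proof (rule part_inv_regs[OF conjunct2[OF P]])
      show "part_bounds v True ?s" using A P unfolding part_bounds_def by simp
    next
      assume "split_ok (klo s) (khi s) (key True (s 13)) (k - s 1) (s 3) (s 16 + of_bool False) (s 17) (s 18) (s 19) (\<lambda>t. of_bool (False \<and> ckey s < t)) m \<alpha>"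
      then have "split_ok (klo s) (khi s) (key True (s 13)) (k - s 1) (s 3) (s 16) (s 17) (s 18) (s 19) (\<lambda>_. 0) m \<alpha>" by simp
      from split_ok_read[OF this] show "split_ok (klo s) (khi s) (key True (s 13)) (k - s 1) (s 3) (?s 16 + of_bool True) (?s 17) (?s 18) (?s 19)
          (\<lambda>t. of_bool (True \<and> ckey ?s < t)) m \<alpha>"
        using P A unfolding ck by (simp add: clampk_def part_bounds_def)
    next
      fix f
      assume "progress (s 9) (\<lambda>y. clampk s (key True y) \<le> key True (s 13)) (s 17 + s 18) (of_bool (False \<and> ckey s \<le> key True (s 13))) (s 16 + of_bool False) f m"
      then have "progress (s 9) (\<lambda>y. clampk s (key True y) \<le> key True (s 13)) (s 17 + s 18) 0 (s 16) f m" by simp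
      from progress_read[OF this]
      show "progress (s 9) (\<lambda>y. clampk s (key True y) \<le> key True (s 13)) (?s 17 + ?s 18) (of_bool (True \<and> ckey ?s \<le> key True (s 13))) (?s 16 + of_bool True) f m"
        unfolding ck by simp
    next
      fix f
      assume "progress (s 9) (\<lambda>y. key True (s 13) \<le> clampk s (key True y)) (s 18 + s 19) (of_bool (False \<and> key True (s 13) \<le> ckey s)) (s 16 + of_bool False) f m"
      then have "progress (s 9) (\<lambda>y. key True (s 13) \<le> clampk s (key True y)) (s 18 + s 19) 0 (s 16) f m" by simp
      from progress_read[OF this]
      show "progress (s 9) (\<lambda>y. key True (s 13) \<le> clampk s (key True y)) (?s 18 + ?s 19) (of_bool (True \<and> key True (s 13) \<le> ckey ?s)) (?s 16 + of_bool True) f m"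
        unfolding ck by simp
    qed auto
    then show "?L (s(20 := m (aval w (R 16) s))) m \<alpha>" using P by simp
  qed simp
  have cla: "H ?L (clamp 20) 5 ?C"
  proof (rule H_reg[OF _ stL])
    fix s m \<alpha>
    assume wf: "wf_state w s m" and L: "?L s m \<alpha>"
    let ?s = "ev (clamp 20) s"
    have o: "?s r = s r" if "r \<noteq> 20" for r using ev_clamp_other[OF that] .
    have kl: "klo ?s = klo s" "khi ?s = khi s" unfolding klo_def khi_def by (simp_all add: o)
    have A: "part_bounds v True s" using L unfolding part_inv_def by blast
    have le: "klo s \<le> khi s" using A unfolding part_bounds_def by linarith
    have k20: "key True (?s 20) = ckey s" using key_ev_clamp[OF wf le] by (simp add: ckey_def)
    then have ck: "ckey ?s = ckey s" using clampk_idem[OF le] kl unfolding ckey_def clampk_def by simp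
    have "part_inv v True ?s m \<alpha>"
    proof (rule part_inv_regs[OF conjunct2[OF L]])
      show "part_bounds v True ?s" using A kl unfolding part_bounds_def by (simp add: o)
    qed (use kl in \<open>simp_all add: o ck\<close>)
    then show "?C ?s m \<alpha>" using L k20 ck by (simp add: o)
  qed (simp_all add: clamp_def)
  have inc: "ev (incr r) s = s(r := Suc (s r))" if "s r \<le> n" for s r
    using that n_pos by (simp add: incr_def arith_simps)
  let ?e = "Eq (R 20) (R 13)" and ?l = "Elem_le (R 20) (R 13)"
  have eq: "H (\<lambda>s m \<alpha>. ?C s m \<alpha> \<and> bval w le ?e s) (incr 18 ;; incr 16) 3 ?Q"
  proof (rule H_reg)
    show "stable (\<lambda>s m \<alpha>. ?C s m \<alpha> \<and> bval w le ?e s)" using stC unfolding stable_def by blast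
    fix s m \<alpha>
    assume a: "?C s m \<alpha> \<and> bval w le ?e s"
    then have A: "part_bounds v True s" and e: "s 20 = s 13" and P: "part_inv v True s m \<alpha>" and ck: "ckey s = key True (s 20)" unfolding part_inv_def by auto
    let ?s = "s(18 := Suc (s 18), 16 := Suc (s 16))"
    have ev: "ev (incr 18 ;; incr 16) s = ?s" using inc A by (simp add: part_bounds_def)
    have "part_inv v False ?s m \<alpha>"
    proof (rule part_inv_regs[OF P])
      show "part_bounds v False ?s" using A unfolding part_bounds_def by simp
    next
      assume "split_ok (klo s) (khi s) (key True (s 13)) (k - s 1) (s 3) (s 16 + of_bool True) (s 17) (s 18) (s 19) (\<lambda>t. of_bool (True \<and> ckey s < t)) m \<alpha>"
      then have "split_ok (klo s) (khi s) (key True (s 13)) (k - s 1) (s 3) (Suc (s 16)) (s 17) (s 18) (s 19) (\<lambda>t. of_bool (key True (s 20) < t)) m \<alpha>"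
        by (simp add: ck)
      from split_ok_eq[OF this] show "split_ok (klo s) (khi s) (key True (s 13)) (k - s 1) (s 3) (?s 16 + of_bool False) (?s 17) (?s 18) (?s 19)
          (\<lambda>t. of_bool (False \<and> ckey ?s < t)) m \<alpha>" using e by simp
    qed (auto simp: progress_def ck e)
    then show "?Q (ev (incr 18 ;; incr 16) s) m \<alpha>" unfolding ev using a by auto
  qed (simp_all add: incr_def)
  let ?hl = "\<lambda>s. s(17 := Suc (s 17), 16 := Suc (s 16))"
  let ?Jl = "\<lambda>s m \<alpha>. (s 17 \<le> n \<and> s 16 \<le> n \<and> s 3 - Suc (s 16) < z) \<and> part_inv v False (?hl s) m \<alpha>"
  have stl: "H (\<lambda>s m \<alpha>. (?C s m \<alpha> \<and> \<not> bval w le ?e s) \<and> bval w le ?l s) (Store (R 17) (R 20)) 1 ?Jl"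
  proof (rule H_Store)
    show "stable (\<lambda>s m \<alpha>. (?C s m \<alpha> \<and> \<not> bval w le ?e s) \<and> bval w le ?l s)" using stC unfolding stable_def by blast
    fix s m \<alpha>
    assume wf: "wf_state w s m" and a: "(?C s m \<alpha> \<and> \<not> bval w le ?e s) \<and> bval w le ?l s"
    then have A: "part_bounds v True s" and P: "part_inv v True s m \<alpha>" and ck: "ckey s = key True (s 20)" unfolding part_inv_def by auto
    have "key True (s 20) \<le> key True (s 13)" using a Elem_le_key[OF wf, of 20 13] by simp
    moreover have "key True (s 20) \<noteq> key True (s 13)" using a key_inj[of "s 20" "s 13"] wf unfolding wf_state_def by simp
    ultimately have lt: "key True (s 20) < key True (s 13)" by simp
    let ?s = "?hl s" and ?m = "m(s 17 := s 20)"
    have q: "s 17 < Suc (s 16)" "s 17 < n" using A unfolding part_bounds_def by auto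
    have "part_inv v False ?s ?m \<alpha>"
    proof (rule part_inv_regs[OF P])
      show "part_bounds v False ?s" using A unfolding part_bounds_def by simp
    next
      assume "split_ok (klo s) (khi s) (key True (s 13)) (k - s 1) (s 3) (s 16 + of_bool True) (s 17) (s 18) (s 19) (\<lambda>t. of_bool (True \<and> ckey s < t)) m \<alpha>"
      then have "split_ok (klo s) (khi s) (key True (s 13)) (k - s 1) (s 3) (Suc (s 16)) (s 17) (s 18) (s 19) (\<lambda>t. of_bool (key True (s 20) < t)) m \<alpha>"
        by (simp add: ck)
      from split_ok_low[OF this lt q] show "split_ok (klo s) (khi s) (key True (s 13)) (k - s 1) (s 3) (?s 16 + of_bool False) (?s 17) (?s 18) (?s 19)
          (\<lambda>t. of_bool (False \<and> ckey ?s < t)) ?m \<alpha>" by simp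
    qed (use lt q in \<open>auto simp: progress_def ck\<close>)
    then show "?Jl s (m(aval w (R 17) s := aval w (R 20) s)) \<alpha>" using a A by (auto simp: part_bounds_def)
  qed simp
  have stJl: "stable ?Jl" by (rule part_inv_stable)
  have incl: "H ?Jl (incr 17 ;; incr 16) 3 ?Q"
    by (rule H_reg[OF _ stJl]) (auto simp: inc, simp_all add: incr_def)
  let ?hh = "\<lambda>s. s(19 := Suc (s 19), 16 := Suc (s 16))"
  let ?Jh = "\<lambda>s m \<alpha>. (s 19 \<le> n \<and> s 16 \<le> n \<and> s 3 - Suc (s 16) < z) \<and> part_inv v False (?hh s) m \<alpha>"
  have sth: "H (\<lambda>s m \<alpha>. (?C s m \<alpha> \<and> \<not> bval w le ?e s) \<and> \<not> bval w le ?l s) (Store (Plus (R 0) (R 19)) (R 20)) 1 ?Jh"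
  proof (rule H_Store)
    show "stable (\<lambda>s m \<alpha>. (?C s m \<alpha> \<and> \<not> bval w le ?e s) \<and> \<not> bval w le ?l s)" using stC unfolding stable_def by blast
    fix s m \<alpha>
    assume wf: "wf_state w s m" and a: "(?C s m \<alpha> \<and> \<not> bval w le ?e s) \<and> \<not> bval w le ?l s"
    then have A: "part_bounds v True s" and P: "part_inv v True s m \<alpha>" and ck: "ckey s = key True (s 20)" unfolding part_inv_def by auto
    have lt: "key True (s 13) < key True (s 20)" using a Elem_le_key[OF wf, of 20 13] by simp
    let ?s = "?hh s" and ?m = "m(n + s 19 := s 20)"
    have addr: "aval w (Plus (R 0) (R 19)) s = n + s 19" using A n_pos unfolding part_bounds_def by (simp add: arith_simps)
    have q: "s 17 \<le> n" "s 3 \<le> n" "s 9 \<le> n" using A unfolding part_bounds_def by auto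
    have "part_inv v False ?s ?m \<alpha>"
    proof (rule part_inv_regs[OF P])
      show "part_bounds v False ?s" using A unfolding part_bounds_def by simp
    next
      assume "split_ok (klo s) (khi s) (key True (s 13)) (k - s 1) (s 3) (s 16 + of_bool True) (s 17) (s 18) (s 19) (\<lambda>t. of_bool (True \<and> ckey s < t)) m \<alpha>"
      then have "split_ok (klo s) (khi s) (key True (s 13)) (k - s 1) (s 3) (Suc (s 16)) (s 17) (s 18) (s 19) (\<lambda>t. of_bool (key True (s 20) < t)) m \<alpha>"
        by (simp add: ck)
      from split_ok_high[OF this lt q(1,2)] show "split_ok (klo s) (khi s) (key True (s 13)) (k - s 1) (s 3) (?s 16 + of_bool False) (?s 17) (?s 18) (?s 19)
          (\<lambda>t. of_bool (False \<and> ckey ?s < t)) ?m \<alpha>" by simp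
    qed (use lt q in \<open>auto simp: progress_def ck\<close>)
    then show "?Jh s (m(aval w (Plus (R 0) (R 19)) s := aval w (R 20) s)) \<alpha>" unfolding addr using a A by (auto simp: part_bounds_def)
  qed simp
  have stJh: "stable ?Jh" by (rule part_inv_stable)
  have inch: "H ?Jh (incr 19 ;; incr 16) 3 ?Q"
    by (rule H_reg[OF _ stJh]) (auto simp: inc, simp_all add: incr_def)
  have stne: "stable (\<lambda>s m \<alpha>. ?C s m \<alpha> \<and> \<not> bval w le ?e s)" using stC unfolding stable_def by blast
  have ne: "H (\<lambda>s m \<alpha>. ?C s m \<alpha> \<and> \<not> bval w le ?e s)
      (If ?l (Store (R 17) (R 20) ;; (incr 17 ;; incr 16)) (Store (Plus (R 0) (R 19)) (R 20) ;; (incr 19 ;; incr 16))) 6 ?Q"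
    by (rule H_If[OF stne H_seq[OF stl stJl incl] H_seq[OF sth stJh inch]]) auto
  have "H ?C (If ?e (incr 18 ;; incr 16)
      (If ?l (Store (R 17) (R 20) ;; (incr 17 ;; incr 16)) (Store (Plus (R 0) (R 19)) (R 20) ;; (incr 19 ;; incr 16)))) 7 ?Q"
    by (rule H_If[OF stC eq ne]) auto
  from H_seq[OF load stL H_seq[OF cla stC this]] show ?thesis unfolding part_body_def by (elim H_time) simp
qed

lemma H_part_loop:
  "H (\<lambda>s m \<alpha>. (s 8 = s 9 \<and> s 8 = v) \<and> returning (s(15 := s 15 + s 8)) m \<alpha>) part_loop (160 * v + 20)
     (\<lambda>s m \<alpha>. s 16 = s 3 \<and> part_inv v False s m \<alpha>)"
proof -
  let ?P = "\<lambda>s m \<alpha>. (s 8 = s 9 \<and> s 8 = v) \<and> returning (s(15 := s 15 + s 8)) m \<alpha>"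
  let ?I = "\<lambda>s m \<alpha>. part_inv v False s m \<alpha>"
  have st: "stable ?I" using part_inv_stable[where B = "\<lambda>_. True" and h = "\<lambda>s. s"] by simp
  have stP: "stable ?P" using returning_stable[where h = "\<lambda>s. s(15 := s 15 + s 8)"] unfolding stable_def by blast
  let ?i = "clamp 13 ;; Assign 16 (N 0) ;; Assign 17 (N 0) ;; Assign 18 (N 0) ;; Assign 19 (N 0)"
  have init: "H ?P ?i 13 (\<lambda>s m \<alpha>. ?I s m \<alpha> \<and> s 3 - s 16 \<le> 8 * v)"
  proof (rule H_reg[OF _ stP])
    fix s m \<alpha>
    assume wf: "wf_state w s m" and P: "?P s m \<alpha>"
    let ?t = "s(15 := s 15 + s 8)"
    have c: "core (good ?t) 0 ?t m \<alpha>" using P unfolding returning_def by blast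
    then obtain f fs con where f: "good ?t f (snd (hd fs)) m" "stk (s 9) (s 8) (s 10) (s 11) fs m"
       "con + f + total fs \<le> 2 * \<alpha>" "16384 * n + pot (s 3) (s 8) fs \<le> 96 * n + 6400 * con + (s 15 + s 8)"
      and c': "s 0 = n" "outer (s 3) (s 1) (klo s) (khi s) m \<alpha>" "s 9 \<le> s 3" "s 3 < 8 * s 9"
      unfolding core_def by auto
    have s89: "s 8 = s 9" using P by blast
    obtain i g where fs: "fs = [(i, g)]" and b: "s 10 = 8 * s 8"
      using f(2) s89 by (cases "(s 9, s 8, s 10, s 11, fs, m)" rule: stk.cases) auto
    note T = c'(2)[unfolded outer_def]
    have le: "klo s \<le> khi s" using T by blast
    define y where "y = ev (clamp 13) s 13"
    have ky: "key True y = clampk s (key True (s 13))" unfolding y_def by (rule key_ev_clamp[OF wf le]) simp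
    define s' where "s' = s(13 := y, 16 := 0, 17 := 0, 18 := 0, 19 := 0)"
    have "ev (clamp 13) s = s(13 := y)" unfolding y_def using ev_clamp_other[of _ 13 s] by (auto simp: fun_eq_iff)
    then have ev: "ev ?i s = s'" by (simp add: s'_def aval.simps del: ev.simps(1) flip: fun_upd_def)
        (simp add: aval.simps)
    have kl: "klo s' = klo s" "khi s' = khi s" by (simp_all add: s'_def)
    have clk: "clampk s' = clampk s" using kl by (simp add: clampk_def fun_eq_iff)
    have \<pi>: "klo s \<le> key True y" "key True y \<le> khi s" using clampk_bounds[OF le] ky by auto
    have r: "s' 0 = s 0" "s' 1 = s 1" "s' 3 = s 3" "s' 9 = s 9" "s' 13 = y" "s' 15 = s 15" "s' 16 = 0" "s' 17 = 0" "s' 18 = 0" "s' 19 = 0"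
      by (simp_all add: s'_def)
    have "part_bounds v False s'" unfolding part_bounds_def r kl using c' T \<pi> P by auto
    moreover have "split_ok (klo s) (khi s) (key True y) (k - s 1) (s 3) (0 + of_bool False) 0 0 0 (\<lambda>t. of_bool (False \<and> ckey s' < t)) m \<alpha>"
      unfolding split_ok_def near_def using T \<pi> by auto
    moreover have "con + g \<le> 2 * \<alpha>" using f(3) fs by (simp add: total_def)
    moreover have "16384 * n + 96 * s 3 \<le> 96 * n + 6400 * con + s 15 + 6 * s 9"
      using f(4) c'(3) s89 fs by simp
    moreover have quota: "s 9 \<le> 8 * (cnt m 0 (s 9) (at_most d (key d (s 13))) + g)" for d
    proof -
      have "snd (hd fs) = g" using fs by simp
      then show ?thesis using f(1)[unfolded good_def, rule_format, of d] b s89 by simp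
    qed
    have "progress (s 9) (\<lambda>x. clampk s (key True x) \<le> key True y) (0 + 0) (of_bool (False \<and> ckey s' \<le> key True y)) (0 + of_bool False) g m"
    proof -
      \<comment> \<open>Clipping is monotone, so the elements at most the original pivot remain at
        most the clipped one; likewise below for the reversed order.\<close>
      have "cnt m 0 (s 9) (at_most True (key True (s 13))) \<le> cnt m 0 (s 9) (\<lambda>x. clampk s (key True x) \<le> key True y)"
        by (rule cnt_mono) (auto simp: ky clampk_def)
      then have "8 * (cnt m 0 (s 9) (at_most True (key True (s 13))) + g) \<le> 8 * (cnt m 0 (s 9) (\<lambda>x. clampk s (key True x) \<le> key True y) + g)"
        by simp
      then show ?thesis using quota[of True] unfolding progress_def by simp
    qed
    moreover have "progress (s 9) (\<lambda>x. key True y \<le> clampk s (key True x)) (0 + 0) (of_bool (False \<and> key True y \<le> ckey s')) (0 + of_bool False) g m"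
    proof -
      have "cnt m 0 (s 9) (at_most False (key False (s 13))) \<le> cnt m 0 (s 9) (\<lambda>x. key True y \<le> clampk s (key True x))"
        by (rule cnt_mono) (auto simp: ky clampk_def key_rev)
      then have "8 * (cnt m 0 (s 9) (at_most False (key False (s 13))) + g) \<le> 8 * (cnt m 0 (s 9) (\<lambda>x. key True y \<le> clampk s (key True x)) + g)"
        by simp
      then show ?thesis using quota[of False] unfolding progress_def by simp
    qed
    ultimately have "part_inv v False s' m \<alpha>" unfolding part_inv_def r kl clk using T by auto
    moreover have "s 3 \<le> 8 * v" using c'(4) P by simp
    ultimately show "?I (ev ?i s) m \<alpha> \<and> ev ?i s 3 - ev ?i s 16 \<le> 8 * v" unfolding ev by (simp add: r)
  qed (simp_all add: clamp_def)
  let ?b = "Less (R 16) (R 3)"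
  have loop: "H (\<lambda>s m \<alpha>. ?I s m \<alpha> \<and> s 3 - s 16 \<le> 8 * v) (While ?b part_body) (8 * v * (18 + 2) + 1)
     (\<lambda>s m \<alpha>. ?I s m \<alpha> \<and> \<not> bval w le ?b s)"
  proof (rule H_for[OF st _ _ le_refl])
    fix z
    show "H (\<lambda>s m \<alpha>. ?I s m \<alpha> \<and> bval w le ?b s \<and> s 3 - s 16 = z) part_body 18
      (\<lambda>s m \<alpha>. ?I s m \<alpha> \<and> s 3 - s 16 < z)"
      by (rule H_conseq[OF H_part_body[of z v]]) auto
  qed auto
  have fin: "H (\<lambda>s m \<alpha>. ?I s m \<alpha> \<and> s 3 - s 16 \<le> 8 * v) (While ?b part_body) (160 * v + 1) (\<lambda>s m \<alpha>. s 16 = s 3 \<and> part_inv v False s m \<alpha>)"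
    by (rule H_conseq[OF loop]) (auto simp: part_inv_def part_bounds_def)
  have stI: "stable (\<lambda>s m \<alpha>. ?I s m \<alpha> \<and> s 3 - s 16 \<le> 8 * v)" using st unfolding stable_def by blast
  show ?thesis unfolding part_loop_def by (rule H_Seq[OF init stI fin]) simp
qed

section \<open>Moving the upper part from the buffer to the front\<close>

definition copy_inv :: "nat \<Rightarrow> bool \<Rightarrow> assn" where
  "copy_inv v b s m \<alpha> \<longleftrightarrow> (s 0 = n \<and> s 16 + of_bool b \<le> s 3 \<and> 1 \<le> s 1 \<and> s 1 \<le> s 3 \<and> s 1 \<le> k \<and> s 3 \<le> n \<and> klo s \<le> khi s \<and> s 3 \<le> 8 * v) \<and>
     cl (klo s) < k + \<alpha> \<and> k \<le> cl (Suc (khi s)) + \<alpha> \<and>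
     (\<forall>t. klo s < t \<longrightarrow> t \<le> khi s \<longrightarrow>
        near (cl t) (k - s 1 + cnt m 0 (s 16) (under t) + cnt m (n + (s 16 + of_bool b)) (n + s 3) (under t) +
          of_bool (b \<and> key True (s 20) < t)) \<alpha>) \<and>
     (\<exists>con\<le>2 * \<alpha>. 16384 * n + 96 * s 3 \<le> 96 * n + 6400 * con + s 15)"

lemma copy_inv_upd: "copy_inv v b s m \<alpha> \<Longrightarrow> copy_inv v b s (m(u := x)) (Suc \<alpha>)"
  unfolding copy_inv_def
proof (elim conjE, intro conjI allI impI, goal_cases)
  case (11 t)
  then show ?case by (intro near2_upd) auto
next
  case 12
  then show ?case by (metis le_SucI mult_Suc_right trans_le_add2)
qed auto

lemma copy_inv_stable: "stable (\<lambda>s m \<alpha>. B s \<and> copy_inv v b (h s) m \<alpha>)"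
  unfolding stable_def using copy_inv_upd by blast

lemma H_copy_high:
  "H (\<lambda>s m \<alpha>. copy_inv v False (s(16 := 0)) m \<alpha>) copy_high (64 * v + 3) (\<lambda>s m \<alpha>. s 3 \<le> 8 * v \<and> staged s m \<alpha>)"
proof -
  let ?b = "Less (R 16) (R 3)"
  let ?c = "Load 20 (Plus (R 0) (R 16)) ;; Store (R 16) (R 20) ;; incr 16"
  have st: "stable (copy_inv v False)" using copy_inv_stable[where B = "\<lambda>_. True" and h = "\<lambda>s. s"] by simp
  have body: "H (\<lambda>s m \<alpha>. copy_inv v False s m \<alpha> \<and> bval w le ?b s \<and> s 3 - s 16 = z) ?c 5 (\<lambda>s m \<alpha>. copy_inv v False s m \<alpha> \<and> s 3 - s 16 < z)" for z
  proof -
    let ?L = "\<lambda>s m \<alpha>. (s 16 < s 3 \<and> s 3 - s 16 = z) \<and> copy_inv v True s m \<alpha>"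
    let ?h = "\<lambda>s. s(16 := Suc (s 16))"
    let ?J = "\<lambda>s m \<alpha>. (s 16 \<le> n \<and> s 3 - Suc (s 16) < z) \<and> copy_inv v False (?h s) m \<alpha>"
    have stL: "stable ?L" and stJ: "stable ?J" by (rule copy_inv_stable)+
    have load: "H (\<lambda>s m \<alpha>. copy_inv v False s m \<alpha> \<and> bval w le ?b s \<and> s 3 - s 16 = z) (Load 20 (Plus (R 0) (R 16))) 1 ?L"
    proof (rule H_Load)
      show "stable (\<lambda>s m \<alpha>. copy_inv v False s m \<alpha> \<and> bval w le ?b s \<and> s 3 - s 16 = z)" using st unfolding stable_def by blast
      fix s m \<alpha>
      assume a: "copy_inv v False s m \<alpha> \<and> bval w le ?b s \<and> s 3 - s 16 = z"
      then have C: "copy_inv v False s m \<alpha>" and q: "s 16 < s 3" by auto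
      have "s 0 = n" "s 3 \<le> n" using C unfolding copy_inv_def by auto
      then have addr: "aval w (Plus (R 0) (R 16)) s = n + s 16" using q n_pos by (simp add: arith_simps)
      have "cnt m (n + s 16) (n + s 3) P = of_bool (P (m (n + s 16))) + cnt m (n + Suc (s 16)) (n + s 3) P" for P
        using cnt_first[of "n + s 16" "n + s 3" m P] q by simp
      then have eq: "k - s 1 + cnt m 0 (s 16) P + cnt m (n + s 16) (n + s 3) P =
          k - s 1 + cnt m 0 (s 16) P + cnt m (n + Suc (s 16)) (n + s 3) P + of_bool (P (m (n + s 16)))" for P by simp
      have nr: "near (cl t) (k - s 1 + cnt m 0 (s 16) (under t) + cnt m (n + Suc (s 16)) (n + s 3) (under t) +
          of_bool (key True (m (n + s 16)) < t)) \<alpha>" if "klo s < t" "t \<le> khi s" for t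
      proof -
        have "near (cl t) (k - s 1 + cnt m 0 (s 16) (under t) + cnt m (n + (s 16 + of_bool False)) (n + s 3) (under t) +
          of_bool (False \<and> key True (s 20) < t)) \<alpha>" using C that unfolding copy_inv_def by blast
        then have "near (cl t) (k - s 1 + cnt m 0 (s 16) (under t) + cnt m (n + s 16) (n + s 3) (under t)) \<alpha>" by simp
        then show ?thesis unfolding eq .
      qed
      have "copy_inv v True (s(20 := m (n + s 16))) m \<alpha>" using C q nr unfolding copy_inv_def by simp
      then show "?L (s(20 := m (aval w (Plus (R 0) (R 16)) s))) m \<alpha>" unfolding addr using q a by simp
    qed simp
    have store: "H ?L (Store (R 16) (R 20)) 1 ?J"
    proof (rule H_Store[OF stL])
      fix s m \<alpha>
      assume a: "?L s m \<alpha>"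
      let ?m = "m(s 16 := s 20)"
      have q: "s 16 < n" using a unfolding copy_inv_def by auto
      have "cnt ?m 0 (Suc (s 16)) P = cnt m 0 (s 16) P + of_bool (P (s 20))"
        "cnt ?m (n + Suc (s 16)) (n + s 3) P = cnt m (n + Suc (s 16)) (n + s 3) P" for P
        using cnt_store_end[of 0 "s 16" m "s 20" P] q by simp_all
      then have eq: "k - s 1 + cnt ?m 0 (Suc (s 16)) P + cnt ?m (n + Suc (s 16)) (n + s 3) P =
          k - s 1 + cnt m 0 (s 16) P + cnt m (n + Suc (s 16)) (n + s 3) P + of_bool (P (s 20))" for P by simp
      have nr: "near (cl t) (k - s 1 + cnt ?m 0 (Suc (s 16)) (under t) + cnt ?m (n + Suc (s 16)) (n + s 3) (under t)) \<alpha>"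
        if "klo s < t" "t \<le> khi s" for t
      proof -
        have "near (cl t) (k - s 1 + cnt m 0 (s 16) (under t) + cnt m (n + (s 16 + of_bool True)) (n + s 3) (under t) +
          of_bool (True \<and> key True (s 20) < t)) \<alpha>" using a that unfolding copy_inv_def by blast
        then have "near (cl t) (k - s 1 + cnt m 0 (s 16) (under t) + cnt m (n + Suc (s 16)) (n + s 3) (under t) +
          of_bool (key True (s 20) < t)) \<alpha>" by simp
        then show ?thesis unfolding eq .
      qed
      have "copy_inv v False (?h s) ?m \<alpha>" using a nr unfolding copy_inv_def by simp
      then show "?J s (m(aval w (R 16) s := aval w (R 20) s)) \<alpha>" using a q by auto
    qed simp
    have inc: "H ?J (incr 16) 1 (\<lambda>s m \<alpha>. copy_inv v False s m \<alpha> \<and> s 3 - s 16 < z)"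
    proof (rule H_reg[OF _ stJ])
      fix s m \<alpha>
      assume a: "?J s m \<alpha>"
      have "ev (incr 16) s = ?h s" using a n_pos by (simp add: incr_def arith_simps)
      then show "copy_inv v False (ev (incr 16) s) m \<alpha> \<and> ev (incr 16) s 3 - ev (incr 16) s 16 < z" using a by simp
    qed (simp_all add: incr_def)
    show ?thesis by (rule H_time[OF H_seq[OF load stL H_seq[OF store stJ inc]]]) simp
  qed
  have loop: "H (\<lambda>s m \<alpha>. copy_inv v False s m \<alpha> \<and> s 3 - s 16 \<le> 8 * v) (While ?b ?c) (8 * v * (5 + 2) + 1)
     (\<lambda>s m \<alpha>. copy_inv v False s m \<alpha> \<and> \<not> bval w le ?b s)"
    by (rule H_for[OF st body _ le_refl]) auto
  have init: "H (\<lambda>s m \<alpha>. copy_inv v False (s(16 := 0)) m \<alpha>) (Assign 16 (N 0)) 1 (\<lambda>s m \<alpha>. copy_inv v False s m \<alpha> \<and> s 3 - s 16 \<le> 8 * v)"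
  proof (rule H_Assign)
    show "stable (\<lambda>s m \<alpha>. copy_inv v False (s(16 := 0)) m \<alpha>)"
      using copy_inv_stable[where B = "\<lambda>_. True" and h = "\<lambda>s. s(16 := 0)"] by simp
    fix s m \<alpha>
    assume C: "copy_inv v False (s(16 := 0)) m \<alpha>"
    then have "(s(16 := 0)) 3 \<le> 8 * v" unfolding copy_inv_def by blast
    with C show "copy_inv v False (s(16 := aval w (N 0) s)) m \<alpha> \<and> (s(16 := aval w (N 0) s)) 3 - (s(16 := aval w (N 0) s)) 16 \<le> 8 * v"
      by (simp add: aval.simps)
  qed simp
  have stI: "stable (\<lambda>s m \<alpha>. copy_inv v False s m \<alpha> \<and> s 3 - s 16 \<le> 8 * v)" using st unfolding stable_def by blast
  show ?thesis
    unfolding copy_high_def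
  proof (rule H_Seq[OF init stI H_post[OF loop]])
    fix s m \<alpha>
    assume a: "copy_inv v False s m \<alpha> \<and> \<not> bval w le ?b s"
    then have "s 16 = s 3" unfolding copy_inv_def by auto
    then show "s 3 \<le> 8 * v \<and> staged s m \<alpha>" using a unfolding copy_inv_def staged_def outer_def near_def
      by (simp del: Nat.add_diff_assoc2)
  qed simp
qed

text \<open>The values of \<open>cl\<close> are the strict rank and the rank of the answer: the
  inequalities make the positions it occupies among the sorted input meet the admissible range. The
  alternative \<open>n \<le> \<alpha>\<close> is the case without fuel, where every rank is
  admissible.\<close>

definition answered :: assn where
  "answered s m \<alpha> \<longleftrightarrow> n \<le> \<alpha> \<or> cl (key True (s 13)) < k + \<alpha> \<and> k \<le> cl (Suc (key True (s 13))) + \<alpha>"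

lemma answered_stable: "stable (\<lambda>s m \<alpha>. B s \<and> answered s m \<alpha>)"
  unfolding stable_def answered_def by auto

definition main_inv :: assn where
  "main_inv s m \<alpha> \<longleftrightarrow> ready s m \<alpha> \<or> returning s m \<alpha> \<or> 2 \<le> s 14 \<and> answered s m \<alpha>"

lemma H_partition:
  "H (\<lambda>s m \<alpha>. (s 8 = s 9 \<and> s 8 = v) \<and> returning (s(15 := s 15 + s 8)) m \<alpha>) partition (300 * v + 80) main_inv"
proof -
  let ?P = "\<lambda>s m \<alpha>. s 16 = s 3 \<and> part_inv v False s m \<alpha>"
  have st: "stable ?P" by (rule part_inv_stable)
  have info: "s 0 = n" "s 17 + s 18 + s 19 = s 3" "1 \<le> s 1" "s 1 \<le> s 3" "s 1 \<le> k" "s 3 \<le> n" "s 3 < 8 * v"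
      "klo s \<le> key True (s 13)" "key True (s 13) \<le> khi s" "cl (klo s) < k + \<alpha>" "k \<le> cl (Suc (khi s)) + \<alpha>"
      "\<And>t. klo s < t \<Longrightarrow> t \<le> khi s \<Longrightarrow> t \<le> key True (s 13) \<Longrightarrow> near (cl t) (k - s 1 + cnt m 0 (s 17) (under t)) \<alpha>"
      "\<And>t. klo s < t \<Longrightarrow> t \<le> khi s \<Longrightarrow> key True (s 13) < t \<Longrightarrow>
         near (cl t) (k - s 1 + s 17 + s 18 + cnt m n (n + s 19) (under t)) \<alpha>"
      "s 17 < s 1 \<Longrightarrow> cl (key True (s 13)) < k + \<alpha>"
      "s 1 \<le> s 17 + s 18 \<Longrightarrow> k \<le> cl (Suc (key True (s 13))) + \<alpha>"
      "\<exists>con\<le>2 * \<alpha>. 16384 * n + 96 * s 17 \<le> 96 * n + 6400 * con + s 15"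
      "\<exists>con\<le>2 * \<alpha>. 16384 * n + 96 * s 19 \<le> 96 * n + 6400 * con + s 15"
    if P: "?P s m \<alpha>" for s m \<alpha>
  proof -
    have A: "part_bounds v False s" and c: "cl (klo s) < k + \<alpha>" "k \<le> cl (Suc (khi s)) + \<alpha>"
      and T: "split_ok (klo s) (khi s) (key True (s 13)) (k - s 1) (s 3) (s 16 + of_bool False) (s 17) (s 18) (s 19) (\<lambda>t. of_bool (False \<and> ckey s < t)) m \<alpha>"
      using P unfolding part_inv_def by blast+
    have q: "s 16 = s 3" using P by blast
    show "s 0 = n" "s 17 + s 18 + s 19 = s 3" "1 \<le> s 1" "s 1 \<le> s 3" "s 1 \<le> k" "s 3 \<le> n" "s 3 < 8 * v"
      "klo s \<le> key True (s 13)" "key True (s 13) \<le> khi s" using A q unfolding part_bounds_def by simp_all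
    then have kk: "1 \<le> s 1" "s 1 \<le> k" and \<pi>: "klo s \<le> key True (s 13)" "key True (s 13) \<le> khi s" and sm: "s 17 + s 18 + s 19 = s 3" by blast+
    show "cl (klo s) < k + \<alpha>" "k \<le> cl (Suc (khi s)) + \<alpha>" by (rule c)+
    show "near (cl t) (k - s 1 + cnt m 0 (s 17) (under t)) \<alpha>" if "klo s < t" "t \<le> khi s" "t \<le> key True (s 13)" for t
      using T that q unfolding split_ok_def by simp
    show "near (cl t) (k - s 1 + s 17 + s 18 + cnt m n (n + s 19) (under t)) \<alpha>"
      if "klo s < t" "t \<le> khi s" "key True (s 13) < t" for t
      using T that q unfolding split_ok_def by simp
    \<comment> \<open>A pivot at the lower end inherits the bound known for \<open>klo\<close>.
      Otherwise the bound rests on the reliable size of the lower part.\<close>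
    show "cl (key True (s 13)) < k + \<alpha>" if "s 17 < s 1"
    proof (cases "klo s < key True (s 13)")
      case True
      then have "cl (key True (s 13)) \<le> k - s 1 + s 17 + \<alpha>" using T q unfolding split_ok_def by simp
      then show ?thesis using that kk by linarith
    qed (use c \<pi> in simp)
    show "k \<le> cl (Suc (key True (s 13))) + \<alpha>" if "s 1 \<le> s 17 + s 18"
    proof (cases "key True (s 13) < khi s")
      case True
      then have "k - s 1 + s 17 + s 18 \<le> cl (Suc (key True (s 13))) + \<alpha>" using T q unfolding split_ok_def by simp
      then show ?thesis using that kk by linarith
    qed (use c \<pi> in simp)
    obtain f con where f: "con + f \<le> 2 * \<alpha>" "16384 * n + 96 * s 3 \<le> 96 * n + 6400 * con + s 15 + 6 * s 9"
        "progress (s 9) (\<lambda>y. clampk s (key True y) \<le> key True (s 13)) (s 17 + s 18) (of_bool (False \<and> ckey s \<le> key True (s 13))) (s 16 + of_bool False) f m"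
        "progress (s 9) (\<lambda>y. key True (s 13) \<le> clampk s (key True y)) (s 18 + s 19) (of_bool (False \<and> key True (s 13) \<le> ckey s)) (s 16 + of_bool False) f m"
      using P unfolding part_inv_def by blast
    have "s 9 \<le> s 16 + of_bool False" using A q unfolding part_bounds_def by simp
    then have g: "s 9 \<le> 8 * (s 17 + s 18 + f)" "s 9 \<le> 8 * (s 18 + s 19 + f)"
      using f(3,4) unfolding progress_def by simp_all
    \<comment> \<open>Whichever part is kept, the rest of the array has at least
      \<open>s 9 / 8 - f\<close> elements, worth \<open>12 * s 9\<close> units up to
      \<open>96 * f\<close>. This recovers the \<open>6 * s 9\<close> spent; the \<open>f\<close>
      corruptions are moved into \<open>con\<close>.\<close>
    have "16384 * n + 96 * s 17 \<le> 96 * n + 6400 * (con + f) + s 15" "16384 * n + 96 * s 19 \<le> 96 * n + 6400 * (con + f) + s 15"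
      using f(2) g sm unfolding distrib_left by linarith+
    then show "\<exists>con\<le>2 * \<alpha>. 16384 * n + 96 * s 17 \<le> 96 * n + 6400 * con + s 15"
      "\<exists>con\<le>2 * \<alpha>. 16384 * n + 96 * s 19 \<le> 96 * n + 6400 * con + s 15" using f(1) by blast+
  qed
  have stS: "stable (\<lambda>s m \<alpha>. s 3 \<le> 8 * v \<and> staged s m \<alpha>)" by (rule stable_STG)
  have new: "H (\<lambda>s m \<alpha>. s 3 \<le> 8 * v \<and> staged s m \<alpha>) new_stage (24 * v + 12) main_inv"
    by (rule H_conseq[OF H_new_stage]) (auto simp: main_inv_def)
  let ?c1 = "Not (Less (R 17) (R 1))" and ?c2 = "Less (Plus (R 17) (R 18)) (R 1)"
  have st1: "stable (\<lambda>s m \<alpha>. ?P s m \<alpha> \<and> bval w le ?c1 s)" and stn: "stable (\<lambda>s m \<alpha>. ?P s m \<alpha> \<and> \<not> bval w le ?c1 s)"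
    and st2: "stable (\<lambda>s m \<alpha>. (?P s m \<alpha> \<and> \<not> bval w le ?c1 s) \<and> bval w le ?c2 s)"
    and st3: "stable (\<lambda>s m \<alpha>. (?P s m \<alpha> \<and> \<not> bval w le ?c1 s) \<and> \<not> bval w le ?c2 s)"
    using st unfolding stable_def by blast+
  let ?low = "Assign 5 (R 13) ;; Assign 7 (N 1) ;; Assign 3 (R 17)"
  have low: "H (\<lambda>s m \<alpha>. ?P s m \<alpha> \<and> bval w le ?c1 s) ?low 5 (\<lambda>s m \<alpha>. s 3 \<le> 8 * v \<and> staged s m \<alpha>)"
  proof (rule H_reg[OF _ st1])
    fix s m \<alpha>
    assume a: "?P s m \<alpha> \<and> bval w le ?c1 s"
    note I = info[OF conjunct1[OF a]]
    have g: "s 1 \<le> s 17" using a by simp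
    let ?s = "s(5 := s 13, 7 := 1, 3 := s 17)"
    have ev: "ev ?low s = ?s" using n_pos by (simp add: arith_simps)
    have kl: "klo ?s = klo s" "khi ?s = key True (s 13)" by (simp_all add: klo_def khi_def)
    \<comment> \<open>Since \<open>s 1 \<le> s 17\<close>, the pivot itself is not too small as an
      answer, which is what \<open>outer\<close> demands of an upper end.\<close>
    have "outer (s 17) (s 1) (klo s) (key True (s 13)) m \<alpha>"
      unfolding outer_def using I g by (auto simp: near_def)
    then have "staged ?s m \<alpha>" unfolding staged_def kl using I by simp
    then show "ev ?low s 3 \<le> 8 * v \<and> staged (ev ?low s) m \<alpha>" unfolding ev using I(2,7) by simp
  qed simp_all
  let ?high = "Assign 4 (R 13) ;; Assign 6 (N 1) ;; Assign 1 (Minus (R 1) (Plus (R 17) (R 18))) ;; Assign 3 (R 19)"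
  have t2: "aval w (Plus (R 17) (R 18)) s = s 17 + s 18" if "?P s m \<alpha>" for s m \<alpha>
    using info(2,6)[OF that] n_pos by (simp add: arith_simps)
  have high: "H (\<lambda>s m \<alpha>. (?P s m \<alpha> \<and> \<not> bval w le ?c1 s) \<and> bval w le ?c2 s) ?high 7 (\<lambda>s m \<alpha>. copy_inv v False (s(16 := 0)) m \<alpha>)"
  proof (rule H_reg[OF _ st2])
    fix s m \<alpha>
    assume wf: "wf_state w s m" and a: "(?P s m \<alpha> \<and> \<not> bval w le ?c1 s) \<and> bval w le ?c2 s"
    then have P: "?P s m \<alpha>" by blast
    note I = info[OF P]
    have g: "s 17 + s 18 < s 1" using a t2[OF P] by simp
    let ?s = "s(4 := s 13, 6 := 1, 1 := s 1 - (s 17 + s 18), 3 := s 19)"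
    have "s 1 < 2 ^ w" using wf unfolding wf_state_def by blast
    moreover have "aval w (Plus (R 17) (R 18)) (s(4 := s 13, 6 := 1)) = s 17 + s 18"
      using I(2,6) n_pos by (simp add: arith_simps)
    ultimately have ev: "ev ?high s = ?s" using n_pos g by (simp add: aval_Minus aval_N small_n)
    have kl: "klo (?s(16 := 0)) = key True (s 13)" "khi (?s(16 := 0)) = khi s" by (simp_all add: klo_def khi_def)
    \<comment> \<open>The lower part and the elements equal to the pivot join those already known to
      lie below; their number is the amount by which the searched rank decreases.\<close>
    have kk: "k - (s 1 - (s 17 + s 18)) = k - s 1 + s 17 + s 18" using g I(5) by simp
    have "near (cl t) (k - (s 1 - (s 17 + s 18)) + cnt m n (n + s 19) (under t)) \<alpha>"
      if "key True (s 13) < t" "t \<le> khi s" for t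
      unfolding kk by (rule I(13)) (use that I(8) in auto)
    moreover have "1 \<le> s 1 - (s 17 + s 18)" "s 1 - (s 17 + s 18) \<le> s 19" "s 1 - (s 17 + s 18) \<le> k" "s 19 \<le> n" "s 19 \<le> 8 * v"
      using g I(2,4,5,6,7) by linarith+
    ultimately have "copy_inv v False (?s(16 := 0)) m \<alpha>" unfolding copy_inv_def kl using I(1,9,11,14,17) g
      by (simp del: Nat.add_diff_assoc2 Nat.diff_diff_right)
    then show "copy_inv v False ((ev ?high s)(16 := 0)) m \<alpha>" unfolding ev .
  qed simp_all
  have fin: "H (\<lambda>s m \<alpha>. (?P s m \<alpha> \<and> \<not> bval w le ?c1 s) \<and> \<not> bval w le ?c2 s) (Assign 14 (N 2)) 1 main_inv"
  proof (rule H_Assign[OF st3])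
    fix s m \<alpha>
    assume a: "(?P s m \<alpha> \<and> \<not> bval w le ?c1 s) \<and> \<not> bval w le ?c2 s"
    then have P: "?P s m \<alpha>" by blast
    have "s 17 < s 1" "s 1 \<le> s 17 + s 18" using a t2[OF P] by auto
    then have "answered (s(14 := 2)) m \<alpha>" using info(14,15)[OF P] unfolding answered_def by simp
    then show "main_inv (s(14 := aval w (N 2) s)) m \<alpha>" unfolding main_inv_def using n_pos by (simp add: arith_simps)
  qed simp
  have stC: "stable (\<lambda>s m \<alpha>. copy_inv v False (s(16 := 0)) m \<alpha>)"
    using copy_inv_stable[where B = "\<lambda>_. True" and h = "\<lambda>s. s(16 := 0)"] by simp
  have high': "H (\<lambda>s m \<alpha>. (?P s m \<alpha> \<and> \<not> bval w le ?c1 s) \<and> bval w le ?c2 s) (?high ;; copy_high ;; new_stage) (88 * v + 30) main_inv"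
    by (rule H_time[OF H_seq[OF high stC H_seq[OF H_copy_high stS new]]]) simp
  have no: "H (\<lambda>s m \<alpha>. ?P s m \<alpha> \<and> \<not> bval w le ?c1 s) (If ?c2 (?high ;; copy_high ;; new_stage) (Assign 14 (N 2))) (88 * v + 31) main_inv"
    by (rule H_If[OF stn high' fin]) auto
  have "H ?P (If ?c1 (?low ;; new_stage) (If ?c2 (?high ;; copy_high ;; new_stage) (Assign 14 (N 2)))) (88 * v + 32) main_inv"
    by (rule H_If[OF st H_seq[OF low stS new] no]) auto
  from H_Seq[OF H_part_loop st this] show ?thesis unfolding partition_def by simp
qed

section \<open>The main loop\<close>

lemma pot_ge:
  assumes "stk N0 NN b S fs m" "N0 \<le> mm"
  shows "NN \<le> pot mm NN fs"
proof (cases "(N0, NN, b, S, fs, m)" rule: stk.cases)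
  case (3 N0' NN' b' S' i f g fs' m')
  then have "i < 5" using assms(1) by simp
  then have "1 \<le> 25 - 6 * i" by simp
  then have "NN \<le> (25 - 6 * i) * NN" by simp
  moreover have "pot mm NN fs = (25 - 6 * i) * NN + pot mm (8 * NN) (g # fs')" using 3 by simp
  ultimately show ?thesis by (simp only: trans_le_add1)
qed (use assms in auto)

text \<open>The demand is at least \<open>s 8\<close> by \<open>pot_ge\<close>, so a lack of fuel
  for one more round forces \<open>16288 * n \<le> 6400 * con\<close>, while
  \<open>con \<le> 2 * \<alpha>\<close>.\<close>

lemma exhausted:
  assumes "core \<Phi> Pt s m \<alpha>" "s 15 < s 8"
  shows "n \<le> \<alpha>"
proof -
  obtain f fs con where f: "stk (s 9) (s 8) (s 10) (s 11) fs m" "con + f + total fs \<le> 2 * \<alpha>"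
     "16384 * n + Pt + pot (s 3) (s 8) fs \<le> 96 * n + 6400 * con + s 15" and "s 9 \<le> s 3"
    using assms(1) unfolding core_def by blast
  then have "s 8 \<le> pot (s 3) (s 8) fs" by (intro pot_ge) auto
  then have "16288 * n \<le> 6400 * con" using f(3) assms(2) by linarith
  then show ?thesis using f(2) by linarith
qed

lemma main_inv_core: "main_inv s m \<alpha> \<Longrightarrow> s 14 < 2 \<Longrightarrow> \<exists>\<Phi> Pt. core \<Phi> Pt s m \<alpha>"
  unfolding main_inv_def ready_def returning_def by (meson not_le)

lemma main_inv_stable: "stable (\<lambda>s m \<alpha>. main_inv s m \<alpha> \<and> B s)"
proof -
  have "stable main_inv"
    using ready_stable returning_stable[where h = "\<lambda>s. s"] answered_stable[where B = "\<lambda>s. 2 \<le> s 14"]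
    unfolding main_inv_def stable_def by blast
  then show ?thesis unfolding stable_def by blast
qed

lemma H_charge:
  assumes "v \<le> a"
  shows "H (\<lambda>s m \<alpha>. main_inv s m \<alpha> \<and> s 14 < 2 \<and> s 15 = a \<and> s 8 = v) (Assign 15 (Minus (R 15) (R 8))) 1
     (\<lambda>s m \<alpha>. ((s 14 = 0 \<and> s 8 = v \<and> core (\<lambda>_ _ _. True) (4 * s 8) s m \<alpha>) \<or>
        (s 14 = 1 \<and> s 8 = v \<and> returning (s(15 := s 15 + s 8)) m \<alpha>)) \<and> s 15 = a - v)"
proof (rule H_Assign[OF main_inv_stable])
  fix s m \<alpha>
  assume wf: "wf_state w s m" and a: "main_inv s m \<alpha> \<and> s 14 < 2 \<and> s 15 = a \<and> s 8 = v"
  have "s 15 < 2 ^ w" using wf unfolding wf_state_def by blast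
  then have m: "aval w (Minus (R 15) (R 8)) s = a - v" using a assms by (simp add: aval_Minus)
  let ?s = "s(15 := a - v)"
  from a consider (1) "ready s m \<alpha>" | (2) "returning s m \<alpha>" unfolding main_inv_def by auto
  then have "((?s 14 = 0 \<and> ?s 8 = v \<and> core (\<lambda>_ _ _. True) (4 * ?s 8) ?s m \<alpha>) \<or>
      (?s 14 = 1 \<and> ?s 8 = v \<and> returning (?s(15 := ?s 15 + ?s 8)) m \<alpha>)) \<and> ?s 15 = a - v" (is ?goal)
  proof cases
    case 1
    then have c: "core (\<lambda>_ _ _. True) (5 * s 8) s m \<alpha>" and s14: "s 14 = 0" unfolding ready_def by blast+
    obtain f fs con where f: "stk (s 9) (s 8) (s 10) (s 11) fs m" "con + f + total fs \<le> 2 * \<alpha>"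
       "16384 * n + 5 * s 8 + pot (s 3) (s 8) fs \<le> 96 * n + 6400 * con + s 15"
      and c': "s 0 = n \<and> outer (s 3) (s 1) (klo s) (khi s) m \<alpha> \<and> s 9 \<le> s 3 \<and> s 3 < 8 * s 9 \<and> (\<exists>e. s 8 = 8 ^ e)"
      using c unfolding core_def by blast
    have "16384 * n + 4 * s 8 + pot (s 3) (s 8) fs \<le> 96 * n + 6400 * con + (a - v)" using f(3) a assms by linarith
    then have ex: "\<exists>f fs con. stk (s 9) (s 8) (s 10) (s 11) fs m \<and> con + f + total fs \<le> 2 * \<alpha> \<and>
       16384 * n + 4 * s 8 + pot (s 3) (s 8) fs \<le> 96 * n + 6400 * con + (a - v)" using f(1,2) by blast
    have kl: "klo ?s = klo s" "khi ?s = khi s" by simp_all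
    have r: "?s 0 = s 0" "?s 1 = s 1" "?s 3 = s 3" "?s 8 = s 8" "?s 9 = s 9" "?s 10 = s 10" "?s 11 = s 11" "?s 15 = a - v" by simp_all
    have "core (\<lambda>_ _ _. True) (4 * s 8) ?s m \<alpha>" unfolding core_def kl r using c' ex by blast
    then show ?goal using s14 a by simp
  next
    case 2
    have "?s(15 := ?s 15 + ?s 8) = s" using a assms by auto
    then show ?goal using 2 a unfolding returning_def by simp
  qed
  then show "(\<lambda>s. ((s 14 = 0 \<and> s 8 = v \<and> core (\<lambda>_ _ _. True) (4 * s 8) s m \<alpha>) \<or>
        (s 14 = 1 \<and> s 8 = v \<and> returning (s(15 := s 15 + s 8)) m \<alpha>)) \<and> s 15 = a - v) (s(15 := aval w (Minus (R 15) (R 8)) s))"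
    unfolding m .
qed simp

lemma H_return:
  "H (\<lambda>s m \<alpha>. s 8 = v \<and> returning (s(15 := s 15 + s 8)) m \<alpha>) return (300 * v + 100) main_inv"
proof -
  let ?P = "\<lambda>s m \<alpha>. s 8 = v \<and> returning (s(15 := s 15 + s 8)) m \<alpha>"
  have st: "stable ?P" using returning_stable[where h = "\<lambda>s. s(15 := s 15 + s 8)"] unfolding stable_def by blast
  have top: "H (\<lambda>s m \<alpha>. ?P s m \<alpha> \<and> bval w le (Eq (R 8) (R 9)) s) partition (300 * v + 80) main_inv"
    by (rule H_pre[OF H_partition]) auto
  have round: "H (\<lambda>s m \<alpha>. ?P s m \<alpha> \<and> \<not> bval w le (Eq (R 8) (R 9)) s)
     (pop ;; count ;;
      If (And (Not (Less (Times (N 8) (R 18)) (R 8))) (Not (Less (Times (N 8) (R 19)) (R 8)))) SKIP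
        (If (Less (Times (N 8) (R 18)) (R 8)) (Assign 27 (N 0)) (Assign 27 (N 1)) ;; discard ;;
         (incr 12 ;; If (Eq (R 12) (N 5)) (Assign 14 (N 0)) push))) (150 * v + 40) main_inv"
    by (rule H_conseq[OF H_round[of v]]) (auto simp: main_inv_def)
  show ?thesis unfolding return_def by (rule H_If[OF st top round]) auto
qed

lemma fuel_modi: "15 \<notin> modi call" "15 \<notin> modi return"
  unfolding call_def return_def partition_def part_loop_def part_body_def copy_high_def new_stage_def push_def pop_def
    discard_def drop_body_def count_def count_body_def medians_def medians_body_def load5_def median5_def cmp_exch_def
    clamp_def incr_def
  by simp_all

lemma H_main_body:
  "H (\<lambda>s m \<alpha>. main_inv s m \<alpha> \<and> s 14 < 2 \<and> s 15 = a \<and> s 8 = v) main_body (if a < v then 5 else 500 * v + 200)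
     (\<lambda>s m \<alpha>. main_inv s m \<alpha> \<and> (if a < v then 2 \<le> s 14 \<and> s 15 = a else s 15 = a - v))"
proof (cases "a < v")
  case True
  let ?P = "\<lambda>s m \<alpha>. main_inv s m \<alpha> \<and> s 14 < 2 \<and> s 15 = a \<and> s 8 = v"
  let ?Q = "\<lambda>s m \<alpha>. main_inv s m \<alpha> \<and> 2 \<le> s 14 \<and> s 15 = a"
  have "H ?P main_body 5 ?Q"
    unfolding main_body_def
  proof (rule H_If[OF main_inv_stable, where ?T1.0 = 1 and ?T2.0 = 0])
    show "H (\<lambda>s m \<alpha>. ?P s m \<alpha> \<and> bval w le (Less (R 15) (R 8)) s) (Assign 14 (N 3)) 1 ?Q"
    proof (rule H_Assign)
      show "stable (\<lambda>s m \<alpha>. ?P s m \<alpha> \<and> bval w le (Less (R 15) (R 8)) s)"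
        using main_inv_stable[where B = "\<lambda>s. (s 14 < 2 \<and> s 15 = a \<and> s 8 = v) \<and> bval w le (Less (R 15) (R 8)) s"]
        by (simp only: conj_assoc)
      fix s m \<alpha>
      assume a: "?P s m \<alpha> \<and> bval w le (Less (R 15) (R 8)) s"
      then obtain \<Phi> Pt where "core \<Phi> Pt s m \<alpha>" using main_inv_core by blast
      then have "n \<le> \<alpha>" by (rule exhausted) (use a True in simp)
      moreover have "aval w (N 3) s = 3" using n_pos by (simp add: arith_simps)
      ultimately show "?Q (s(14 := aval w (N 3) s)) m \<alpha>" using a unfolding main_inv_def answered_def by simp
    qed simp
    have "H (\<lambda>s m \<alpha>. False) (Assign 15 (Minus (R 15) (R 8)) ;; If (Eq (R 14) (N 0)) call return) 0 ?Q" by (simp add: H_def)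
    then show "H (\<lambda>s m \<alpha>. ?P s m \<alpha> \<and> \<not> bval w le (Less (R 15) (R 8)) s)
       (Assign 15 (Minus (R 15) (R 8)) ;; If (Eq (R 14) (N 0)) call return) 0 ?Q"
      by (rule H_pre) (use True in auto)
  qed auto
  then show ?thesis using True by simp
next
  case False
  let ?P = "\<lambda>s m \<alpha>. main_inv s m \<alpha> \<and> s 14 < 2 \<and> s 15 = a \<and> s 8 = v"
  let ?Q = "\<lambda>s m \<alpha>. main_inv s m \<alpha> \<and> s 15 = a - v"
  let ?M1 = "\<lambda>s m \<alpha>. s 14 = 0 \<and> s 8 = v \<and> core (\<lambda>_ _ _. True) (4 * s 8) s m \<alpha>"
  let ?M2 = "\<lambda>s m \<alpha>. s 14 = 1 \<and> s 8 = v \<and> returning (s(15 := s 15 + s 8)) m \<alpha>"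
  let ?M = "\<lambda>s m \<alpha>. (?M1 s m \<alpha> \<or> ?M2 s m \<alpha>) \<and> s 15 = a - v"
  have "stable (\<lambda>s m \<alpha>. (s 14 = 0 \<and> s 8 = v) \<and> core (\<lambda>_ _ _. True) (4 * s 8) s m \<alpha>)"
    by (rule core_stable[where A = "\<lambda>s. s 14 = 0 \<and> s 8 = v" and h = "\<lambda>s. s" and \<Phi> = "\<lambda>_ _ _ _. True" and Pt = "\<lambda>s. 4 * s 8"]) auto
  then have stM: "stable ?M"
    using returning_stable[where h = "\<lambda>s. s(15 := s 15 + s 8)"] unfolding stable_def by blast
  have e0: "bval w le (Eq (R 14) (N 0)) s \<longleftrightarrow> s 14 = 0" for s by (simp add: aval.simps)
  have c: "H (\<lambda>s m \<alpha>. ?M s m \<alpha> \<and> bval w le (Eq (R 14) (N 0)) s) call (20 * v + 20) ?Q"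
  proof (rule H_conseq[OF H_frame[OF H_call fuel_modi(1)]])
    fix s m \<alpha>
    assume "?M s m \<alpha> \<and> bval w le (Eq (R 14) (N 0)) s"
    then show "(s 8 = v \<and> core (\<lambda>_ _ _. True) (4 * s 8) s m \<alpha>) \<and> s 15 = a - v" unfolding e0 by auto
  qed (auto simp: main_inv_def)
  have r: "H (\<lambda>s m \<alpha>. ?M s m \<alpha> \<and> \<not> bval w le (Eq (R 14) (N 0)) s) return (300 * v + 100) ?Q"
  proof (rule H_conseq[OF H_frame[OF H_return fuel_modi(2)]])
    fix s m \<alpha>
    assume "?M s m \<alpha> \<and> \<not> bval w le (Eq (R 14) (N 0)) s"
    then show "(s 8 = v \<and> returning (s(15 := s 15 + s 8)) m \<alpha>) \<and> s 15 = a - v" unfolding e0 by auto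
  qed auto
  have i: "H ?M (If (Eq (R 14) (N 0)) call return) (300 * v + 101) ?Q" by (rule H_If[OF stM c r]) auto
  have "H ?P (Assign 15 (Minus (R 15) (R 8)) ;; If (Eq (R 14) (N 0)) call return) (300 * v + 103) ?Q"
    by (rule H_Seq[OF H_charge stM i]) (use False in auto)
  then have s: "H (\<lambda>s m \<alpha>. ?P s m \<alpha> \<and> \<not> bval w le (Less (R 15) (R 8)) s)
      (Assign 15 (Minus (R 15) (R 8)) ;; If (Eq (R 14) (N 0)) call return) (300 * v + 103) ?Q" by (rule H_pre) blast
  have "H (\<lambda>s m \<alpha>. False) (Assign 14 (N 3)) 0 ?Q" by (simp add: H_def)
  then have "H (\<lambda>s m \<alpha>. ?P s m \<alpha> \<and> bval w le (Less (R 15) (R 8)) s) (Assign 14 (N 3)) 0 ?Q"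
    by (rule H_pre) (use False in auto)
  then have "H ?P main_body (500 * v + 200) ?Q"
    unfolding main_body_def by (rule H_If[OF main_inv_stable _ s]) auto
  then show ?thesis using False by simp
qed

text \<open>The budget is 800 steps per unit of fuel: a round on an instance of size
  \<open>z \<ge> 1\<close> takes at most \<open>500 * z + 202\<close> steps with loop overhead and
  consumes \<open>z\<close> units. The extra 800 while the mode is below 2 pays for a last round
  that finds the fuel insufficient.\<close>

lemma H_main:
  "H (\<lambda>s m \<alpha>. main_inv s m \<alpha> \<and> s 15 \<le> 16384 * n) (While (Less (R 14) (N 2)) main_body) (13108001 * n)
     (\<lambda>s m \<alpha>. 2 \<le> s 14 \<and> answered s m \<alpha>)"
proof -
  let ?b = "Less (R 14) (N 2)"
  let ?I = "\<lambda>B s m \<alpha>. main_inv s m \<alpha> \<and> 800 * (s 15 + of_bool (s 14 < 2)) \<le> B"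
  let ?\<tau> = "\<lambda>s. if s 15 < s 8 then 5 else 500 * s 8 + 200 :: nat"
  have g: "bval w le ?b s \<longleftrightarrow> s 14 < 2" for s using n_pos by (simp add: arith_simps)
  have pos: "1 \<le> s 8" if "main_inv s m \<alpha>" "s 14 < 2" for s m \<alpha>
    using main_inv_core[OF that] core_bounds(8) by blast
  have loop: "H (?I B) (While ?b main_body) (B + 1) (\<lambda>s m \<alpha>. (\<exists>B'. ?I B' s m \<alpha>) \<and> \<not> bval w le ?b s)" for B
  proof (rule H_While[where \<tau> = ?\<tau>])
    show "stable (?I B)" for B by (rule main_inv_stable)
    show "?\<tau> s + 2 \<le> B" if "?I B s m \<alpha>" "bval w le ?b s" for B s m \<alpha>
      using that(1) that(2)[unfolded g] by auto
    fix B v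
    let ?Q = "\<lambda>s m \<alpha>. \<exists>B'. ?I B' s m \<alpha> \<and> B' + v + 2 \<le> B"
    have "H (\<lambda>s m \<alpha>. \<exists>a z. (800 * (a + 1) \<le> B \<and> v = (if a < z then 5 else 500 * z + 200) \<and> 1 \<le> z) \<and>
        (main_inv s m \<alpha> \<and> s 14 < 2 \<and> s 15 = a \<and> s 8 = z)) main_body v ?Q"
    proof (intro H_ex H_pure)
      fix a z
      assume a: "800 * (a + 1) \<le> B \<and> v = (if a < z then 5 else 500 * z + 200) \<and> 1 \<le> z"
      show "H (\<lambda>s m \<alpha>. main_inv s m \<alpha> \<and> s 14 < 2 \<and> s 15 = a \<and> s 8 = z) main_body v ?Q"
      proof (rule H_conseq[OF H_main_body[of a z]])
        fix s m \<alpha>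
        assume Q: "main_inv s m \<alpha> \<and> (if a < z then 2 \<le> s 14 \<and> s 15 = a else s 15 = a - z)"
        have "800 * (s 15 + of_bool (s 14 < 2)) + v + 2 \<le> B"
        proof (cases "a < z")
          case True
          then show ?thesis using Q a by simp
        next
          case False
          then have "s 15 + z = a" "v = 500 * z + 200" using Q a by auto
          moreover have "of_bool (s 14 < 2) \<le> (1 :: nat)" by simp
          moreover have "800 * (a + 1) \<le> B" "1 \<le> z" using a by blast+
          ultimately show ?thesis unfolding distrib_left by linarith
        qed
        then show "?Q s m \<alpha>" using Q by blast
      qed (use a in auto)
    qed
    then show "H (\<lambda>s m \<alpha>. ?I B s m \<alpha> \<and> bval w le ?b s \<and> ?\<tau> s = v) main_body v ?Q"
    proof (rule H_pre)
      fix s m \<alpha>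
      assume I: "?I B s m \<alpha> \<and> bval w le ?b s \<and> ?\<tau> s = v"
      then have "s 14 < 2" using g by blast
      then show "\<exists>a z. (800 * (a + 1) \<le> B \<and> v = (if a < z then 5 else 500 * z + 200) \<and> 1 \<le> z) \<and>
        (main_inv s m \<alpha> \<and> s 14 < 2 \<and> s 15 = a \<and> s 8 = z)"
        using I pos[of s m \<alpha>] by (intro exI[of _ "s 15"] exI[of _ "s 8"]) auto
    qed
  qed
  show ?thesis
  proof (rule H_conseq[OF loop[of "800 * (16384 * n + 1)"]])
    fix s m \<alpha>
    assume "main_inv s m \<alpha> \<and> s 15 \<le> 16384 * n"
    moreover have "of_bool (s 14 < 2) \<le> (1 :: nat)" by simp
    ultimately show "?I (800 * (16384 * n + 1)) s m \<alpha>" by (intro conjI mult_le_mono2) auto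
  next
    fix s m \<alpha>
    assume "(\<exists>B'. ?I B' s m \<alpha>) \<and> \<not> bval w le ?b s"
    then show "2 \<le> s 14 \<and> answered s m \<alpha>" unfolding g main_inv_def ready_def returning_def by auto
  qed (use n_pos in simp)
qed

section \<open>The whole program and the rank of its answer\<close>

definition final_inv :: assn where
  "final_inv s m \<alpha> \<longleftrightarrow> n \<le> \<alpha> \<or> cl (key True (s 0)) < k + \<alpha> \<and> k \<le> cl (Suc (key True (s 0))) + \<alpha>"

lemma H_program:
  "H (\<lambda>s m \<alpha>. s 0 = n \<and> staged (s(3 := n, 15 := 16384 * n)) m \<alpha>) program (14000000 * n) final_inv"
proof -
  let ?P = "\<lambda>s m \<alpha>. s 0 = n \<and> staged (s(3 := n, 15 := 16384 * n)) m \<alpha>"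
  let ?S = "\<lambda>s m \<alpha>. (s 3 \<le> n \<and> staged s m \<alpha>) \<and> s 15 = 16384 * n"
  let ?i = "Assign 3 (R 0) ;; Assign 15 (Times (N 16384) (R 0))"
  have stP: "stable ?P" by (rule stable_STG)
  have stS: "stable ?S" using staged_upd unfolding stable_def by blast
  have init: "H ?P ?i 3 ?S"
  proof (rule H_reg[OF _ stP])
    fix s m \<alpha>
    assume P: "?P s m \<alpha>"
    then have "ev ?i s = s(3 := n, 15 := 16384 * n)" using n_pos by (simp add: arith_simps)
    then show "?S (ev ?i s) m \<alpha>" using P by simp
  qed simp_all
  have "15 \<notin> modi new_stage" by (simp add: new_stage_def)
  from H_frame[OF H_new_stage this]
  have stage: "H ?S new_stage (3 * n + 12) (\<lambda>s m \<alpha>. main_inv s m \<alpha> \<and> s 15 \<le> 16384 * n)"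
    by (rule H_post) (auto simp: main_inv_def)
  have last: "H (\<lambda>s m \<alpha>. 2 \<le> s 14 \<and> answered s m \<alpha>) (Assign 0 (R 13)) 1 final_inv"
    by (rule H_Assign[OF answered_stable]) (auto simp: answered_def final_inv_def)
  show ?thesis
    unfolding program_def
    by (rule H_time[OF H_seq[OF init stS H_seq[OF stage main_inv_stable H_seq[OF H_main answered_stable last]]]])
      (use n_pos in simp)
qed

lemma program_run:
  assumes "run w le (program, init_regs n k \<delta>, X) t \<alpha> (c, s, m)" "\<delta> < 2 ^ w"
  shows "t \<le> 14000000 * n" and "c = SKIP \<Longrightarrow> s 0 \<in> alpha_rank_ties le n X \<alpha> k"
proof -
  let ?s = "init_regs n k \<delta>"
  have "n < 2 ^ w" "k < 2 ^ w" using k by (auto intro!: small_n)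
  then have wf: "wf_state w ?s X" using assms(2) X by (simp add: wf_state_def init_regs_def)
  \<comment> \<open>The initial upper end \<open>2 ^ w + 1\<close> exceeds every key, so all
    \<open>n\<close> elements lie under its successor and the initial interval is
    admissible.\<close>
  have cn: "cl (Suc (Suc (2 ^ w))) = n"
  proof -
    have "(key True y < Suc (Suc (2 ^ w))) = True" for y using key_True_le[of y] by simp
    then show ?thesis unfolding cl_def cnt_def by (simp only: of_bool_eq) simp
  qed
  have "cl 0 = 0" unfolding cl_def cnt_def by simp
  then have "outer n k 0 (2 ^ w + 1) X 0" unfolding outer_def using k cn by (simp add: cl_def)
  then have "staged (?s(3 := n, 15 := 16384 * n)) X 0"
    unfolding staged_def klo_def khi_def by (simp add: init_regs_def)
  then have P: "?s 0 = n \<and> staged (?s(3 := n, 15 := 16384 * n)) X 0" by (simp add: init_regs_def)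
  have H: "t \<le> 14000000 * n \<and> (c = SKIP \<longrightarrow> final_inv s m (0 + \<alpha>))"
    using H_program assms(1) wf P unfolding H_def by blast
  then show "t \<le> 14000000 * n" by blast
  assume "c = SKIP"
  then have F: "final_inv s m \<alpha>" using H by simp
  have e: "s 0 < 2 ^ w" using run_wf[OF assms(1)] wf by (simp add: wf_state_def)
  have "(s 0, s 0) \<in> le" using linear e by (auto simp: order_on_defs refl_on_def)
  then have Fld: "s 0 \<in> Field le" by (auto simp: Field_def)
  have r: "rank le n X (s 0) = cl (Suc (key True (s 0)))" "strict_rank le n X (s 0) = cl (key True (s 0))"
    using rank_cl[OF e] strict_rank_cl[OF e] by simp_all
  have "\<exists>r \<in> ranks le n X (s 0). int r \<in> {int k - int \<alpha> .. int k + int \<alpha>}"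
  proof (cases "cl (Suc (key True (s 0))) \<le> k + \<alpha>")
    case True
    then have "int (rank le n X (s 0)) \<in> {int k - int \<alpha> .. int k + int \<alpha>}"
      using F k unfolding final_inv_def r by auto
    then show ?thesis unfolding ranks_def by blast
  next
    case False
    then have "\<not> n \<le> \<alpha>" using cl_le[of "Suc (key True (s 0))"] by linarith
    \<comment> \<open>If the rank overshoots, then \<open>k + \<alpha>\<close> itself is a position
      occupied by ties with the answer, as the strict rank is below it.\<close>
    then have "k + \<alpha> \<in> {strict_rank le n X (s 0) <.. rank le n X (s 0)}" using F False unfolding final_inv_def r by auto
    then show ?thesis unfolding ranks_def by (intro bexI[of _ "k + \<alpha>"]) auto
  qed
  then show "s 0 \<in> alpha_rank_ties le n X \<alpha> k" unfolding alpha_rank_ties_def using Fld by blast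
qed

end

section \<open>Word size and assembly of the result\<close>

lemma word_bound:
  assumes "real 16 * log 2 (real n + 1) \<le> real w" "1 \<le> n"
  shows "2 ^ 15 * (n + 1) \<le> (2 :: nat) ^ w"
proof -
  \<comment> \<open>As \<open>n + 1 \<ge> 2\<close>, fifteen factors \<open>n + 1\<close> absorb
    \<open>2 ^ 15\<close>; one more factor gives the constant 16.\<close>
  have "real (2 ^ 15 * (n + 1)) \<le> real ((n + 1) ^ 15 * (n + 1))"
    using assms(2) by (intro of_nat_mono mult_le_mono1 power_mono) auto
  also have "(n + 1) ^ 15 * (n + 1) = (n + 1) ^ 16" using power_Suc2[of "n + 1" 15] by simp
  also have "real ((n + 1) ^ 16) = (real n + 1) powr 16" by (simp add: add.commute)
  also have "\<dots> = (2 powr (log 2 (real n + 1))) powr 16" by simp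
  also have "\<dots> = 2 powr (real 16 * log 2 (real n + 1))" by (simp only: powr_powr mult.commute of_nat_numeral)
  also have "\<dots> \<le> 2 powr (real w)" using assms(1) by (intro powr_mono) auto
  also have "\<dots> = real (2 ^ w)" by (simp add: powr_realpow)
  finally show ?thesis by linarith
qed

lemma program_correct:
  assumes "2 ^ 15 * (n + 1) \<le> (2 :: nat) ^ w"
  shows "resilient_selection program w n" "time_bounded program w n (14000000 * n)"
proof -
  have sel: "sel w le n k X" if "valid_input w n le k \<delta> X" for le k \<delta> X
    using that assms unfolding valid_input_def by unfold_locales auto
  show "resilient_selection program w n"
    unfolding resilient_selection_def
  proof (intro allI impI)
    fix le k \<delta> X t \<alpha> s m
    assume v: "valid_input w n le k \<delta> X" and r: "run w le (program, init_regs n k \<delta>, X) t \<alpha> (SKIP, s, m)"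
    have "s 0 \<in> alpha_rank_ties le n X \<alpha> k"
      using sel.program_run(2)[OF sel[OF v] r] v unfolding valid_input_def by blast
    then show "s 0 \<in> (if inj_on X {..<n} then alpha_rank le n X \<alpha> k else alpha_rank_ties le n X \<alpha> k)"
      using alpha_rank_ties_eq_alpha_rank[of X n le \<alpha> k] by auto
  qed
  show "time_bounded program w n (14000000 * n)"
    unfolding time_bounded_def
  proof (intro allI impI)
    fix le k \<delta> X t \<alpha> cf
    assume v: "valid_input w n le k \<delta> X" and r: "run w le (program, init_regs n k \<delta>, X) t \<alpha> cf"
    obtain c s m where cf: "cf = (c, s, m)" by (cases cf)
    show "t \<le> 14000000 * n"
      using sel.program_run(1)[OF sel[OF v] r[unfolded cf]] v unfolding valid_input_def by blast
  qed
qed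

theorem theorem7:
  shows "\<exists>(P :: com) (c :: nat). c \<ge> 1 \<and>
    (\<forall>w. word_size c w \<longrightarrow>
      (\<exists>T :: nat \<Rightarrow> nat. (\<lambda>n. real (T n)) \<in> O(\<lambda>n. real n) \<and>
        (\<forall>n \<ge> 1. resilient_selection P (w n) n \<and> time_bounded P (w n) n (T n))))"
proof (intro exI[of _ program] exI[of _ 16] conjI allI impI)
  fix w :: "nat \<Rightarrow> nat"
  assume w: "word_size 16 w"
  show "\<exists>T :: nat \<Rightarrow> nat. (\<lambda>n. real (T n)) \<in> O(\<lambda>n. real n) \<and>
        (\<forall>n \<ge> 1. resilient_selection program (w n) n \<and> time_bounded program (w n) n (T n))"
  proof (intro exI[of _ "\<lambda>n. 14000000 * n"] conjI allI impI)
    show "(\<lambda>n. real (14000000 * n)) \<in> O(\<lambda>n. real n)" by simp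
    fix n :: nat
    assume n: "1 \<le> n"
    have b: "2 ^ 15 * (n + 1) \<le> (2 :: nat) ^ w n"
      by (rule word_bound) (use w n in \<open>auto simp: word_size_def\<close>)
    show "resilient_selection program (w n) n" "time_bounded program (w n) n (14000000 * n)"
      using program_correct[OF b] by blast+
  qed
qed simp

end
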